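(* Consider the scalar control system described in the context, with one channel use per control sample ($K_C=K_S=1$) and $\alpha>1$. The system is stabilizable if and only if $$\alpha^2<1+\mathrm{SNR}.$$ Moreover (when this condition holds) the optimal achievable infinite-horizon average stage LQG cost equals $$\bar J^{\mathrm r} = \bar J^{\mathrm t} + \frac{Q+(\alpha^2-1)S}{1+\mathrm{SNR}-\alpha^2}\,\bigl(P^{\mathrm t}-\bar P^{\mathrm t}\bigr),\qquad \bar J^{\mathrm t}=Q\,\bar P^{\mathrm t}+S\,\bigl(P^{\mathrm t}-\bar P^{\mathrm t}\bigr),$$ where $S$ and $P^{\mathrm t}$ are the positive solutions of $$S^2-\bigl[Q+(\alpha^2-1)R\bigr]S-QR=0,\qquad (P^{\mathrm t})^2-\bigl[(\alpha^2-1)V+W\bigr]P^{\mathrm t}-VW=0,$$ and $$\bar P^{\mathrm t}=\frac{P^{\mathrm t}V}{P^{\mathrm t}+V}.$$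
   Context: **System.** The scalar plant is $x_{t+1}=\alpha x_t+w_t+u_t$ with $\alpha>1$ known. The noises $w_t$ are i.i.d. $N(0,W)$ with $W>0$, $x_0\sim N(0,P_0)$, and $u_t$ is the control. The observer measures $y_t=x_t+v_t$, where the $v_t$ are i.i.d. $N(0,V)$ with $V\ge0$. Observed samples are $t=1,2,\dots,T$, and $u_0=0$. The observer and the controller are connected by a channel used exactly once per sample time: $b_t=a_t+n_t$, where the $n_t$ are i.i.d. $N(0,1/\mathrm{SNR})$, $\mathrm{SNR}>0$, and the input satisfies the unit power constraint $\mathbb E[a_t^2]\le1$. The variables $x_0$, $\{w_t\}$, $\{v_t\}$, $\{n_t\}$ are mutually independent. **Policies.** The observer (transmitter) chooses $a_t$ as a function of $y_1,\dots,y_t$ and all past controls $u_1,\dots,u_{t-1}$, which it knows. The controller (receiver) chooses $u_t$ as a function of $b_1,\dots,b_t$. **Cost.** For non-negative constants $F,Q,R$, $$\bar J_T=\frac1T\,\mathbb E\Bigl[F x_{T+1}^2+\sum_{t=1}^T(Qx_t^2+Ru_t^2)\Bigr].$$ The infinite-horizon average stage cost is $\lim_{T\to\infty}\bar J_T$ (to be read as $\limsup$ if the limit does not exist), where policies may depend on the horizon $T$. The optimal achievable cost is its infimum over all policies. The constants are assumed to be such that the LQG gains $L_t=\alpha S_{t+1}/(S_{t+1}+R)$, with $S_t=\alpha^2RS_{t+1}/(S_{t+1}+R)+Q$ and $S_{T+1}=F$, are well defined and nonzero. The system is *stabilizable* if there are observer and controller policies under which $\mathbb E[x_t^2]$ remains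 bounded in $t$. The quantities $P^{\mathrm t}$ and $\bar P^{\mathrm t}$ are the steady-state prediction and filtering error variances of the Kalman filter at the observer, and $\bar J^{\mathrm t}$ is the average stage cost achievable at the observer (no communication channel). *)

theory Defs
  imports "HOL-Probability.Probability"
begin

section \<open>Noise model\<close>

text \<open>The normal law with mean 0 and variance \<open>s\<close>; for \<open>s = 0\<close> it is the point mass at 0.\<close>

definition centered_normal :: "real \<Rightarrow> real measure" where
  "centered_normal s =
     (if s = 0 then return borel 0 else density lborel (\<lambda>z. ennreal (normal_density 0 (sqrt s) z)))"

text \<open>All primitive random variables form one family, so that joint independence of this
  family says both that each noise sequence is independent in time and that the sequences and the
  initial state are mutually independent.\<close>

datatype noise_index = Initial | Process nat | Measurement nat | Channel nat

fun noise_family ::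
  "('a \<Rightarrow> real) \<Rightarrow> (nat \<Rightarrow> 'a \<Rightarrow> real) \<Rightarrow> (nat \<Rightarrow> 'a \<Rightarrow> real) \<Rightarrow> (nat \<Rightarrow> 'a \<Rightarrow> real) \<Rightarrow> noise_index \<Rightarrow> 'a \<Rightarrow> real"
where
  "noise_family x0 w v n Initial = x0"
| "noise_family x0 w v n (Process t) = w t"
| "noise_family x0 w v n (Measurement t) = v t"
| "noise_family x0 w v n (Channel t) = n t"

section \<open>Policies and the closed loop\<close>

text \<open>A finite record \<open>z\<^sub>1, \<dots>, z\<^sub>t\<close> is an element of the product space over \<open>{1..t}\<close>. At time \<open>t\<close> a
  transmitter maps \<open>y\<^sub>1, \<dots>, y\<^sub>t\<close> and \<open>u\<^sub>1, \<dots>, u\<^bsub>t-1\<^esub>\<close> to \<open>a\<^sub>t\<close>; a receiver maps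
  \<open>b\<^sub>1, \<dots>, b\<^sub>t\<close> to \<open>u\<^sub>t\<close>.\<close>

type_synonym transmitter = "nat \<Rightarrow> (nat \<Rightarrow> real) \<Rightarrow> (nat \<Rightarrow> real) \<Rightarrow> real"
type_synonym receiver = "nat \<Rightarrow> (nat \<Rightarrow> real) \<Rightarrow> real"

definition measurable_transmitter :: "transmitter \<Rightarrow> bool" where
  "measurable_transmitter f \<longleftrightarrow>
     (\<forall>t\<ge>1. (\<lambda>(y, u). f t y u) \<in>
        borel_measurable (PiM {1..t} (\<lambda>_. borel) \<Otimes>\<^sub>M PiM {1..<t} (\<lambda>_. borel)))"

definition measurable_receiver :: "receiver \<Rightarrow> bool" where
  "measurable_receiver g \<longleftrightarrow> (\<forall>t\<ge>1. g t \<in> borel_measurable (PiM {1..t} (\<lambda>_. borel)))"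

text \<open>The closed loop for one realization \<open>x0\<close>, \<open>w\<close>, \<open>v\<close>, \<open>n\<close> of the primitive variables. Only the
  times \<open>t \<ge> 1\<close> of \<open>measured\<close>, \<open>ch_in\<close> and \<open>ch_out\<close> are ever used.\<close>

lemma restrict_fundef_cong [fundef_cong]:
  "I = J \<Longrightarrow> (\<And>s. s \<in> J \<Longrightarrow> h s = k s) \<Longrightarrow> restrict h I = restrict k J"
  by (auto simp: restrict_def)

function
  state :: "real \<Rightarrow> transmitter \<Rightarrow> receiver \<Rightarrow> real \<Rightarrow> (nat \<Rightarrow> real) \<Rightarrow> (nat \<Rightarrow> real) \<Rightarrow> (nat \<Rightarrow> real) \<Rightarrow> nat \<Rightarrow> real"
and measured :: "real \<Rightarrow> transmitter \<Rightarrow> receiver \<Rightarrow> real \<Rightarrow> (nat \<Rightarrow> real) \<Rightarrow> (nat \<Rightarrow> real) \<Rightarrow> (nat \<Rightarrow> real) \<Rightarrow> nat \<Rightarrow> real"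
and ch_in :: "real \<Rightarrow> transmitter \<Rightarrow> receiver \<Rightarrow> real \<Rightarrow> (nat \<Rightarrow> real) \<Rightarrow> (nat \<Rightarrow> real) \<Rightarrow> (nat \<Rightarrow> real) \<Rightarrow> nat \<Rightarrow> real"
and ch_out :: "real \<Rightarrow> transmitter \<Rightarrow> receiver \<Rightarrow> real \<Rightarrow> (nat \<Rightarrow> real) \<Rightarrow> (nat \<Rightarrow> real) \<Rightarrow> (nat \<Rightarrow> real) \<Rightarrow> nat \<Rightarrow> real"
and control :: "real \<Rightarrow> transmitter \<Rightarrow> receiver \<Rightarrow> real \<Rightarrow> (nat \<Rightarrow> real) \<Rightarrow> (nat \<Rightarrow> real) \<Rightarrow> (nat \<Rightarrow> real) \<Rightarrow> nat \<Rightarrow> real"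
where
  "state \<alpha> f g x0 w v n 0 = x0"
| "state \<alpha> f g x0 w v n (Suc t) =
     \<alpha> * state \<alpha> f g x0 w v n t + w t + control \<alpha> f g x0 w v n t"
| "measured \<alpha> f g x0 w v n t = state \<alpha> f g x0 w v n t + v t"
| "ch_in \<alpha> f g x0 w v n t =
     f t (\<lambda>s\<in>{1..t}. measured \<alpha> f g x0 w v n s) (\<lambda>s\<in>{1..<t}. control \<alpha> f g x0 w v n s)"
| "ch_out \<alpha> f g x0 w v n t = ch_in \<alpha> f g x0 w v n t + n t"
| "control \<alpha> f g x0 w v n t =
     (if t = 0 then 0 else g t (\<lambda>s\<in>{1..t}. ch_out \<alpha> f g x0 w v n s))"
  by pat_completeness auto
termination
  by (relation "Wellfounded.measure (\<lambda>z. case z of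
        Inl (Inl (_, _, _, _, _, _, _, t)) \<Rightarrow> 5 * t
      | Inl (Inr (_, _, _, _, _, _, _, t)) \<Rightarrow> 5 * t + 1
      | Inr (Inl (_, _, _, _, _, _, _, t)) \<Rightarrow> 5 * t + 2
      | Inr (Inr (Inl (_, _, _, _, _, _, _, t))) \<Rightarrow> 5 * t + 3
      | Inr (Inr (Inr (_, _, _, _, _, _, _, t))) \<Rightarrow> 5 * t + 4)") auto

declare measured.simps [simp del] ch_in.simps [simp del] ch_out.simps [simp del] control.simps [simp del]

text \<open>Turns a signal of the closed loop into a stochastic process.\<close>

definition process ::
  "(real \<Rightarrow> (nat \<Rightarrow> real) \<Rightarrow> (nat \<Rightarrow> real) \<Rightarrow> (nat \<Rightarrow> real) \<Rightarrow> nat \<Rightarrow> real) \<Rightarrow>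
   ('a \<Rightarrow> real) \<Rightarrow> (nat \<Rightarrow> 'a \<Rightarrow> real) \<Rightarrow> (nat \<Rightarrow> 'a \<Rightarrow> real) \<Rightarrow> (nat \<Rightarrow> 'a \<Rightarrow> real) \<Rightarrow> nat \<Rightarrow> 'a \<Rightarrow> real"
where
  "process sig x0 w v n t \<omega> = sig (x0 \<omega>) (\<lambda>s. w s \<omega>) (\<lambda>s. v s \<omega>) (\<lambda>s. n s \<omega>) t"

text \<open>Expectations of non-negative quantities are taken in \<open>[0, \<infinity>]\<close>: the Bochner integral would
  assign the value 0 to a non-integrable cost or power.\<close>

definition second_moment :: "'a measure \<Rightarrow> ('a \<Rightarrow> real) \<Rightarrow> ennreal" where
  "second_moment M X = (\<integral>\<^sup>+ \<omega>. ennreal ((X \<omega>)\<^sup>2) \<partial>M)"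

text \<open>\<open>I\<close> is the set of times at which the channel is used.\<close>

definition admissible ::
  "'a measure \<Rightarrow> real \<Rightarrow> ('a \<Rightarrow> real) \<Rightarrow> (nat \<Rightarrow> 'a \<Rightarrow> real) \<Rightarrow> (nat \<Rightarrow> 'a \<Rightarrow> real) \<Rightarrow> (nat \<Rightarrow> 'a \<Rightarrow> real) \<Rightarrow>
   nat set \<Rightarrow> transmitter \<Rightarrow> receiver \<Rightarrow> bool"
where
  "admissible M \<alpha> x0 w v n I f g \<longleftrightarrow>
     measurable_transmitter f \<and> measurable_receiver g \<and>
     (\<forall>t\<in>I. second_moment M (process (ch_in \<alpha> f g) x0 w v n t) \<le> 1)"

definition stabilizable ::
  "'a measure \<Rightarrow> real \<Rightarrow> ('a \<Rightarrow> real) \<Rightarrow> (nat \<Rightarrow> 'a \<Rightarrow> real) \<Rightarrow> (nat \<Rightarrow> 'a \<Rightarrow> real) \<Rightarrow> (nat \<Rightarrow> 'a \<Rightarrow> real) \<Rightarrow> bool"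
where
  "stabilizable M \<alpha> x0 w v n \<longleftrightarrow>
     (\<exists>f g. admissible M \<alpha> x0 w v n {1..} f g \<and>
        (\<exists>B::real. \<forall>t. second_moment M (process (state \<alpha> f g) x0 w v n t) \<le> ennreal B))"

section \<open>LQG cost\<close>

definition avg_cost ::
  "'a measure \<Rightarrow> real \<Rightarrow> real \<Rightarrow> real \<Rightarrow> nat \<Rightarrow> (nat \<Rightarrow> 'a \<Rightarrow> real) \<Rightarrow> (nat \<Rightarrow> 'a \<Rightarrow> real) \<Rightarrow> ennreal"
where
  "avg_cost M F Q R T x u =
     (\<integral>\<^sup>+ \<omega>. ennreal (F * (x (Suc T) \<omega>)\<^sup>2 + (\<Sum>t=1..T. Q * (x t \<omega>)\<^sup>2 + R * (u t \<omega>)\<^sup>2)) \<partial>M)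
       / ennreal (real T)"

text \<open>The infimum ranges over families of policies indexed by the horizon \<open>T\<close>.\<close>

definition optimal_cost ::
  "'a measure \<Rightarrow> real \<Rightarrow> real \<Rightarrow> real \<Rightarrow> real \<Rightarrow>
   ('a \<Rightarrow> real) \<Rightarrow> (nat \<Rightarrow> 'a \<Rightarrow> real) \<Rightarrow> (nat \<Rightarrow> 'a \<Rightarrow> real) \<Rightarrow> (nat \<Rightarrow> 'a \<Rightarrow> real) \<Rightarrow> ennreal"
where
  "optimal_cost M \<alpha> F Q R x0 w v n =
     Inf {limsup (\<lambda>T. avg_cost M F Q R T
            (process (state \<alpha> (f T) (g T)) x0 w v n) (process (control \<alpha> (f T) (g T)) x0 w v n))
          | f g. \<forall>T. admissible M \<alpha> x0 w v n {1..T} (f T) (g T)}"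

text \<open>Without a channel the observer itself applies \<open>u\<^sub>t\<close>, as a function of
  \<open>y\<^sub>1, \<dots>, y\<^sub>t\<close>; its own past controls are then functions of these as well.\<close>

function
  obs_state :: "real \<Rightarrow> receiver \<Rightarrow> real \<Rightarrow> (nat \<Rightarrow> real) \<Rightarrow> (nat \<Rightarrow> real) \<Rightarrow> nat \<Rightarrow> real"
and obs_control :: "real \<Rightarrow> receiver \<Rightarrow> real \<Rightarrow> (nat \<Rightarrow> real) \<Rightarrow> (nat \<Rightarrow> real) \<Rightarrow> nat \<Rightarrow> real"
where
  "obs_state \<alpha> g x0 w v 0 = x0"
| "obs_state \<alpha> g x0 w v (Suc t) =
     \<alpha> * obs_state \<alpha> g x0 w v t + w t + obs_control \<alpha> g x0 w v t"
| "obs_control \<alpha> g x0 w v t =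
     (if t = 0 then 0 else g t (\<lambda>s\<in>{1..t}. obs_state \<alpha> g x0 w v s + v s))"
  by pat_completeness auto
termination
  by (relation "Wellfounded.measure (\<lambda>z. case z of
        Inl (_, _, _, _, _, t) \<Rightarrow> 2 * t
      | Inr (_, _, _, _, _, t) \<Rightarrow> 2 * t + 1)") auto

declare obs_control.simps [simp del]

definition obs_optimal_cost ::
  "'a measure \<Rightarrow> real \<Rightarrow> real \<Rightarrow> real \<Rightarrow> real \<Rightarrow>
   ('a \<Rightarrow> real) \<Rightarrow> (nat \<Rightarrow> 'a \<Rightarrow> real) \<Rightarrow> (nat \<Rightarrow> 'a \<Rightarrow> real) \<Rightarrow> ennreal"
where
  "obs_optimal_cost M \<alpha> F Q R x0 w v =
     Inf {limsup (\<lambda>T. avg_cost M F Q R T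
            (\<lambda>t \<omega>. obs_state \<alpha> (g T) (x0 \<omega>) (\<lambda>s. w s \<omega>) (\<lambda>s. v s \<omega>) t)
            (\<lambda>t \<omega>. obs_control \<alpha> (g T) (x0 \<omega>) (\<lambda>s. w s \<omega>) (\<lambda>s. v s \<omega>) t))
          | g. \<forall>T. measurable_receiver (g T)}"

section \<open>Riccati recursions\<close>

text \<open>\<open>riccati \<alpha> F Q R k\<close> is the cost-to-go coefficient \<open>k\<close> steps before time \<open>T + 1\<close>.\<close>

primrec riccati :: "real \<Rightarrow> real \<Rightarrow> real \<Rightarrow> real \<Rightarrow> nat \<Rightarrow> real" where
  "riccati \<alpha> F Q R 0 = F"
| "riccati \<alpha> F Q R (Suc k) = \<alpha>\<^sup>2 * R * riccati \<alpha> F Q R k / (riccati \<alpha> F Q R k + R) + Q"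

definition lqg_S :: "real \<Rightarrow> real \<Rightarrow> real \<Rightarrow> real \<Rightarrow> nat \<Rightarrow> nat \<Rightarrow> real" where
  "lqg_S \<alpha> F Q R T t = riccati \<alpha> F Q R (T + 1 - t)"

definition lqg_gain :: "real \<Rightarrow> real \<Rightarrow> real \<Rightarrow> real \<Rightarrow> nat \<Rightarrow> nat \<Rightarrow> real" where
  "lqg_gain \<alpha> F Q R T t = \<alpha> * lqg_S \<alpha> F Q R T (t + 1) / (lqg_S \<alpha> F Q R T (t + 1) + R)"

text \<open>Kalman filter error variances: \<open>kalman_filt \<dots> t\<close> is that of \<open>x\<^sub>t\<close> given \<open>y\<^sub>1, \<dots>, y\<^sub>t\<close> (there is no
  measurement at time 0), and \<open>kalman_pred \<dots> t\<close> that of \<open>x\<^bsub>t+1\<^esub>\<close> given \<open>y\<^sub>1, \<dots>, y\<^sub>t\<close>.\<close>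

primrec kalman_filt :: "real \<Rightarrow> real \<Rightarrow> real \<Rightarrow> real \<Rightarrow> nat \<Rightarrow> real" where
  "kalman_filt \<alpha> W V P0 0 = P0"
| "kalman_filt \<alpha> W V P0 (Suc t) =
     (\<alpha>\<^sup>2 * kalman_filt \<alpha> W V P0 t + W) * V / (\<alpha>\<^sup>2 * kalman_filt \<alpha> W V P0 t + W + V)"

definition kalman_pred :: "real \<Rightarrow> real \<Rightarrow> real \<Rightarrow> real \<Rightarrow> nat \<Rightarrow> real" where
  "kalman_pred \<alpha> W V P0 t = \<alpha>\<^sup>2 * kalman_filt \<alpha> W V P0 t + W"

end

theory Submission
  imports Defs
begin

text \<open>
  The Kalman filter splits the plant state into the estimate at the observer, driven by its
  innovations, and an error independent of everything the observer and the channel have seen. In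
  second moments the error only adds the Kalman variances, so the problem becomes that of a fully
  observed state with Gaussian noise \<open>\<nu>\<^sub>t\<close> of variance \<open>P\<^sub>t - P'\<^sub>t\<close>, and completing the square turns its
  cost into a constant plus weighted estimation errors \<open>D\<^sub>t\<close> of a receiver that sees only the channel
  outputs.

  For the lower bound on the \<open>D\<^sub>t\<close> no entropy is needed. Fix target variances \<open>d\<^sub>t\<close> and put
  \<open>\<sigma>\<^sub>t = \<alpha>\<^sup>2 d\<^bsub>t-1\<^esub> + var \<nu>\<^sub>t\<close>. With \<open>e\<^sub>t\<close> the estimation error and \<open>\<phi>\<^sub>s\<close> the centered normal density of
  variance \<open>s\<close>, the product of the ratios
  \<open>\<phi>\<^bsub>d\<^sub>t\<^esub>(e\<^sub>t) / \<phi>\<^bsub>\<sigma>\<^sub>t\<^esub>(\<alpha> e\<^bsub>t-1\<^esub> + \<nu>\<^sub>t) \<cdot> \<phi>\<^bsub>1+1/SNR\<^esub>(b\<^sub>t) / \<phi>\<^bsub>1/SNR\<^esub>(n\<^sub>t)\<close> has expectation 1, whatever the policy: under this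
  density the outputs \<open>b\<^sub>t\<close> are independent and \<open>e\<^sub>t\<close> is normal with variance \<open>d\<^sub>t\<close> and independent of
  them. Hence the expectation of its logarithm is at most 0, and this is a linear inequality for
  the \<open>D\<^sub>t\<close>. With \<open>d\<^sub>t\<close> constant except near both ends of the horizon it gives the optimal average
  \<open>var \<nu> / (1 + SNR - \<alpha>\<^sup>2)\<close>; with \<open>d\<^sub>t\<close> a bound on the state it rules out stability when
  \<open>\<alpha>\<^sup>2 \<ge> 1 + SNR\<close>. Transmitting the scaled prediction error of the receiver attains the bound.
\<close>

text \<open>For arbitrary measurable policies the conditional law of the error given the outputs is
  out of reach. The weighted product avoids it: its factors are fixed normal densities evaluated at
  the variables at hand. From expectation 1 the bound follows by \<open>ln x \<le> x - 1\<close>;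
  the exponents contribute second moments, and the power constraint enters only through that of
  \<open>b\<close>, at most 1 + 1/SNR. The constant comes from the fixed point d = (\<alpha>^2 d +
  var \<nu>) / (1 + SNR). There each logarithm is exactly the ln(1 + SNR) / 2 allowed per channel
  use, and what remains compares the average error with d. The same map with current variances is
  the error recursion of the linear scheme, which is why the two bounds meet. The obstacle is at the
  ends of the horizon: cost weights come from a Riccati recursion running backwards, variances from
  a Kalman recursion running forwards, and neither is at its limit throughout. Finitely many stages
  are given up, at a price that vanishes in the average, together with factors \<theta> < 1 that
  tend to 1 at the end. Moments live in [0, \<infinity>], so policies of infinite cost need no
  integrability hypotheses.\<close>

lemma subalgebra_measurable_ident:
  "subalgebra M G \<longleftrightarrow> space G = space M \<and> (\<lambda>\<omega>. \<omega>) \<in> measurable M G"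
proof -
  have "(\<lambda>\<omega>. \<omega>) -` A \<inter> space M = A" if "A \<in> sets G" "space G = space M" for A
    using sets.sets_into_space[OF that(1)] that(2) by auto
  then show ?thesis unfolding subalgebra_def measurable_def by auto
qed

section \<open>Independence of a real variable from a sub-sigma-algebra\<close>

text \<open>Law and independence are kept together, because the likelihood argument replaces
  \<open>M\<close> by a density measure under which both change. The preimage of \<open>B\<close> is
  not intersected with the space, since \<open>A\<close> already lies in it.\<close>

definition indep_of :: "'a measure \<Rightarrow> 'a measure \<Rightarrow> ('a \<Rightarrow> real) \<Rightarrow> real measure \<Rightarrow> bool" where
  "indep_of M G Z \<mu> \<longleftrightarrow>
     subalgebra M G \<and> Z \<in> borel_measurable M \<and> prob_space \<mu> \<and> sets \<mu> = sets borel \<and>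
     (\<forall>A\<in>sets G. \<forall>B\<in>sets borel. emeasure M (Z -` B \<inter> A) = emeasure \<mu> B * emeasure M A)"

lemma indep_ofD:
  assumes "indep_of M G Z \<mu>"
  shows "subalgebra M G" "Z \<in> borel_measurable M" "prob_space \<mu>" "sets \<mu> = sets borel"
  using assms by (auto simp: indep_of_def)

text \<open>The map from \<omega> to \<open>(Z \<omega>, \<omega>)\<close> carries \<open>M\<close>
  to the product of \<open>\<mu>\<close> with the restriction of \<open>M\<close> to
  \<open>G\<close>, as rectangles show; then Tonelli. This is the freezing rule: \<open>Z\<close> is
  integrated out while everything measurable in \<open>G\<close> is held fixed.\<close>

lemma nn_integral_indep_of:
  assumes M: "prob_space M" and ind: "indep_of M G Z \<mu>"
    and h: "(\<lambda>(z, \<omega>). h z \<omega>) \<in> borel_measurable (borel \<Otimes>\<^sub>M G)"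
  shows "(\<integral>\<^sup>+\<omega>. h (Z \<omega>) \<omega> \<partial>M) = (\<integral>\<^sup>+\<omega>. \<integral>\<^sup>+z. h z \<omega> \<partial>\<mu> \<partial>M)"
proof -
  interpret M: prob_space M by fact
  note sub = indep_ofD(1)[OF ind] and [measurable] = indep_ofD(2)[OF ind]
  interpret mu: prob_space \<mu> using indep_ofD(3)[OF ind] .
  note s[measurable_cong] = indep_ofD(4)[OF ind]
  let ?R = "restr_to_subalg M G"
  have sp: "space G = space M" using sub by (simp add: subalgebra_def)
  interpret R: prob_space ?R by (rule prob_space_restr_to_subalg[OF sub M])
  interpret PS: pair_sigma_finite \<mu> ?R ..
  note [measurable_cong] = sets_restr_to_subalg[OF sub]
  have id[measurable]: "(\<lambda>\<omega>. \<omega>) \<in> measurable M G"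
    using sub by (simp add: subalgebra_measurable_ident)
  have eq: "\<mu> \<Otimes>\<^sub>M ?R = distr M (borel \<Otimes>\<^sub>M G) (\<lambda>\<omega>. (Z \<omega>, \<omega>))"
  proof (rule pair_measure_eqI)
    show "sigma_finite_measure \<mu>" ..
    show "sigma_finite_measure ?R" ..
    show "sets (\<mu> \<Otimes>\<^sub>M ?R) = sets (distr M (borel \<Otimes>\<^sub>M G) (\<lambda>\<omega>. (Z \<omega>, \<omega>)))"
      by (simp cong: sets_pair_measure_cong add: s sets_restr_to_subalg[OF sub])
    fix A B assume A: "A \<in> sets \<mu>" and B: "B \<in> sets ?R"
    have A': "A \<in> sets borel" "B \<in> sets G" using A B s sets_restr_to_subalg[OF sub] by auto
    have "emeasure (distr M (borel \<Otimes>\<^sub>M G) (\<lambda>\<omega>. (Z \<omega>, \<omega>))) (A \<times> B)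
        = emeasure M ((\<lambda>\<omega>. (Z \<omega>, \<omega>)) -` (A \<times> B) \<inter> space M)"
      using A' by (intro emeasure_distr) auto
    also have "(\<lambda>\<omega>. (Z \<omega>, \<omega>)) -` (A \<times> B) \<inter> space M = Z -` A \<inter> B"
      using sets.sets_into_space[OF A'(2)] sp by auto
    also have "emeasure M \<dots> = emeasure \<mu> A * emeasure M B"
      using ind A' by (auto simp: indep_of_def)
    finally show "emeasure \<mu> A * emeasure ?R B = emeasure (distr M (borel \<Otimes>\<^sub>M G) (\<lambda>\<omega>. (Z \<omega>, \<omega>))) (A \<times> B)"
      using emeasure_restr_to_subalg[OF sub A'(2)] by simp
  qed
  have h'[measurable]: "(\<lambda>(z, \<omega>). h z \<omega>) \<in> borel_measurable (\<mu> \<Otimes>\<^sub>M ?R)"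
    using h by (simp cong: measurable_cong_sets sets_pair_measure_cong add: s sets_restr_to_subalg[OF sub])
  have "(\<integral>\<^sup>+\<omega>. h (Z \<omega>) \<omega> \<partial>M) = (\<integral>\<^sup>+x. (case x of (z, \<omega>) \<Rightarrow> h z \<omega>) \<partial>distr M (borel \<Otimes>\<^sub>M G) (\<lambda>\<omega>. (Z \<omega>, \<omega>)))"
    by (subst nn_integral_distr) (use h in auto)
  also have "\<dots> = (\<integral>\<^sup>+x. (case x of (z, \<omega>) \<Rightarrow> h z \<omega>) \<partial>(\<mu> \<Otimes>\<^sub>M ?R))" by (simp only: eq)
  also have "\<dots> = (\<integral>\<^sup>+\<omega>. \<integral>\<^sup>+z. h z \<omega> \<partial>\<mu> \<partial>?R)"
    by (subst PS.nn_integral_snd[symmetric]) auto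
  also have "\<dots> = (\<integral>\<^sup>+\<omega>. \<integral>\<^sup>+z. h z \<omega> \<partial>\<mu> \<partial>M)"
  proof (rule nn_integral_subalgebra2[OF sub])
    show "(\<lambda>\<omega>. \<integral>\<^sup>+z. h z \<omega> \<partial>\<mu>) \<in> borel_measurable G"
      using h by measurable
  qed
  finally show ?thesis .
qed

lemma nn_integral_indep_of_compose:
  assumes "prob_space M" "indep_of M G Z \<mu>" and f: "f \<in> measurable G N"
    and h: "(\<lambda>(z, y). h z y) \<in> borel_measurable (borel \<Otimes>\<^sub>M N)"
  shows "(\<integral>\<^sup>+\<omega>. h (Z \<omega>) (f \<omega>) \<partial>M) = (\<integral>\<^sup>+\<omega>. \<integral>\<^sup>+z. h z (f \<omega>) \<partial>\<mu> \<partial>M)"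
proof -
  have "(\<lambda>x. (fst x, f (snd x))) \<in> measurable (borel \<Otimes>\<^sub>M G) (borel \<Otimes>\<^sub>M N)"
    by (intro measurable_Pair measurable_fst measurable_compose[OF measurable_snd f])
  from measurable_compose[OF this h]
  have "(\<lambda>(z, \<omega>). h z (f \<omega>)) \<in> borel_measurable (borel \<Otimes>\<^sub>M G)" by (simp add: case_prod_beta)
  then show ?thesis by (rule nn_integral_indep_of[OF assms(1,2)])
qed

lemma indep_of_mono:
  assumes "indep_of M G Z \<mu>" "subalgebra G H"
  shows "indep_of M H Z \<mu>"
  using assms unfolding indep_of_def subalgebra_def by auto

lemma indep_of_nn_integralI:
  assumes sub: "subalgebra M G" and Z[measurable]: "Z \<in> borel_measurable M"
    and mu: "prob_space \<mu>" "sets \<mu> = sets borel"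
    and eq: "\<And>A B. A \<in> sets G \<Longrightarrow> B \<in> sets (borel :: real measure) \<Longrightarrow>
      (\<integral>\<^sup>+\<omega>. indicator B (Z \<omega>) * indicator A \<omega> \<partial>M) = emeasure \<mu> B * emeasure M A"
  shows "indep_of M G Z \<mu>"
  unfolding indep_of_def
proof (intro conjI ballI sub Z mu)
  fix A and B :: "real set" assume A: "A \<in> sets G" and B[measurable]: "B \<in> sets borel"
  have A'[measurable]: "A \<in> sets M" using A sub by (auto simp: subalgebra_def)
  have m: "Z -` B \<inter> A \<in> sets M"
  proof -
    have "Z -` B \<inter> A = (Z -` B \<inter> space M) \<inter> A" using sets.sets_into_space[OF A'] by auto
    then show ?thesis by simp
  qed
  have "emeasure M (Z -` B \<inter> A) = (\<integral>\<^sup>+\<omega>. indicator (Z -` B \<inter> A) \<omega> \<partial>M)" using m by simp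
  also have "\<dots> = (\<integral>\<^sup>+\<omega>. indicator B (Z \<omega>) * indicator A \<omega> \<partial>M)"
    by (intro nn_integral_cong) (auto simp: indicator_def)
  finally show "emeasure M (Z -` B \<inter> A) = emeasure \<mu> B * emeasure M A" using eq[OF A B] by simp
qed

lemma indep_of_scale:
  assumes M: "prob_space M" and ind: "indep_of M G Z \<mu>"
  shows "indep_of M G (\<lambda>\<omega>. c * Z \<omega>) (distr \<mu> borel (\<lambda>z. c * z))"
proof -
  note [measurable] = indep_ofD(2)[OF ind] and s[measurable_cong] = indep_ofD(4)[OF ind]
  interpret mu: prob_space \<mu> using indep_ofD(3)[OF ind] .
  have m: "(\<lambda>z. c * z) \<in> borel_measurable \<mu>" by measurable
  show ?thesis unfolding indep_of_def
  proof (intro conjI ballI)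
    fix A B assume A: "A \<in> sets G" and B: "B \<in> sets (borel :: real measure)"
    have B': "(\<lambda>z. c * z) -` B \<in> sets borel"
      using measurable_sets[of "\<lambda>z::real. c * z" borel borel B] B by simp
    have "(\<lambda>\<omega>. c * Z \<omega>) -` B \<inter> A = Z -` ((\<lambda>z. c * z) -` B) \<inter> A" by auto
    then have "emeasure M ((\<lambda>\<omega>. c * Z \<omega>) -` B \<inter> A) = emeasure \<mu> ((\<lambda>z. c * z) -` B) * emeasure M A"
      using ind A B' by (auto simp: indep_of_def)
    then show "emeasure M ((\<lambda>\<omega>. c * Z \<omega>) -` B \<inter> A) = emeasure (distr \<mu> borel (\<lambda>z. c * z)) B * emeasure M A"
      using B m s by (simp add: emeasure_distr sets_eq_imp_space_eq[OF s])
  qed (use indep_ofD[OF ind] m in \<open>auto intro!: mu.prob_space_distr\<close>)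
qed

section \<open>Adjoining a real variable to a sigma-algebra\<close>

text \<open>The sigma-algebra generated by \<open>G\<close> and \<open>X\<close>. As a pullback
  along the graph of \<open>X\<close>, its sets and functions factor through
  \<open>(\<omega>, X \<omega>)\<close>, with \<omega> seen only through \<open>G\<close>.\<close>

definition adjoin :: "'a measure \<Rightarrow> ('a \<Rightarrow> real) \<Rightarrow> 'a measure" where
  "adjoin G X = vimage_algebra (space G) (\<lambda>\<omega>. (\<omega>, X \<omega>)) (G \<Otimes>\<^sub>M borel)"

lemma space_adjoin [simp]: "space (adjoin G X) = space G"
  by (simp add: adjoin_def)

lemma measurable_adjoin_pair: "(\<lambda>\<omega>. (\<omega>, X \<omega>)) \<in> measurable (adjoin G X) (G \<Otimes>\<^sub>M borel)"
  unfolding adjoin_def by (rule measurable_vimage_algebra1) (auto simp: space_pair_measure)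

lemma measurable_adjoin_ident: "(\<lambda>\<omega>. \<omega>) \<in> measurable (adjoin G X) G"
  using measurable_compose[OF measurable_adjoin_pair measurable_fst] by simp

lemma measurable_adjoin_new: "X \<in> borel_measurable (adjoin G X)"
  using measurable_compose[OF measurable_adjoin_pair measurable_snd] by simp

lemma measurable_adjoin:
  "f \<in> measurable G N \<Longrightarrow> f \<in> measurable (adjoin G X) N"
  by (rule measurable_compose[OF measurable_adjoin_ident])

lemma subalgebra_adjoin: "subalgebra (adjoin G X) G"
  by (simp add: subalgebra_measurable_ident measurable_adjoin_ident)

lemma adjoin_least:
  assumes sub: "subalgebra A G" and X[measurable]: "X \<in> borel_measurable A"
  shows "subalgebra A (adjoin G X)"
proof -
  have sp: "space G = space A" and [measurable]: "(\<lambda>\<omega>. \<omega>) \<in> measurable A G"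
    using sub by (auto simp: subalgebra_measurable_ident)
  have "(\<lambda>\<omega>. \<omega>) \<in> measurable A (adjoin G X)"
    unfolding adjoin_def by (rule measurable_vimage_algebra2) (auto simp: sp)
  then show ?thesis by (simp add: subalgebra_measurable_ident sp)
qed

lemma subalgebra_trans: "subalgebra M G \<Longrightarrow> subalgebra G H \<Longrightarrow> subalgebra M H"
  by (auto simp: subalgebra_def)

lemma subalgebra_refl: "subalgebra M M"
  by (auto simp: subalgebra_def)

lemma sets_adjoinE:
  assumes "A \<in> sets (adjoin G X)"
  obtains A' where "A' \<in> sets (G \<Otimes>\<^sub>M borel)" "A = {\<omega>\<in>space G. (\<omega>, X \<omega>) \<in> A'}"
proof -
  have "sets (adjoin G X) = {(\<lambda>\<omega>. (\<omega>, X \<omega>)) -` A \<inter> space G |A. A \<in> sets (G \<Otimes>\<^sub>M borel)}"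
    unfolding adjoin_def by (rule sets_vimage_algebra2) (auto simp: space_pair_measure)
  with assms obtain A' where "A' \<in> sets (G \<Otimes>\<^sub>M borel)" "A = (\<lambda>\<omega>. (\<omega>, X \<omega>)) -` A' \<inter> space G" by auto
  then show ?thesis by (intro that[of A']) auto
qed

text \<open>Doob-Dynkin factorisation, by induction over indicators, linear combinations and
  suprema.\<close>

lemma adjoin_factor_ennreal:
  fixes f :: "'a \<Rightarrow> ennreal"
  assumes "f \<in> borel_measurable (adjoin G X)"
  shows "\<exists>k\<in>borel_measurable (G \<Otimes>\<^sub>M borel). \<forall>\<omega>\<in>space G. f \<omega> = k (\<omega>, X \<omega>)"
  using assms
proof (induction rule: borel_measurable_induct)
  case (cong f g)
  then show ?case by auto
next
  case (set A)
  then obtain A' where "A' \<in> sets (G \<Otimes>\<^sub>M borel)" "A = {\<omega>\<in>space G. (\<omega>, X \<omega>) \<in> A'}"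
    by (elim sets_adjoinE)
  then show ?case by (intro bexI[of _ "indicator A'"]) (auto simp: indicator_def)
next
  case (mult u c)
  then obtain k where "k\<in>borel_measurable (G \<Otimes>\<^sub>M borel)" "\<forall>\<omega>\<in>space G. u \<omega> = k (\<omega>, X \<omega>)" by blast
  then show ?case by (intro bexI[of _ "\<lambda>x. c * k x"]) auto
next
  case (add u v)
  then obtain k l where "k\<in>borel_measurable (G \<Otimes>\<^sub>M borel)" "\<forall>\<omega>\<in>space G. u \<omega> = k (\<omega>, X \<omega>)"
    "l\<in>borel_measurable (G \<Otimes>\<^sub>M borel)" "\<forall>\<omega>\<in>space G. v \<omega> = l (\<omega>, X \<omega>)" by blast
  then show ?case by (intro bexI[of _ "\<lambda>x. l x + k x"]) auto
next
  case (seq U)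
  then have "\<forall>i. \<exists>k\<in>borel_measurable (G \<Otimes>\<^sub>M borel). \<forall>\<omega>\<in>space G. U i \<omega> = k (\<omega>, X \<omega>)" by blast
  then obtain k where k: "\<And>i. k i \<in>borel_measurable (G \<Otimes>\<^sub>M borel)"
    "\<And>i \<omega>. \<omega>\<in>space G \<Longrightarrow> U i \<omega> = k i (\<omega>, X \<omega>)" by metis
  show ?case
    by (rule bexI[of _ "\<lambda>x. SUP i. k i x"]) (use k in \<open>auto simp: image_comp\<close>)
qed

lemma adjoin_factor:
  fixes f :: "'a \<Rightarrow> real"
  assumes f[measurable]: "f \<in> borel_measurable (adjoin G X)"
  obtains k where "(\<lambda>(\<omega>, x). k \<omega> x) \<in> borel_measurable (G \<Otimes>\<^sub>M borel)"
    "\<And>\<omega>. \<omega> \<in> space G \<Longrightarrow> f \<omega> = k \<omega> (X \<omega>)"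
proof -
  obtain k where k[measurable]: "k\<in>borel_measurable (G \<Otimes>\<^sub>M borel)"
    "\<And>\<omega>. \<omega>\<in>space G \<Longrightarrow> ennreal (f \<omega>) = k (\<omega>, X \<omega>)"
    using adjoin_factor_ennreal[of "\<lambda>\<omega>. ennreal (f \<omega>)" G X] by auto
  obtain l where l[measurable]: "l\<in>borel_measurable (G \<Otimes>\<^sub>M borel)"
    "\<And>\<omega>. \<omega>\<in>space G \<Longrightarrow> ennreal (- f \<omega>) = l (\<omega>, X \<omega>)"
    using adjoin_factor_ennreal[of "\<lambda>\<omega>. ennreal (- f \<omega>)" G X] by auto
  \<comment> \<open>\<open>ennreal\<close> sends negative reals to 0, so \<open>k\<close> and
    \<open>l\<close> represent the positive and negative parts of \<open>f\<close>.\<close>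
  show ?thesis
  proof (rule that[of "\<lambda>\<omega> x. enn2real (k (\<omega>, x)) - enn2real (l (\<omega>, x))"])
    show "(\<lambda>(\<omega>, x). enn2real (k (\<omega>, x)) - enn2real (l (\<omega>, x))) \<in> borel_measurable (G \<Otimes>\<^sub>M borel)"
      by measurable
    fix \<omega> assume "\<omega> \<in> space G"
    then show "f \<omega> = enn2real (k (\<omega>, X \<omega>)) - enn2real (l (\<omega>, X \<omega>))"
      by (cases "f \<omega> \<ge> 0") (simp_all flip: k(2) l(2) add: ennreal_neg)
  qed
qed

lemma nn_integral_indep_of_right:
  assumes "prob_space M" "indep_of M G Z \<mu>"
    and h: "(\<lambda>(\<omega>, z). h \<omega> z) \<in> borel_measurable (G \<Otimes>\<^sub>M borel)"
  shows "(\<integral>\<^sup>+\<omega>. h \<omega> (Z \<omega>) \<partial>M) = (\<integral>\<^sup>+\<omega>. \<integral>\<^sup>+z. h \<omega> z \<partial>\<mu> \<partial>M)"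
proof -
  have "(\<lambda>(z, \<omega>). h \<omega> z) \<in> borel_measurable (borel \<Otimes>\<^sub>M G)"
    using measurable_pair_swap[OF h] by (simp add: case_prod_beta)
  then show ?thesis by (rule nn_integral_indep_of[OF assms(1,2)])
qed

text \<open>Integrating \<open>Y\<close> out of an event of \<open>adjoin G Y\<close> leaves a
  function \<open>k\<close> measurable in \<open>G\<close>, from which \<open>Z\<close> is
  independent. This allows a fresh channel noise to join the information against which the Kalman
  error is independent.\<close>

lemma indep_of_adjoin_swap:
  assumes M: "prob_space M" and Z: "indep_of M G Z \<mu>" and Y: "indep_of M (adjoin G Z) Y \<eta>"
  shows "indep_of M (adjoin G Y) Z \<mu>"
proof (rule indep_of_nn_integralI)
  note sub = indep_ofD(1)[OF Z] and [measurable] = indep_ofD(2)[OF Z] indep_ofD(2)[OF Y]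
  interpret M: prob_space M by fact
  interpret eta: prob_space \<eta> using indep_ofD(3)[OF Y] .
  interpret mu: prob_space \<mu> using indep_ofD(3)[OF Z] .
  note [measurable_cong] = indep_ofD(4)[OF Z] indep_ofD(4)[OF Y]
  have sp: "space G = space M" using sub by (simp add: subalgebra_def)
  have idM[measurable]: "(\<lambda>\<omega>. \<omega>) \<in> measurable M G"
    using sub by (simp add: subalgebra_measurable_ident)
  show "subalgebra M (adjoin G Y)" by (rule adjoin_least[OF sub]) simp
  show "Z \<in> borel_measurable M" "prob_space \<mu>" "sets \<mu> = sets borel"
    using indep_ofD[OF Z] by auto
  fix A B assume A: "A \<in> sets (adjoin G Y)" and B[measurable]: "B \<in> sets (borel::real measure)"
  obtain A' where A'[measurable]: "A' \<in> sets (G \<Otimes>\<^sub>M borel)" and Aeq: "A = {\<omega>\<in>space G. (\<omega>, Y \<omega>) \<in> A'}"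
    using A by (elim sets_adjoinE)
  have [measurable]: "(\<lambda>\<omega>. \<omega>) \<in> measurable (adjoin G Z) G" by (rule measurable_adjoin_ident)
  have [measurable]: "Z \<in> borel_measurable (adjoin G Z)" by (rule measurable_adjoin_new)
  have Bmu[measurable]: "B \<in> sets \<mu>" using B indep_ofD(4)[OF Z] by simp
  define k where "k \<omega> = (\<integral>\<^sup>+y. indicator A' (\<omega>, y) \<partial>\<eta>)" for \<omega>
  have k[measurable]: "k \<in> borel_measurable G" unfolding k_def by measurable
  have sect: "(\<lambda>y. indicator A' (\<omega>, y) :: ennreal) \<in> borel_measurable \<eta>" if "\<omega> \<in> space M" for \<omega>
    using that by (intro measurable_compose[OF measurable_Pair1'[of \<omega> G borel]
          borel_measurable_indicator[OF A'], THEN measurable_cong_sets[OF indep_ofD(4)[OF Y] refl, THEN equalityD2, THEN subsetD]])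
      (simp add: sp)
  have *: "(\<integral>\<^sup>+\<omega>. f (Z \<omega>) * indicator A \<omega> \<partial>M) = (\<integral>\<^sup>+\<omega>. f (Z \<omega>) * k \<omega> \<partial>M)"
    if [measurable]: "f \<in> borel_measurable borel" for f :: "real \<Rightarrow> ennreal"
  proof -
    have "(\<integral>\<^sup>+\<omega>. f (Z \<omega>) * indicator A \<omega> \<partial>M) = (\<integral>\<^sup>+\<omega>. f (Z \<omega>) * indicator A' (\<omega>, Y \<omega>) \<partial>M)"
      by (intro nn_integral_cong) (auto simp: Aeq indicator_def sp)
    also have "\<dots> = (\<integral>\<^sup>+\<omega>. \<integral>\<^sup>+y. f (Z \<omega>) * indicator A' (\<omega>, y) \<partial>\<eta> \<partial>M)"
      by (rule nn_integral_indep_of_right[OF M Y]) measurable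
    also have "\<dots> = (\<integral>\<^sup>+\<omega>. f (Z \<omega>) * k \<omega> \<partial>M)"
      unfolding k_def by (intro nn_integral_cong nn_integral_cmult sect)
    finally show ?thesis .
  qed
  have kM[measurable]: "k \<in> borel_measurable M" using measurable_compose[OF idM k] by simp
  have "(\<integral>\<^sup>+\<omega>. indicator B (Z \<omega>) * indicator A \<omega> \<partial>M) = (\<integral>\<^sup>+\<omega>. indicator B (Z \<omega>) * k \<omega> \<partial>M)"
    by (rule *) measurable
  also have "\<dots> = (\<integral>\<^sup>+\<omega>. \<integral>\<^sup>+z. indicator B z * k \<omega> \<partial>\<mu> \<partial>M)"
    by (rule nn_integral_indep_of[OF M Z]) measurable
  also have "\<dots> = (\<integral>\<^sup>+\<omega>. emeasure \<mu> B * k \<omega> \<partial>M)"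
    by (intro nn_integral_cong) (simp add: nn_integral_multc Bmu)
  also have "\<dots> = emeasure \<mu> B * (\<integral>\<^sup>+\<omega>. k \<omega> \<partial>M)" by (simp add: nn_integral_cmult)
  also have "(\<integral>\<^sup>+\<omega>. k \<omega> \<partial>M) = (\<integral>\<^sup>+\<omega>. indicator A \<omega> \<partial>M)" using *[of "\<lambda>_. 1"] by simp
  also have "\<dots> = emeasure M A"
    using A \<open>subalgebra M (adjoin G Y)\<close> by (auto simp: subalgebra_def)
  finally show "(\<integral>\<^sup>+\<omega>. indicator B (Z \<omega>) * indicator A \<omega> \<partial>M) = emeasure \<mu> B * emeasure M A" .
qed

section \<open>Centered normal laws\<close>

abbreviation (input) "\<N> \<equiv> centered_normal"

lemma sets_centered_normal [simp, measurable_cong]: "sets (\<N> s) = sets borel"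
  by (simp add: centered_normal_def)

lemma space_centered_normal [simp]: "space (\<N> s) = UNIV"
  by (simp add: centered_normal_def)

lemma prob_space_centered_normal: "0 \<le> s \<Longrightarrow> prob_space (\<N> s)"
  by (auto simp: centered_normal_def intro!: prob_space_return prob_space_normal_density)

lemma nn_integral_centered_normal_0:
  "f \<in> borel_measurable borel \<Longrightarrow> (\<integral>\<^sup>+x. f x \<partial>\<N> 0) = f 0"
  by (simp add: centered_normal_def nn_integral_return)

lemma nn_integral_centered_normal:
  assumes [measurable]: "f \<in> borel_measurable borel" and "0 < s"
  shows "(\<integral>\<^sup>+x. f x \<partial>\<N> s) =
    (\<integral>\<^sup>+x. ennreal (normal_density 0 (sqrt s) x) * f x \<partial>lborel)"
  using assms(2) by (simp add: centered_normal_def nn_integral_density)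

lemma nn_integral_centered_normal_indicator:
  "B \<in> sets borel \<Longrightarrow>
    (\<integral>\<^sup>+x. indicator B x * c \<partial>\<N> s) = emeasure (\<N> s) B * c"
  by (rule nn_integral_multc[THEN trans], auto intro!: borel_measurable_indicator)

lemma nn_integral_centered_normal_square:
  assumes s: "0 \<le> s"
  shows "(\<integral>\<^sup>+x. ennreal ((c + b * x)\<^sup>2) \<partial>\<N> s) = ennreal (c\<^sup>2 + b\<^sup>2 * s)"
proof (cases "s = 0")
  case True
  then show ?thesis by (simp add: nn_integral_centered_normal_0)
next
  case False
  with s have s: "0 < s" by simp
  let ?\<phi> = "normal_density 0 (sqrt s)"
  have 2: "has_bochner_integral lborel (\<lambda>x. ?\<phi> x * x\<^sup>2) s"
    using normal_moment_even[of "sqrt s" 0 1] s by simp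
  have 1: "has_bochner_integral lborel (\<lambda>x. ?\<phi> x * x) 0"
    using normal_moment_nz_1[of "sqrt s" 0] s by simp
  have 0: "has_bochner_integral lborel ?\<phi> 1"
    using s by (simp add: has_bochner_integral_iff)
  have "has_bochner_integral lborel (\<lambda>x. c\<^sup>2 * ?\<phi> x + (2 * c * b * (?\<phi> x * x) + b\<^sup>2 * (?\<phi> x * x\<^sup>2)))
     (c\<^sup>2 * 1 + (2 * c * b * 0 + b\<^sup>2 * s))"
    by (intro has_bochner_integral_add has_bochner_integral_mult_right 0 1 2)
  also have "(\<lambda>x. c\<^sup>2 * ?\<phi> x + (2 * c * b * (?\<phi> x * x) + b\<^sup>2 * (?\<phi> x * x\<^sup>2))) = (\<lambda>x. ?\<phi> x * (c + b * x)\<^sup>2)"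
    by (auto simp: algebra_simps power2_eq_square)
  finally have "has_bochner_integral lborel (\<lambda>x. ?\<phi> x * (c + b * x)\<^sup>2) (c\<^sup>2 + b\<^sup>2 * s)" by simp
  then have "(\<integral>\<^sup>+x. ennreal (?\<phi> x * (c + b * x)\<^sup>2) \<partial>lborel) = ennreal (c\<^sup>2 + b\<^sup>2 * s)"
    by (subst nn_integral_eq_integral) (auto simp: has_bochner_integral_iff)
  then show ?thesis using s by (simp add: nn_integral_centered_normal ennreal_mult)
qed

lemma distr_centered_normal_scale:
  assumes s: "0 \<le> s"
  shows "distr (\<N> s) borel (\<lambda>x. c * x) = \<N> (c\<^sup>2 * s)"
proof (cases "c = 0 \<or> s = 0")
  case True
  interpret prob_space "\<N> s" using s by (rule prob_space_centered_normal)
  show ?thesis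
  proof (cases "c = 0")
    case True
    have "distr (\<N> s) borel (\<lambda>x. 0) = return borel (0::real)"
    proof (rule measure_eqI)
      fix A :: "real set" assume "A \<in> sets (distr (\<N> s) borel (\<lambda>x. 0))"
      then have A: "A \<in> sets borel" by simp
      then have "emeasure (distr (\<N> s) borel (\<lambda>x. 0)) A = emeasure (\<N> s) ((\<lambda>x. 0) -` A \<inter> UNIV)"
        by (subst emeasure_distr) simp_all
      also have "\<dots> = indicator A 0"
        using emeasure_space_1 by (cases "0 \<in> A") auto
      finally show "emeasure (distr (\<N> s) borel (\<lambda>x. 0)) A = emeasure (return borel 0) A"
        using A by simp
    qed simp
    with True show ?thesis by (simp add: centered_normal_def)
  next
    case False
    then have "s = 0" using True by simp
    then show ?thesis by (simp add: centered_normal_def distr_return)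
  qed
next
  case False
  with s have s: "0 < s" and c: "c \<noteq> 0" by auto
  interpret prob_space "\<N> s" using s by (intro prob_space_centered_normal) simp
  have d: "distributed (\<N> s) lborel (\<lambda>x. x) (normal_density 0 (sqrt s))"
    using s by (auto simp: distributed_def centered_normal_def intro!: distr_id2)
  have "distributed (\<N> s) lborel (\<lambda>x. c * x) (normal_density 0 (\<bar>c\<bar> * sqrt s))"
    using normal_density_affine[OF d _ c, of 0] s by simp
  then have "distr (\<N> s) lborel (\<lambda>x. c * x) = density lborel (normal_density 0 (\<bar>c\<bar> * sqrt s))"
    by (rule distributed_distr_eq_density)
  moreover have "distr (\<N> s) lborel (\<lambda>x. c * x) = distr (\<N> s) borel (\<lambda>x. c * x)"
    by (rule distr_cong) auto
  ultimately show ?thesis using s c by (simp add: centered_normal_def real_sqrt_mult)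
qed

lemma normal_density_0_eq:
  "0 < s \<Longrightarrow> normal_density 0 (sqrt s) x = exp (- (x\<^sup>2 / (2 * s))) / sqrt (2 * pi * s)"
  by (simp add: normal_density_def)

text \<open>In the coordinates \<open>i = a x + y\<close> and \<open>e = x - \<kappa> i\<close> the
  regression coefficient \<open>\<kappa>\<close> kills the cross term of the exponents;
  \<open>T\<close> is the variance of \<open>i\<close> and \<open>s1 * s2 / T\<close> that of the
  residual.\<close>

lemma normal_density_rotate:
  fixes a s1 s2 T \<kappa> e i :: real
  assumes s: "0 < s1" "0 < s2" and T: "T = a\<^sup>2 * s1 + s2" and \<kappa>: "\<kappa> = a * s1 / T"
  shows "normal_density 0 (sqrt s1) (e + \<kappa> * i) * normal_density 0 (sqrt s2) (i - a * (e + \<kappa> * i)) =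
    normal_density 0 (sqrt T) i * normal_density 0 (sqrt (s1 * s2 / T)) e"
proof -
  have T0: "0 < T" using s T by (simp add: add_nonneg_pos)
  have ex: "(e + \<kappa> * i)\<^sup>2 / (2 * s1) + (i - a * (e + \<kappa> * i))\<^sup>2 / (2 * s2) =
     i\<^sup>2 / (2 * T) + e\<^sup>2 / (2 * (s1 * s2 / T))"
  proof -
    have k: "\<kappa> * T = a * s1" using \<kappa> T0 by simp
    \<comment> \<open>\<open>1 - a * \<kappa>\<close> is the complementary weight
      \<open>s2 / T\<close>; through it the cross term vanishes and the coefficient of the square of
      \<open>i\<close> collapses.\<close>
    have "(1 - a * \<kappa>) * T = T - a * (\<kappa> * T)" by (simp add: algebra_simps)
    then have c1: "(1 - a * \<kappa>) * T = s2" unfolding k by (simp add: T power2_eq_square)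
    have "(e + \<kappa> * i)\<^sup>2 * s2 + (i - a * (e + \<kappa> * i))\<^sup>2 * s1
       = e\<^sup>2 * T + i\<^sup>2 * (\<kappa>\<^sup>2 * s2 + (1 - a * \<kappa>)\<^sup>2 * s1) + 2 * e * i * (\<kappa> * s2 - a * s1 * (1 - a * \<kappa>))"
      unfolding T by (simp add: power2_eq_square algebra_simps)
    also have "\<kappa> * s2 - a * s1 * (1 - a * \<kappa>) = 0"
      using c1 k by (metis cancel_comm_monoid_add_class.diff_cancel mult.assoc mult.commute)
    also have "\<kappa>\<^sup>2 * s2 + (1 - a * \<kappa>)\<^sup>2 * s1 = s1 * s2 / T"
    proof -
      have "T * (\<kappa>\<^sup>2 * s2 + (1 - a * \<kappa>)\<^sup>2 * s1) = (\<kappa> * T) * \<kappa> * s2 + ((1 - a * \<kappa>) * T) * (1 - a * \<kappa>) * s1"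
        by (simp add: power2_eq_square algebra_simps)
      also have "\<dots> = s1 * s2" unfolding k c1 by (simp add: algebra_simps)
      finally show ?thesis using T0 by (simp add: field_simps)
    qed
    finally have *: "(e + \<kappa> * i)\<^sup>2 * s2 + (i - a * (e + \<kappa> * i))\<^sup>2 * s1 = e\<^sup>2 * T + i\<^sup>2 * (s1 * s2 / T)" by simp
    have "(e + \<kappa> * i)\<^sup>2 / (2 * s1) + (i - a * (e + \<kappa> * i))\<^sup>2 / (2 * s2) =
      ((e + \<kappa> * i)\<^sup>2 * s2 + (i - a * (e + \<kappa> * i))\<^sup>2 * s1) / (2 * s1 * s2)"
      using s by (simp add: add_divide_distrib)
    also have "\<dots> = i\<^sup>2 / (2 * T) + e\<^sup>2 / (2 * (s1 * s2 / T))"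
      unfolding * using s T0 by (simp add: field_simps)
    finally show ?thesis .
  qed
  have "sqrt (2 * pi * s1) * sqrt (2 * pi * s2) = sqrt (2 * pi * T) * sqrt (2 * pi * (s1 * s2 / T))"
    using T0 by (simp add: real_sqrt_mult[symmetric])
  moreover have "exp (- ((e + \<kappa> * i)\<^sup>2 / (2 * s1))) * exp (- ((i - a * (e + \<kappa> * i))\<^sup>2 / (2 * s2))) =
     exp (- (i\<^sup>2 / (2 * T))) * exp (- (e\<^sup>2 / (2 * (s1 * s2 / T))))"
    unfolding exp_add[symmetric] using ex by (intro arg_cong[where f = exp]) linarith
  moreover have "0 < s1 * s2 / T" using s T0 by simp
  ultimately show ?thesis
    using s T0 by (simp only: normal_density_0_eq times_divide_times_eq)
qed

lemma nn_integral_lborel_shift: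
  fixes t :: real
  assumes [measurable]: "f \<in> borel_measurable borel"
  shows "(\<integral>\<^sup>+x. f (t + x) \<partial>lborel) = (\<integral>\<^sup>+x. f x \<partial>lborel)"
  using nn_integral_real_affine[of f 1 t] by simp

text \<open>The regression of \<open>x\<close> on \<open>a x + y\<close> leaves an independent residual.\<close>

lemma nn_integral_centered_normal_rotate:
  fixes a s1 s2 T \<kappa> :: real
  assumes h[measurable]: "(\<lambda>(i, e). h i e) \<in> borel_measurable (borel \<Otimes>\<^sub>M borel)"
    and s: "0 \<le> s1" "0 \<le> s2" and s2: "0 < s2 \<or> (a = 1 \<and> 0 < s1)"
    and T: "T = a\<^sup>2 * s1 + s2" and \<kappa>: "\<kappa> = a * s1 / T"
  shows "(\<integral>\<^sup>+x. \<integral>\<^sup>+y. h (a * x + y) (x - \<kappa> * (a * x + y)) \<partial>\<N> s2 \<partial>\<N> s1) =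
    (\<integral>\<^sup>+i. \<integral>\<^sup>+e. h i e \<partial>\<N> (s1 * s2 / T) \<partial>\<N> T)"
proof -
  interpret n2: prob_space "\<N> s2" by (rule prob_space_centered_normal[OF s(2)])
  have T0: "0 \<le> T" "0 < T" using s s2 T by (auto simp: add_nonneg_pos)
  have T4: "0 \<le> s1 * s2 / T" using s T0 by simp
  interpret n4: prob_space "\<N> (s1 * s2 / T)" by (rule prob_space_centered_normal[OF T4])
  \<comment> \<open>The degenerate cases are point masses: \<open>s1 = 0\<close> is an error known
    exactly, \<open>s2 = 0\<close> a noiseless measurement. The residual is then 0.\<close>
  consider "s1 = 0" "0 < s2" | "s2 = 0" "a = 1" "0 < s1" | "0 < s1" "0 < s2" using s s2 by fastforce
  then show ?thesis
  proof cases
    case 1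
    then show ?thesis using T \<kappa> by (simp add: nn_integral_centered_normal_0)
  next
    case 2
    then show ?thesis using T \<kappa> by (simp add: nn_integral_centered_normal_0)
  next
    case 3
    let ?d = "\<lambda>s x. ennreal (normal_density 0 (sqrt s) x)"
    have "(\<integral>\<^sup>+x. \<integral>\<^sup>+y. h (a * x + y) (x - \<kappa> * (a * x + y)) \<partial>\<N> s2 \<partial>\<N> s1) =
       (\<integral>\<^sup>+x. \<integral>\<^sup>+y. ?d s1 x * (?d s2 y * h (a * x + y) (x - \<kappa> * (a * x + y))) \<partial>lborel \<partial>lborel)"
      using 3 by (simp add: nn_integral_centered_normal nn_integral_cmult)
    \<comment> \<open>The change of variables is two shears, each a translation of Lebesgue measure
      in one variable, with Tonelli between them; no Jacobian arises.\<close>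
    also have "\<dots> = (\<integral>\<^sup>+x. \<integral>\<^sup>+i. ?d s1 x * (?d s2 (i - a * x) * h i (x - \<kappa> * i)) \<partial>lborel \<partial>lborel)"
    proof (rule nn_integral_cong)
      fix x :: real
      have "(\<integral>\<^sup>+i. ?d s1 x * (?d s2 (i - a * x) * h i (x - \<kappa> * i)) \<partial>lborel) =
         (\<integral>\<^sup>+y. ?d s1 x * (?d s2 ((a * x + y) - a * x) * h (a * x + y) (x - \<kappa> * (a * x + y))) \<partial>lborel)"
        by (rule nn_integral_lborel_shift[symmetric]) measurable
      then show "(\<integral>\<^sup>+y. ?d s1 x * (?d s2 y * h (a * x + y) (x - \<kappa> * (a * x + y))) \<partial>lborel) =
         (\<integral>\<^sup>+i. ?d s1 x * (?d s2 (i - a * x) * h i (x - \<kappa> * i)) \<partial>lborel)" by simp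
    qed
    also have "\<dots> = (\<integral>\<^sup>+i. \<integral>\<^sup>+x. ?d s1 x * (?d s2 (i - a * x) * h i (x - \<kappa> * i)) \<partial>lborel \<partial>lborel)"
      by (rule lborel_pair.Fubini') measurable
    also have "\<dots> = (\<integral>\<^sup>+i. \<integral>\<^sup>+e. ?d T i * (?d (s1 * s2 / T) e * h i e) \<partial>lborel \<partial>lborel)"
    proof (rule nn_integral_cong)
      fix i :: real
      have "(\<integral>\<^sup>+x. ?d s1 x * (?d s2 (i - a * x) * h i (x - \<kappa> * i)) \<partial>lborel) =
        (\<integral>\<^sup>+e. ?d s1 (\<kappa> * i + e) * (?d s2 (i - a * (\<kappa> * i + e)) * h i (\<kappa> * i + e - \<kappa> * i)) \<partial>lborel)"
        by (rule nn_integral_lborel_shift[symmetric]) measurable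
      also have "\<dots> = (\<integral>\<^sup>+e. ?d T i * (?d (s1 * s2 / T) e * h i e) \<partial>lborel)"
      proof (rule nn_integral_cong)
        fix e :: real
        have "?d s1 (\<kappa> * i + e) * (?d s2 (i - a * (\<kappa> * i + e)) * h i (\<kappa> * i + e - \<kappa> * i)) =
          ennreal (normal_density 0 (sqrt s1) (e + \<kappa> * i) * normal_density 0 (sqrt s2) (i - a * (e + \<kappa> * i))) * h i e"
          by (simp add: ennreal_mult mult.assoc add.commute)
        also have "\<dots> = ennreal (normal_density 0 (sqrt T) i * normal_density 0 (sqrt (s1 * s2 / T)) e) * h i e"
          using normal_density_rotate[OF 3 T \<kappa>] by simp
        finally show "?d s1 (\<kappa> * i + e) * (?d s2 (i - a * (\<kappa> * i + e)) * h i (\<kappa> * i + e - \<kappa> * i)) =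
          ?d T i * (?d (s1 * s2 / T) e * h i e)"
          by (simp add: ennreal_mult mult.assoc)
      qed
      finally show "(\<integral>\<^sup>+x. ?d s1 x * (?d s2 (i - a * x) * h i (x - \<kappa> * i)) \<partial>lborel) =
        (\<integral>\<^sup>+e. ?d T i * (?d (s1 * s2 / T) e * h i e) \<partial>lborel)" .
    qed
    also have "\<dots> = (\<integral>\<^sup>+i. \<integral>\<^sup>+e. h i e \<partial>\<N> (s1 * s2 / T) \<partial>\<N> T)"
      using 3 T0 by (simp add: nn_integral_centered_normal nn_integral_cmult)
    finally show ?thesis .
  qed
qed

lemma nn_integral_centered_normal_conv:
  assumes f[measurable]: "f \<in> borel_measurable borel" and s: "0 \<le> s1" "0 < s2"
  shows "(\<integral>\<^sup>+x. \<integral>\<^sup>+y. f (a * x + y) \<partial>\<N> s2 \<partial>\<N> s1) =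
    (\<integral>\<^sup>+i. f i \<partial>\<N> (a\<^sup>2 * s1 + s2))"
proof -
  interpret prob_space "\<N> (s1 * s2 / (a\<^sup>2 * s1 + s2))"
    using s by (intro prob_space_centered_normal) simp
  show ?thesis
    using nn_integral_centered_normal_rotate[of "\<lambda>i e. f i" s1 s2 a, OF _ s(1) _ _ refl refl] s
    by (simp add: emeasure_space_1[simplified])
qed

section \<open>One step of the Kalman filter\<close>

text \<open>The variables are frozen out in reverse order of adjunction: \<open>v\<close>,
  \<open>w\<close>, \<open>e\<close>. Then \<open>a e + w\<close> convolves to a normal prediction
  error of variance \<open>P\<close>, and regressing it on itself plus \<open>v\<close> splits off
  the innovation.\<close>

lemma nn_integral_kalman_step:
  fixes a p W V P K :: real
  assumes M: "prob_space M"
    and e: "indep_of M G e (\<N> p)"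
    and w: "indep_of M (adjoin G e) w (\<N> W)"
    and v: "indep_of M (adjoin (adjoin G e) w) v (\<N> V)"
    and pos: "0 \<le> p" "0 < W" "0 \<le> V"
    and P: "P = a\<^sup>2 * p + W" and K: "K = P / (P + V)"
    and h: "(\<lambda>(i, x, \<omega>). h i x \<omega>) \<in> borel_measurable (borel \<Otimes>\<^sub>M borel \<Otimes>\<^sub>M G)"
  shows "(\<integral>\<^sup>+\<omega>. h (a * e \<omega> + w \<omega> + v \<omega>) (a * e \<omega> + w \<omega> - K * (a * e \<omega> + w \<omega> + v \<omega>)) \<omega> \<partial>M) =
    (\<integral>\<^sup>+\<omega>. \<integral>\<^sup>+i. \<integral>\<^sup>+x. h i x \<omega> \<partial>\<N> (P * V / (P + V)) \<partial>\<N> (P + V) \<partial>M)"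
proof -
  interpret prob_space M by fact
  have P0: "0 < P" using P pos by (simp add: add_nonneg_pos)
  interpret nv: prob_space "\<N> V" using pos by (intro prob_space_centered_normal)
  interpret nw: prob_space "\<N> W" using pos by (intro prob_space_centered_normal) simp
  interpret nP: prob_space "\<N> P" using P0 by (intro prob_space_centered_normal) simp
  interpret np: prob_space "\<N> p" using pos by (intro prob_space_centered_normal)
  have sp: "space G = space M" using indep_ofD(1)[OF e] by (simp add: subalgebra_def)
  have [measurable (raw)]: "(\<lambda>p. h (f1 p) (f2 p) (f3 p)) \<in> borel_measurable N"
    if "f1 \<in> borel_measurable N" "f2 \<in> borel_measurable N" "f3 \<in> measurable N G" for N :: "'b measure" and f1 f2 f3
    using measurable_compose[OF measurable_Pair[OF that(1) measurable_Pair[OF that(2,3)]] h] by simp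
  let ?G1 = "adjoin G e" and ?G2 = "adjoin (adjoin G e) w"
  have m1: "(\<lambda>\<omega>. (e \<omega>, \<omega>)) \<in> measurable ?G1 (borel \<Otimes>\<^sub>M G)"
    by (intro measurable_Pair measurable_adjoin_ident measurable_adjoin_new)
  have m2: "(\<lambda>\<omega>. (w \<omega>, e \<omega>, \<omega>)) \<in> measurable ?G2 (borel \<Otimes>\<^sub>M borel \<Otimes>\<^sub>M G)"
    by (intro measurable_Pair measurable_adjoin measurable_adjoin_ident measurable_adjoin_new)
  have "(\<integral>\<^sup>+\<omega>. h (a * e \<omega> + w \<omega> + v \<omega>) (a * e \<omega> + w \<omega> - K * (a * e \<omega> + w \<omega> + v \<omega>)) \<omega> \<partial>M) =
    (\<integral>\<^sup>+\<omega>. \<integral>\<^sup>+y. h (a * e \<omega> + w \<omega> + y) (a * e \<omega> + w \<omega> - K * (a * e \<omega> + w \<omega> + y)) \<omega> \<partial>\<N> V \<partial>M)"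
    using nn_integral_indep_of_compose[OF M v m2,
        where h="\<lambda>y (z, x, \<omega>). h (a * x + z + y) (a * x + z - K * (a * x + z + y)) \<omega>"] by simp
  also have "\<dots> = (\<integral>\<^sup>+\<omega>. \<integral>\<^sup>+z. \<integral>\<^sup>+y. h (a * e \<omega> + z + y) (a * e \<omega> + z - K * (a * e \<omega> + z + y)) \<omega> \<partial>\<N> V \<partial>\<N> W \<partial>M)"
    using nn_integral_indep_of_compose[OF M w m1,
        where h="\<lambda>z (x, \<omega>). \<integral>\<^sup>+y. h (a * x + z + y) (a * x + z - K * (a * x + z + y)) \<omega> \<partial>\<N> V"] by simp
  also have "\<dots> = (\<integral>\<^sup>+\<omega>. \<integral>\<^sup>+x. \<integral>\<^sup>+z. \<integral>\<^sup>+y. h (a * x + z + y) (a * x + z - K * (a * x + z + y)) \<omega> \<partial>\<N> V \<partial>\<N> W \<partial>\<N> p \<partial>M)"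
    by (rule nn_integral_indep_of[OF M e, where h="\<lambda>x \<omega>. \<integral>\<^sup>+z. \<integral>\<^sup>+y. h (a * x + z + y) (a * x + z - K * (a * x + z + y)) \<omega> \<partial>\<N> V \<partial>\<N> W"]) measurable
  also have "\<dots> = (\<integral>\<^sup>+\<omega>. \<integral>\<^sup>+i. \<integral>\<^sup>+x. h i x \<omega> \<partial>\<N> (P * V / (P + V)) \<partial>\<N> (P + V) \<partial>M)"
  proof (rule nn_integral_cong)
    fix \<omega> assume "\<omega> \<in> space M"
    then have [measurable]: "\<omega> \<in> space G" by (simp add: sp)
    have [measurable]: "(\<lambda>(i, x). h i x \<omega>) \<in> borel_measurable (borel \<Otimes>\<^sub>M borel)" by measurable
    have "(\<integral>\<^sup>+x. \<integral>\<^sup>+z. \<integral>\<^sup>+y. h (a * x + z + y) (a * x + z - K * (a * x + z + y)) \<omega> \<partial>\<N> V \<partial>\<N> W \<partial>\<N> p)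
       = (\<integral>\<^sup>+q. \<integral>\<^sup>+y. h (q + y) (q - K * (q + y)) \<omega> \<partial>\<N> V \<partial>\<N> P)"
      unfolding P by (rule nn_integral_centered_normal_conv[where f="\<lambda>q. \<integral>\<^sup>+y. h (q + y) (q - K * (q + y)) \<omega> \<partial>\<N> V"])
        (measurable, use pos in auto)
    also have "\<dots> = (\<integral>\<^sup>+i. \<integral>\<^sup>+x. h i x \<omega> \<partial>\<N> (P * V / (P + V)) \<partial>\<N> (P + V))"
      using nn_integral_centered_normal_rotate[of "\<lambda>i x. h i x \<omega>" P V 1 "P + V" K] P0 pos K by simp
    finally show "(\<integral>\<^sup>+x. \<integral>\<^sup>+z. \<integral>\<^sup>+y. h (a * x + z + y) (a * x + z - K * (a * x + z + y)) \<omega> \<partial>\<N> V \<partial>\<N> W \<partial>\<N> p)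
       = (\<integral>\<^sup>+i. \<integral>\<^sup>+x. h i x \<omega> \<partial>\<N> (P * V / (P + V)) \<partial>\<N> (P + V))" .
  qed
  finally show ?thesis .
qed

text \<open>By the preceding formula innovation and updated error have, given \<open>G\<close>, a
  product law. Ignoring the error gives the first claim, testing with events of
  \<open>adjoin G i\<close> the second.\<close>

lemma kalman_step:
  fixes a p W V P K :: real
  assumes M: "prob_space M"
    and e: "indep_of M G e (\<N> p)"
    and w: "indep_of M (adjoin G e) w (\<N> W)"
    and v: "indep_of M (adjoin (adjoin G e) w) v (\<N> V)"
    and pos: "0 \<le> p" "0 < W" "0 \<le> V"
    and P: "P = a\<^sup>2 * p + W" and K: "K = P / (P + V)"
    and i: "i = (\<lambda>\<omega>. a * e \<omega> + w \<omega> + v \<omega>)" and e': "e' = (\<lambda>\<omega>. a * e \<omega> + w \<omega> - K * i \<omega>)"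
  shows "indep_of M G i (\<N> (P + V))"
    and "indep_of M (adjoin G i) e' (\<N> (P * V / (P + V)))"
proof -
  let ?Ni = "\<N> (P + V)" and ?Ne = "\<N> (P * V / (P + V))"
  interpret prob_space M by fact
  have P0: "0 < P" using P pos by (simp add: add_nonneg_pos)
  have P1: "0 \<le> P + V" "0 \<le> P * V / (P + V)" using P0 pos by auto
  interpret ni: prob_space ?Ni using P1(1) by (intro prob_space_centered_normal)
  interpret ne: prob_space ?Ne using P1(2) by (intro prob_space_centered_normal)
  note sub = indep_ofD(1)[OF e]
  note [measurable] = indep_ofD(2)[OF e] indep_ofD(2)[OF w] indep_ofD(2)[OF v]
  have sp: "space G = space M" using sub by (simp add: subalgebra_def)
  have idM[measurable]: "(\<lambda>\<omega>. \<omega>) \<in> measurable M G" using sub by (simp add: subalgebra_measurable_ident)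
  have i_m[measurable]: "i \<in> borel_measurable M" unfolding i by measurable
  have e_m[measurable]: "e' \<in> borel_measurable M" unfolding e' by measurable
  have key: "(\<integral>\<^sup>+\<omega>. h (i \<omega>) (e' \<omega>) \<omega> \<partial>M) =
      (\<integral>\<^sup>+\<omega>. \<integral>\<^sup>+y. \<integral>\<^sup>+x. h y x \<omega> \<partial>?Ne \<partial>?Ni \<partial>M)"
    if "(\<lambda>(i, x, \<omega>). h i x \<omega>) \<in> borel_measurable (borel \<Otimes>\<^sub>M borel \<Otimes>\<^sub>M G)" for h :: "real \<Rightarrow> real \<Rightarrow> 'a \<Rightarrow> ennreal"
    unfolding i e' by (rule nn_integral_kalman_step[OF M e w v pos P K that])
  have key1: "(\<integral>\<^sup>+\<omega>. h (i \<omega>) \<omega> \<partial>M) = (\<integral>\<^sup>+\<omega>. \<integral>\<^sup>+y. h y \<omega> \<partial>?Ni \<partial>M)"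
    if [measurable]: "(\<lambda>(i, \<omega>). h i \<omega>) \<in> borel_measurable (borel \<Otimes>\<^sub>M G)" for h :: "real \<Rightarrow> 'a \<Rightarrow> ennreal"
    using key[of "\<lambda>i x \<omega>. h i \<omega>"] by (simp add: ne.emeasure_space_1[simplified])
  show "indep_of M G i ?Ni"
  proof (rule indep_of_nn_integralI[OF sub i_m ni.prob_space_axioms])
    fix A and B :: "real set" assume A[measurable]: "A \<in> sets G" and B[measurable]: "B \<in> sets borel"
    have A': "A \<in> sets M" using A sub by (auto simp: subalgebra_def)
    have "(\<integral>\<^sup>+\<omega>. indicator B (i \<omega>) * indicator A \<omega> \<partial>M) =
        (\<integral>\<^sup>+\<omega>. \<integral>\<^sup>+y. indicator B y * indicator A \<omega> \<partial>?Ni \<partial>M)"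
      by (rule key1) measurable
    also have "\<dots> = (\<integral>\<^sup>+\<omega>. emeasure ?Ni B * indicator A \<omega> \<partial>M)"
      by (intro nn_integral_cong) (simp add: nn_integral_centered_normal_indicator)
    finally show "(\<integral>\<^sup>+\<omega>. indicator B (i \<omega>) * indicator A \<omega> \<partial>M) = emeasure ?Ni B * emeasure M A"
      using A' by (simp add: nn_integral_cmult)
  qed simp
  show "indep_of M (adjoin G i) e' ?Ne"
  proof (rule indep_of_nn_integralI[OF adjoin_least[OF sub i_m] e_m ne.prob_space_axioms])
    fix A and B :: "real set" assume A: "A \<in> sets (adjoin G i)" and B[measurable]: "B \<in> sets borel"
    obtain A' where A'[measurable]: "A' \<in> sets (G \<Otimes>\<^sub>M borel)" and Aeq: "A = {\<omega>\<in>space G. (\<omega>, i \<omega>) \<in> A'}"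
      using A by (elim sets_adjoinE)
    have AM: "A \<in> sets M" using A adjoin_least[OF sub i_m] by (auto simp: subalgebra_def)
    have ind: "indicator A \<omega> = (indicator A' (\<omega>, i \<omega>) :: ennreal)" if "\<omega> \<in> space M" for \<omega>
      using that by (auto simp: Aeq indicator_def sp)
    have "(\<integral>\<^sup>+\<omega>. indicator B (e' \<omega>) * indicator A \<omega> \<partial>M) = (\<integral>\<^sup>+\<omega>. indicator B (e' \<omega>) * indicator A' (\<omega>, i \<omega>) \<partial>M)"
      by (intro nn_integral_cong) (simp add: ind)
    also have "\<dots> = (\<integral>\<^sup>+\<omega>. \<integral>\<^sup>+y. \<integral>\<^sup>+x. indicator B x * indicator A' (\<omega>, y) \<partial>?Ne \<partial>?Ni \<partial>M)"
      by (rule key) measurable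
    also have "\<dots> = (\<integral>\<^sup>+\<omega>. emeasure ?Ne B * (\<integral>\<^sup>+y. indicator A' (\<omega>, y) \<partial>?Ni) \<partial>M)"
    proof (rule nn_integral_cong)
      fix \<omega> assume "\<omega> \<in> space M"
      then have [measurable]: "\<omega> \<in> space G" by (simp add: sp)
      have sect: "(\<lambda>y. indicator A' (\<omega>, y) :: ennreal) \<in> borel_measurable ?Ni"
        by measurable
      show "(\<integral>\<^sup>+y. \<integral>\<^sup>+x. indicator B x * indicator A' (\<omega>, y) \<partial>?Ne \<partial>?Ni) =
        emeasure ?Ne B * (\<integral>\<^sup>+y. indicator A' (\<omega>, y) \<partial>?Ni)"
        using nn_integral_cmult[OF sect] by (simp add: nn_integral_centered_normal_indicator)
    qed
    also have "\<dots> = emeasure ?Ne B * (\<integral>\<^sup>+\<omega>. \<integral>\<^sup>+y. indicator A' (\<omega>, y) \<partial>?Ni \<partial>M)"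
      by (rule nn_integral_cmult) (rule measurable_compose[OF idM], measurable)
    also have "(\<integral>\<^sup>+\<omega>. \<integral>\<^sup>+y. indicator A' (\<omega>, y) \<partial>?Ni \<partial>M) = (\<integral>\<^sup>+\<omega>. indicator A' (\<omega>, i \<omega>) \<partial>M)"
      by (rule key1[symmetric]) measurable
    also have "\<dots> = (\<integral>\<^sup>+\<omega>. indicator A \<omega> \<partial>M)" by (intro nn_integral_cong) (simp add: ind)
    also have "\<dots> = emeasure M A" using AM by simp
    finally show "(\<integral>\<^sup>+\<omega>. indicator B (e' \<omega>) * indicator A \<omega> \<partial>M) = emeasure ?Ne B * emeasure M A" .
  qed simp
qed

section \<open>Filtrations of the plant\<close>

locale gaussian_plant = prob_space M for M :: "'a measure" +
  fixes \<alpha> W V P0 SNR :: real and x0 :: "'a \<Rightarrow> real" and w v n :: "nat \<Rightarrow> 'a \<Rightarrow> real"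
  assumes alpha: "\<alpha> > 1" and W: "W > 0" and V: "V \<ge> 0" and P0: "P0 \<ge> 0" and SNR: "SNR > 0"
    and indep: "indep_vars (\<lambda>_. borel) (noise_family x0 w v n) UNIV"
    and distr_x0: "distr M borel x0 = \<N> P0"
    and distr_w: "\<And>t. distr M borel (w t) = \<N> W"
    and distr_v: "\<And>t. distr M borel (v t) = \<N> V"
    and distr_n: "\<And>t. distr M borel (n t) = \<N> (1 / SNR)"
begin

abbreviation noise :: "noise_index \<Rightarrow> 'a \<Rightarrow> real" where
  "noise \<equiv> noise_family x0 w v n"

lemma noise_measurable [measurable]: "noise i \<in> borel_measurable M"
  using indep by (simp add: indep_vars_def2)

text \<open>The sigma-algebra generated by the noises with index in \<open>J\<close>, as a pullback
  of the product space: the form in which independence of disjoint groups of variables is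
  available.\<close>

definition noise_alg :: "noise_index set \<Rightarrow> 'a measure" where
  "noise_alg J = vimage_algebra (space M) (\<lambda>\<omega>. \<lambda>i\<in>J. noise i \<omega>) (PiM J (\<lambda>_. borel))"

lemma restrict_noise_measurable: "(\<lambda>\<omega>. \<lambda>i\<in>J. noise i \<omega>) \<in> measurable (noise_alg J) (PiM J (\<lambda>_. borel))"
  unfolding noise_alg_def by (rule measurable_vimage_algebra1) (auto simp: space_PiM)

lemma noise_alg_measurable:
  assumes "i \<in> J"
  shows "noise i \<in> borel_measurable (noise_alg J)"
  using measurable_compose[OF restrict_noise_measurable measurable_component_singleton[OF assms]] assms by simp

lemma space_noise_alg [simp]: "space (noise_alg J) = space M"
  by (simp add: noise_alg_def)

lemma subalgebra_noise_alg_iff: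
  "subalgebra A (noise_alg J) \<longleftrightarrow> space A = space M \<and> (\<forall>i\<in>J. noise i \<in> borel_measurable A)"
proof
  assume "subalgebra A (noise_alg J)"
  then show "space A = space M \<and> (\<forall>i\<in>J. noise i \<in> borel_measurable A)"
    by (auto simp: subalgebra_measurable_ident intro: measurable_compose[OF _ noise_alg_measurable])
next
  assume *: "space A = space M \<and> (\<forall>i\<in>J. noise i \<in> borel_measurable A)"
  have "(\<lambda>\<omega>. \<omega>) \<in> measurable A (noise_alg J)"
    unfolding noise_alg_def using * by (intro measurable_vimage_algebra2 measurable_restrict) auto
  then show "subalgebra A (noise_alg J)" using * by (simp add: subalgebra_measurable_ident)
qed

lemma subalgebra_noise_alg: "subalgebra M (noise_alg J)"
  by (simp add: subalgebra_noise_alg_iff)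

lemma indep_of_noise:
  assumes "i \<notin> J" and d: "distr M borel (noise i) = \<mu>"
  shows "indep_of M (noise_alg J) (noise i) \<mu>"
proof -
  let ?X = "\<lambda>\<omega>. \<lambda>i\<in>J. noise i \<omega>"
  have iv: "indep_var (PiM J (\<lambda>_. borel :: real measure)) ?X (PiM {i} (\<lambda>_. borel)) (\<lambda>\<omega>. \<lambda>i\<in>{i}. noise i \<omega>)"
    by (rule indep_var_restrict[OF indep]) (use assms in auto)
  show ?thesis unfolding indep_of_def
  proof (intro conjI ballI)
    fix A and B :: "real set" assume A: "A \<in> sets (noise_alg J)" and B: "B \<in> sets borel"
    have "sets (noise_alg J) = {?X -` A \<inter> space M |A. A \<in> sets (PiM J (\<lambda>_. borel))}"
      unfolding noise_alg_def by (rule sets_vimage_algebra2) (auto simp: space_PiM)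
    with A obtain A' where A': "A' \<in> sets (PiM J (\<lambda>_. borel))" and Aeq: "A = ?X -` A' \<inter> space M" by auto
    let ?Y = "\<lambda>\<omega>. \<lambda>i\<in>{i}. noise i \<omega>"
    define B' where "B' = (\<lambda>f. f i) -` B \<inter> space (PiM {i} (\<lambda>_. borel :: real measure))"
    have B': "B' \<in> sets (PiM {i} (\<lambda>_. borel :: real measure))"
      unfolding B'_def using B by measurable
    have "emeasure M (noise i -` B \<inter> A) = ennreal (prob ((\<lambda>\<omega>. (?X \<omega>, ?Y \<omega>)) -` (A' \<times> B') \<inter> space M))"
      unfolding emeasure_eq_measure[symmetric] by (intro arg_cong[where f="emeasure M"]) (auto simp: Aeq B'_def space_PiM)
    also have "prob ((\<lambda>\<omega>. (?X \<omega>, ?Y \<omega>)) -` (A' \<times> B') \<inter> space M) = prob (?X -` A' \<inter> space M) * prob (?Y -` B' \<inter> space M)"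
      by (rule indep_varD[OF iv A' B'])
    also have "?Y -` B' \<inter> space M = noise i -` B \<inter> space M"
      by (auto simp: B'_def space_PiM)
    also have "ennreal (prob (?X -` A' \<inter> space M) * prob (noise i -` B \<inter> space M)) = emeasure M (noise i -` B \<inter> space M) * emeasure M A"
      by (simp add: ennreal_mult emeasure_eq_measure Aeq mult.commute)
    also have "emeasure M (noise i -` B \<inter> space M) = emeasure \<mu> B"
      unfolding d[symmetric] using B by (simp add: emeasure_distr)
    finally show "emeasure M (noise i -` B \<inter> A) = emeasure \<mu> B * emeasure M A" .
  qed (use d in \<open>auto simp: subalgebra_noise_alg intro!: prob_space_distr\<close>)
qed

section \<open>Kalman filter of the plant: gains, errors, innovations\<close>

abbreviation "filt \<equiv> kalman_filt \<alpha> W V P0"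
abbreviation "pred \<equiv> kalman_pred \<alpha> W V P0"

definition kgain :: "nat \<Rightarrow> real" where
  "kgain t = pred t / (pred t + V)"

text \<open>The variance of the filter correction \<open>kgain t * inn t\<close>, equal to
  prediction minus filtering variance. Index \<open>t\<close> belongs to the measurement at time
  \<open>t + 1\<close>.\<close>

definition nvar :: "nat \<Rightarrow> real" where
  "nvar t = (pred t)\<^sup>2 / (pred t + V)"

lemma filt_nonneg: "0 \<le> filt t"
proof (induction t)
  case (Suc t)
  then show ?case using W V by (auto intro!: divide_nonneg_nonneg mult_nonneg_nonneg add_nonneg_nonneg)
qed (simp add: P0)

lemma filt_Suc: "filt (Suc t) = pred t * V / (pred t + V)"
  by (simp add: kalman_pred_def)

declare kalman_filt.simps(2) [simp del]

lemma pred_ge: "W \<le> pred t"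
  by (simp add: kalman_pred_def filt_nonneg)

lemma pred_pos: "0 < pred t"
  using pred_ge[of t] W by simp

lemma nvar_pos: "0 < nvar t"
  using pred_pos[of t] V by (simp add: nvar_def)

lemma nvar_kgain: "(kgain t)\<^sup>2 * (pred t + V) = nvar t"
  using pred_pos[of t] V by (simp add: nvar_def kgain_def power_divide power2_eq_square)

lemma nvar_eq: "nvar t = pred t - filt (Suc t)"
  using pred_pos[of t] V by (simp add: nvar_def filt_Suc field_simps power2_eq_square)

text \<open>The filtering error of the observer, a function of the noises alone because controls
  known to the observer cancel. Without a measurement at time 0 it starts as the whole of
  \<open>x0\<close>.\<close>

primrec eps :: "nat \<Rightarrow> 'a \<Rightarrow> real" where
  "eps 0 = x0"
| "eps (Suc t) = (\<lambda>\<omega>. \<alpha> * eps t \<omega> + w t \<omega> - kgain t * (\<alpha> * eps t \<omega> + w t \<omega> + v (Suc t) \<omega>))"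

definition inn :: "nat \<Rightarrow> 'a \<Rightarrow> real" where
  "inn t = (\<lambda>\<omega>. \<alpha> * eps t \<omega> + w t \<omega> + v (Suc t) \<omega>)"

lemma eps_Suc: "eps (Suc t) = (\<lambda>\<omega>. \<alpha> * eps t \<omega> + w t \<omega> - kgain t * inn t \<omega>)"
  by (simp add: inn_def)

declare eps.simps(2) [simp del]

text \<open>\<open>inn t\<close> is the innovation at time \<open>t + 1\<close>; \<open>hist t\<close> is the information at the observer at time
  \<open>t\<close> together with the channel noise up to that time, and \<open>hist' t\<close> adds the next measurement.\<close>

primrec hist :: "nat \<Rightarrow> 'a measure" where
  "hist 0 = sigma (space M) {}"
| "hist (Suc t) = adjoin (adjoin (hist t) (inn t)) (n (Suc t))"

definition hist' :: "nat \<Rightarrow> 'a measure" where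
  "hist' t = adjoin (hist t) (inn t)"

lemma hist_Suc: "hist (Suc t) = adjoin (hist' t) (n (Suc t))"
  by (simp add: hist'_def)

declare hist.simps(2) [simp del]

text \<open>Indices of the noises that determine \<open>hist t\<close> and \<open>eps t\<close>. The
  bound on \<open>Process\<close> is strict since \<open>w t\<close> first acts on the state at time
  \<open>t + 1\<close>.\<close>

definition past :: "nat \<Rightarrow> noise_index set" where
  "past t = {Initial} \<union> Process ` {..<t} \<union> Measurement ` {..t} \<union> Channel ` {..t}"

lemma past_Suc: "past (Suc t) = past t \<union> {Process t, Measurement (Suc t), Channel (Suc t)}"
  by (auto simp: past_def lessThan_Suc atMost_Suc)

lemma noise_alg_comp:
  "Initial \<in> J \<Longrightarrow> x0 \<in> borel_measurable (noise_alg J)"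
  "Process t \<in> J \<Longrightarrow> w t \<in> borel_measurable (noise_alg J)"
  "Measurement t \<in> J \<Longrightarrow> v t \<in> borel_measurable (noise_alg J)"
  "Channel t \<in> J \<Longrightarrow> n t \<in> borel_measurable (noise_alg J)"
  using noise_alg_measurable[of Initial J] noise_alg_measurable[of "Process t" J]
    noise_alg_measurable[of "Measurement t" J] noise_alg_measurable[of "Channel t" J] by auto

lemma x0_measurable [measurable]: "x0 \<in> borel_measurable M"
  and w_measurable [measurable]: "w t \<in> borel_measurable M"
  and v_measurable [measurable]: "v t \<in> borel_measurable M"
  and n_measurable [measurable]: "n t \<in> borel_measurable M"
  using noise_measurable[of Initial] noise_measurable[of "Process t"]
    noise_measurable[of "Measurement t"] noise_measurable[of "Channel t"] by auto

lemma eps_noise_alg: "past t \<subseteq> J \<Longrightarrow> eps t \<in> borel_measurable (noise_alg J)"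
proof (induction t)
  case 0
  then show ?case by (auto simp: past_def intro: noise_alg_comp)
next
  case (Suc t)
  have [measurable]: "eps t \<in> borel_measurable (noise_alg J)"
    "w t \<in> borel_measurable (noise_alg J)" "v (Suc t) \<in> borel_measurable (noise_alg J)"
    using Suc by (auto simp: past_Suc intro: noise_alg_comp)
  show ?case unfolding eps_Suc inn_def by measurable
qed

lemma inn_noise_alg:
  "past t \<union> {Process t, Measurement (Suc t)} \<subseteq> J \<Longrightarrow> inn t \<in> borel_measurable (noise_alg J)"
proof -
  assume *: "past t \<union> {Process t, Measurement (Suc t)} \<subseteq> J"
  have [measurable]: "eps t \<in> borel_measurable (noise_alg J)"
    "w t \<in> borel_measurable (noise_alg J)" "v (Suc t) \<in> borel_measurable (noise_alg J)"
    using * by (auto intro: noise_alg_comp eps_noise_alg)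
  show "inn t \<in> borel_measurable (noise_alg J)" unfolding inn_def by measurable
qed

lemma hist_noise_alg: "past t \<subseteq> J \<Longrightarrow> subalgebra (noise_alg J) (hist t)"
proof (induction t)
  case 0
  then show ?case
    using sets.empty_sets[of "noise_alg J"] sets.top[of "noise_alg J"]
    by (auto simp: subalgebra_def sets_measure_of_conv sigma_sets_empty_eq)
next
  case (Suc t)
  then show ?case unfolding hist.simps(2)
    by (intro adjoin_least inn_noise_alg noise_alg_comp) (auto simp: past_Suc)
qed

lemma hist'_noise_alg:
  "past t \<union> {Process t, Measurement (Suc t)} \<subseteq> J \<Longrightarrow> subalgebra (noise_alg J) (hist' t)"
  unfolding hist'_def by (intro adjoin_least hist_noise_alg inn_noise_alg) auto

lemma eps_measurable [measurable]: "eps t \<in> borel_measurable M"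
  by (rule measurable_from_subalg[OF subalgebra_noise_alg eps_noise_alg]) (rule order_refl)

lemma indep_of_channel: "indep_of M (hist' t) (n (Suc t)) (\<N> (1 / SNR))"
proof -
  let ?J = "past t \<union> {Process t, Measurement (Suc t)}"
  have "indep_of M (noise_alg ?J) (noise (Channel (Suc t))) (\<N> (1 / SNR))"
    by (rule indep_of_noise) (auto simp: past_def distr_n)
  then show ?thesis
    using indep_of_mono[OF _ hist'_noise_alg[of t ?J]] by simp
qed

text \<open>Induction along the filter: the hypothesis on \<open>eps t\<close> feeds
  \<open>kalman_step\<close>, as \<open>w t\<close> and \<open>v (Suc t)\<close> lie outside the
  past. That step yields independence from \<open>hist' t\<close> only; the channel noise is
  adjoined afterwards.\<close>

lemma indep_of_eps: "indep_of M (hist t) (eps t) (\<N> (filt t))"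
    and indep_of_inn: "indep_of M (hist t) (inn t) (\<N> (pred t + V))"
proof -
  have step: "indep_of M (hist t) (inn t) (\<N> (pred t + V)) \<and>
      indep_of M (hist (Suc t)) (eps (Suc t)) (\<N> (filt (Suc t)))"
    if e: "indep_of M (hist t) (eps t) (\<N> (filt t))" for t
  proof -
    let ?J = "past t" and ?J1 = "insert (Process t) (past t)"
    let ?J2 = "insert (Measurement (Suc t)) (insert (Process t) (past t))"
    have s0: "subalgebra (noise_alg J) (adjoin (hist t) (eps t))" if "past t \<subseteq> J" for J
      using that by (intro adjoin_least hist_noise_alg eps_noise_alg)
    have s1: "subalgebra (noise_alg ?J1) (adjoin (adjoin (hist t) (eps t)) (w t))"
      by (intro adjoin_least s0 noise_alg_comp) auto
    have w': "indep_of M (adjoin (hist t) (eps t)) (w t) (\<N> W)"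
      using indep_of_mono[OF indep_of_noise[of "Process t" ?J, OF _ refl] s0[of ?J]]
      by (simp add: past_def distr_w image_iff)
    have v': "indep_of M (adjoin (adjoin (hist t) (eps t)) (w t)) (v (Suc t)) (\<N> V)"
      using indep_of_mono[OF indep_of_noise[of "Measurement (Suc t)" ?J1, OF _ refl] s1]
      by (simp add: past_def distr_v image_iff)
    note ks = kalman_step[OF prob_space_axioms e w' v' filt_nonneg W V kalman_pred_def kgain_def inn_def eps_Suc]
    have "subalgebra (noise_alg ?J2) (adjoin (adjoin (hist t) (inn t)) (eps (Suc t)))"
    proof -
      have [measurable]: "inn t \<in> borel_measurable (noise_alg ?J2)" "eps t \<in> borel_measurable (noise_alg ?J2)"
         "w t \<in> borel_measurable (noise_alg ?J2)"
        by (intro inn_noise_alg eps_noise_alg noise_alg_comp; auto)+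
      have "eps (Suc t) \<in> borel_measurable (noise_alg ?J2)" unfolding eps_Suc by measurable
      then show ?thesis by (intro adjoin_least hist_noise_alg inn_noise_alg) auto
    qed
    then have "indep_of M (adjoin (adjoin (hist t) (inn t)) (eps (Suc t))) (n (Suc t)) (\<N> (1 / SNR))"
      using indep_of_mono[OF indep_of_noise[of "Channel (Suc t)" ?J2, OF _ refl]]
      by (simp add: past_def distr_n image_iff)
    \<comment> \<open>\<open>n (Suc t)\<close> is independent of \<open>hist' t\<close> and the new
      error jointly, so the two may be exchanged.\<close>
    then have "indep_of M (adjoin (adjoin (hist t) (inn t)) (n (Suc t))) (eps (Suc t)) (\<N> (filt (Suc t)))"
      unfolding filt_Suc by (rule indep_of_adjoin_swap[OF prob_space_axioms ks(2)])
    then show ?thesis using ks(1) by (simp add: hist.simps(2))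
  qed
  have eps: "indep_of M (hist t) (eps t) (\<N> (filt t))" for t
  proof (induction t)
    case 0
    have "indep_of M (noise_alg {}) (noise Initial) (\<N> P0)"
      by (rule indep_of_noise) (auto simp: distr_x0)
    moreover have "subalgebra (noise_alg {}) (hist 0)"
      using sets.empty_sets[of "noise_alg {}"] sets.top[of "noise_alg {}"]
      by (auto simp: subalgebra_def sets_measure_of_conv sigma_sets_empty_eq)
    ultimately show ?case using indep_of_mono by force
  next
    case (Suc t)
    then show ?case using step by blast
  qed
  show "indep_of M (hist t) (eps t) (\<N> (filt t))" by (rule eps)
  show "indep_of M (hist t) (inn t) (\<N> (pred t + V))" using step[OF eps] by blast
qed

end

section \<open>Change of measure through a Gaussian channel\<close>

text \<open>Weighting by the posterior to prior ratio of the error and by the channel likelihood ratio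
  makes the channel output independent of the source, and gives the estimation error the prescribed
  variance \<open>d'\<close>. The channel input is removed by translating the channel noise.\<close>

lemma nn_integral_likelihood_step:
  fixes \<alpha> d q r d' \<sigma> R :: real
  assumes M: "prob_space M"
    and nu: "indep_of M H \<nu> (\<N> q)"
    and n: "indep_of M H' n (\<N> r)"
    and pos: "0 \<le> d" "0 < q" "0 < r" "0 < d'" "0 < R"
    and sub: "subalgebra H B" "subalgebra H' H" and nuH': "\<nu> \<in> borel_measurable H'"
    and L: "L \<in> borel_measurable H" "\<And>\<omega>. 0 < L \<omega>"
    and LP: "prob_space (density M (\<lambda>\<omega>. ennreal (L \<omega>)))"
    and eH: "e \<in> borel_measurable H"
    and e: "indep_of (density M (\<lambda>\<omega>. ennreal (L \<omega>))) B e (\<N> d)"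
    and a: "a \<in> borel_measurable H'"
    and k: "(\<lambda>(\<omega>, y). k \<omega> y) \<in> borel_measurable (B \<Otimes>\<^sub>M borel)"
    and \<sigma>: "\<sigma> = \<alpha>\<^sup>2 * d + q"
    and b: "b = (\<lambda>\<omega>. a \<omega> + n \<omega>)" and e': "e' = (\<lambda>\<omega>. \<alpha> * e \<omega> + \<nu> \<omega> - k \<omega> (b \<omega>))"
    and L': "L' = (\<lambda>\<omega>. L \<omega> * (normal_density 0 (sqrt d') (e' \<omega>) / normal_density 0 (sqrt \<sigma>) (\<alpha> * e \<omega> + \<nu> \<omega>)
       * (normal_density 0 (sqrt R) (b \<omega>) / normal_density 0 (sqrt r) (n \<omega>))))"
    and F[measurable]: "F \<in> borel_measurable borel" and A[measurable]: "A \<in> sets (B \<Otimes>\<^sub>M borel)"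
  shows "(\<integral>\<^sup>+\<omega>. ennreal (L' \<omega>) * (F (e' \<omega>) * indicator A (\<omega>, b \<omega>)) \<partial>M) =
    (\<integral>\<^sup>+x. F x \<partial>\<N> d') *
      (\<integral>\<^sup>+\<omega>. ennreal (L \<omega>) * (\<integral>\<^sup>+y. indicator A (\<omega>, y) \<partial>\<N> R) \<partial>M)"
proof -
  interpret prob_space M by fact
  let ?D = "density M (\<lambda>\<omega>. ennreal (L \<omega>))"
  let ?f = "\<lambda>s. normal_density 0 (sqrt s)"
  let ?g = "\<lambda>p \<omega> y. ennreal (?f d' (p - k \<omega> y) / ?f \<sigma> p * ?f R y)"
  let ?h = "\<lambda>p \<omega> y. F (p - k \<omega> y) * indicator A (\<omega>, y)"
  let ?l = "\<lambda>p \<omega> x. ennreal (L \<omega> * (?f d' (p - k \<omega> (a \<omega> + x)) / ?f \<sigma> p * (?f R (a \<omega> + x) / ?f r x)))"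
  let ?q = "\<lambda>\<omega> s y. ennreal (?f R y) * indicator A (\<omega>, y) * (ennreal (?f d' (s - k \<omega> y)) * F (s - k \<omega> y))"
  have \<sigma>0: "0 < \<sigma>" using pos \<sigma> by (simp add: add_nonneg_pos)
  interpret nr: prob_space "\<N> r" using pos by (intro prob_space_centered_normal) simp
  interpret nq: prob_space "\<N> q" using pos by (intro prob_space_centered_normal) simp
  interpret nd: prob_space "\<N> d" using pos by (intro prob_space_centered_normal) simp
  interpret nR: prob_space "\<N> R" using pos by (intro prob_space_centered_normal) simp
  note [measurable] = k
  have MH': "subalgebra M H'" and MH: "subalgebra M H" using n nu by (auto dest: indep_ofD)
  have MB: "subalgebra M B" using subalgebra_trans[OF MH sub(1)] .
  have H'B: "subalgebra H' B" using subalgebra_trans[OF sub(2,1)] .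
  have spB: "space B = space M" using MB by (simp add: subalgebra_def)
  have idB: "(\<lambda>\<omega>. \<omega>) \<in> measurable H B" "(\<lambda>\<omega>. \<omega>) \<in> measurable H' B" "(\<lambda>\<omega>. \<omega>) \<in> measurable M B"
    using sub(1) H'B MB by (simp_all add: subalgebra_measurable_ident)
  have LM: "L \<in> borel_measurable M" by (rule measurable_from_subalg[OF MH L(1)])
  have LH': "L \<in> borel_measurable H'" "e \<in> borel_measurable H'"
    by (rule measurable_from_subalg[OF sub(2)], fact)+
  have fpos: "0 < ?f s x" if "0 < s" for s x using that by (intro normal_density_pos) simp
  \<comment> \<open>What integrating out the channel noise leaves: the likelihood ratio turns the
    noise density into the density of variance \<open>R\<close> at the output \<open>y\<close>, and
    the translation to \<open>y\<close> absorbs \<open>a\<close>.\<close>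
  define \<Psi> where "\<Psi> p \<omega> = (\<integral>\<^sup>+y. ?g p \<omega> y * ?h p \<omega> y \<partial>lborel)" for p \<omega>
  have \<Psi>m[measurable]: "(\<lambda>(p, \<omega>). \<Psi> p \<omega>) \<in> borel_measurable (borel \<Otimes>\<^sub>M B)"
    unfolding \<Psi>_def by measurable
  have t1: "(\<lambda>\<omega>. (L \<omega>, \<alpha> * e \<omega> + \<nu> \<omega>, a \<omega>, \<omega>)) \<in> measurable H' (borel \<Otimes>\<^sub>M borel \<Otimes>\<^sub>M borel \<Otimes>\<^sub>M B)"
    by (intro measurable_Pair LH' borel_measurable_add borel_measurable_times borel_measurable_const nuH' a idB)
  have t2: "(\<lambda>\<omega>. (L \<omega>, e \<omega>, \<omega>)) \<in> measurable H (borel \<Otimes>\<^sub>M borel \<Otimes>\<^sub>M B)"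
    by (intro measurable_Pair L eH idB)
  have "(\<integral>\<^sup>+\<omega>. ennreal (L' \<omega>) * (F (e' \<omega>) * indicator A (\<omega>, b \<omega>)) \<partial>M) =
    (\<integral>\<^sup>+\<omega>. \<integral>\<^sup>+x. ?l (\<alpha> * e \<omega> + \<nu> \<omega>) \<omega> x * ?h (\<alpha> * e \<omega> + \<nu> \<omega>) \<omega> (a \<omega> + x) \<partial>\<N> r \<partial>M)"
    unfolding L' e' b
    using nn_integral_indep_of_compose[OF M n t1, where h="\<lambda>x (l, p, a, \<omega>).
      ennreal (l * (?f d' (p - k \<omega> (a + x)) / ?f \<sigma> p * (?f R (a + x) / ?f r x))) *
        (F (p - k \<omega> (a + x)) * indicator A (\<omega>, a + x))"] by simp
  also have "\<dots> = (\<integral>\<^sup>+\<omega>. ennreal (L \<omega>) * \<Psi> (\<alpha> * e \<omega> + \<nu> \<omega>) \<omega> \<partial>M)"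
  proof (rule nn_integral_cong)
    fix \<omega> assume "\<omega> \<in> space M"
    then have [measurable]: "\<omega> \<in> space B" by (simp add: spB)
    define p where "p = \<alpha> * e \<omega> + \<nu> \<omega>"
    have "(\<integral>\<^sup>+x. ?l p \<omega> x * ?h p \<omega> (a \<omega> + x) \<partial>\<N> r) =
      (\<integral>\<^sup>+x. ennreal (?f r x) * (?l p \<omega> x * ?h p \<omega> (a \<omega> + x)) \<partial>lborel)"
      by (rule nn_integral_centered_normal[OF _ pos(3)]) measurable
    also have "\<dots> = (\<integral>\<^sup>+x. ennreal (L \<omega>) * (?g p \<omega> (a \<omega> + x) * ?h p \<omega> (a \<omega> + x)) \<partial>lborel)"
    proof (rule nn_integral_cong)
      fix x
      have "ennreal (?f r x) * ?l p \<omega> x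
         = ennreal (L \<omega>) * ?g p \<omega> (a \<omega> + x)"
        using fpos[OF pos(3), of x] L(2)[of \<omega>]
        by (subst (1 2) ennreal_mult[symmetric]) (auto simp: field_simps less_imp_le)
      then show "ennreal (?f r x) * (?l p \<omega> x * ?h p \<omega> (a \<omega> + x)) =
        ennreal (L \<omega>) * (?g p \<omega> (a \<omega> + x) * ?h p \<omega> (a \<omega> + x))"
        by (simp add: mult.assoc[symmetric])
    qed
    also have "\<dots> = (\<integral>\<^sup>+x. ennreal (L \<omega>) * (?g p \<omega> x * ?h p \<omega> x) \<partial>lborel)"
      by (rule nn_integral_lborel_shift) measurable
    also have "\<dots> = ennreal (L \<omega>) * \<Psi> p \<omega>"
      unfolding \<Psi>_def by (rule nn_integral_cmult) measurable
    finally show "(\<integral>\<^sup>+x. ?l (\<alpha> * e \<omega> + \<nu> \<omega>) \<omega> x * ?h (\<alpha> * e \<omega> + \<nu> \<omega>) \<omega> (a \<omega> + x) \<partial>\<N> r) = ennreal (L \<omega>) * \<Psi> (\<alpha> * e \<omega> + \<nu> \<omega>) \<omega>" by (simp only: p_def)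
  qed
  \<comment> \<open>The order is forced: \<open>\<nu>\<close> is independent of \<open>H\<close>,
    hence of \<open>L\<close> and \<open>e\<close>, under \<open>M\<close>; but \<open>e\<close> is
    known to be normal and independent of \<open>B\<close> only under the weighted measure, entered
    next.\<close>
  also have "\<dots> = (\<integral>\<^sup>+\<omega>. \<integral>\<^sup>+z. ennreal (L \<omega>) * \<Psi> (\<alpha> * e \<omega> + z) \<omega> \<partial>\<N> q \<partial>M)"
    using nn_integral_indep_of_compose[OF M nu t2, where h="\<lambda>z (l, x, \<omega>). ennreal l * \<Psi> (\<alpha> * x + z) \<omega>"] by simp
  also have "\<dots> = (\<integral>\<^sup>+\<omega>. ennreal (L \<omega>) * (\<integral>\<^sup>+z. \<Psi> (\<alpha> * e \<omega> + z) \<omega> \<partial>\<N> q) \<partial>M)"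
  proof (intro nn_integral_cong nn_integral_cmult)
    fix \<omega> assume "\<omega> \<in> space M"
    then have [measurable]: "\<omega> \<in> space B" by (simp add: spB)
    show "(\<lambda>z. \<Psi> (\<alpha> * e \<omega> + z) \<omega>) \<in> borel_measurable (\<N> q)" by measurable
  qed
  also have "\<dots> = (\<integral>\<^sup>+\<omega>. \<integral>\<^sup>+z. \<Psi> (\<alpha> * e \<omega> + z) \<omega> \<partial>\<N> q \<partial>?D)"
  proof (rule nn_integral_density[symmetric])
    show "(\<lambda>\<omega>. \<integral>\<^sup>+z. \<Psi> (\<alpha> * e \<omega> + z) \<omega> \<partial>\<N> q) \<in> borel_measurable M"
    proof -
      have "(\<lambda>(x, \<omega>). \<integral>\<^sup>+z. \<Psi> (\<alpha> * x + z) \<omega> \<partial>\<N> q) \<in> borel_measurable (borel \<Otimes>\<^sub>M B)" by measurable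
      from measurable_compose[OF measurable_Pair[OF measurable_from_subalg[OF MH eH] idB(3)] this]
      show ?thesis by simp
    qed
  qed (use LM in auto)
  also have "\<dots> = (\<integral>\<^sup>+\<omega>. \<integral>\<^sup>+x. \<integral>\<^sup>+z. \<Psi> (\<alpha> * x + z) \<omega> \<partial>\<N> q \<partial>\<N> d \<partial>?D)"
    by (rule nn_integral_indep_of[OF LP e, where h="\<lambda>x \<omega>. \<integral>\<^sup>+z. \<Psi> (\<alpha> * x + z) \<omega> \<partial>\<N> q"]) measurable
  also have "\<dots> = (\<integral>\<^sup>+\<omega>. (\<integral>\<^sup>+x. F x \<partial>\<N> d') * (\<integral>\<^sup>+y. indicator A (\<omega>, y) \<partial>\<N> R) \<partial>?D)"
  proof (rule nn_integral_cong)
    fix \<omega> assume "\<omega> \<in> space ?D"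
    then have [measurable]: "\<omega> \<in> space B" by (simp add: spB)
    \<comment> \<open>Here \<open>\<alpha> e + \<nu>\<close> is normal with variance
      \<open>\<sigma>\<close>, so its density cancels the denominator. A density of variance
      \<open>d'\<close> centered at \<open>k \<omega> y\<close> is left, and the integral of the
      shifted \<open>F\<close> against it does not depend on \<open>y\<close>.\<close>
    have "(\<integral>\<^sup>+x. \<integral>\<^sup>+z. \<Psi> (\<alpha> * x + z) \<omega> \<partial>\<N> q \<partial>\<N> d) = (\<integral>\<^sup>+s. \<Psi> s \<omega> \<partial>\<N> \<sigma>)"
      unfolding \<sigma> by (rule nn_integral_centered_normal_conv) (measurable, use pos in auto)
    also have "\<dots> = (\<integral>\<^sup>+s. ennreal (?f \<sigma> s) * \<Psi> s \<omega> \<partial>lborel)"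
      by (rule nn_integral_centered_normal[OF _ \<sigma>0]) measurable
    also have "\<dots> = (\<integral>\<^sup>+s. \<integral>\<^sup>+y. ?q \<omega> s y \<partial>lborel \<partial>lborel)"
    proof (rule nn_integral_cong)
      fix s
      have "ennreal (?f \<sigma> s) * \<Psi> s \<omega> = (\<integral>\<^sup>+y. ennreal (?f \<sigma> s) * (?g s \<omega> y * ?h s \<omega> y) \<partial>lborel)"
        unfolding \<Psi>_def by (rule nn_integral_cmult[symmetric]) measurable
      also have "\<dots> = (\<integral>\<^sup>+y. ?q \<omega> s y \<partial>lborel)"
      proof (rule nn_integral_cong)
        fix y
        have "ennreal (?f \<sigma> s) * ?g s \<omega> y = ennreal (?f R y) * ennreal (?f d' (s - k \<omega> y))"
          using fpos[OF \<sigma>0, of s] by (subst (1 2) ennreal_mult[symmetric]) (auto simp: field_simps)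
        then show "ennreal (?f \<sigma> s) * (?g s \<omega> y * ?h s \<omega> y) =
          ?q \<omega> s y"
          by (simp add: mult.assoc[symmetric]) (simp add: mult_ac)
      qed
      finally show "ennreal (?f \<sigma> s) * \<Psi> s \<omega> =
        (\<integral>\<^sup>+y. ?q \<omega> s y \<partial>lborel)" .
    qed
    also have "\<dots> = (\<integral>\<^sup>+y. \<integral>\<^sup>+s. ?q \<omega> s y \<partial>lborel \<partial>lborel)"
      by (rule lborel_pair.Fubini') measurable
    also have "\<dots> = (\<integral>\<^sup>+y. ennreal (?f R y) * indicator A (\<omega>, y) * (\<integral>\<^sup>+x. F x \<partial>\<N> d') \<partial>lborel)"
    proof (rule nn_integral_cong)
      fix y
      have sm: "(\<lambda>s. ennreal (?f d' (s - x)) * F (s - x)) \<in> borel_measurable lborel" for x by measurable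
      have "(\<integral>\<^sup>+s. ennreal (?f d' (- k \<omega> y + s)) * F (- k \<omega> y + s) \<partial>lborel) = (\<integral>\<^sup>+s. ennreal (?f d' s) * F s \<partial>lborel)"
        by (rule nn_integral_lborel_shift) measurable
      then have "(\<integral>\<^sup>+s. ennreal (?f d' (s - k \<omega> y)) * F (s - k \<omega> y) \<partial>lborel) = (\<integral>\<^sup>+x. F x \<partial>\<N> d')"
        using pos by (simp add: nn_integral_centered_normal)
      then show "(\<integral>\<^sup>+s. ?q \<omega> s y \<partial>lborel) =
        ennreal (?f R y) * indicator A (\<omega>, y) * (\<integral>\<^sup>+x. F x \<partial>\<N> d')"
        by (simp add: nn_integral_cmult[OF sm])
    qed
    also have "\<dots> = (\<integral>\<^sup>+y. ennreal (?f R y) * indicator A (\<omega>, y) \<partial>lborel) * (\<integral>\<^sup>+x. F x \<partial>\<N> d')"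
      by (rule nn_integral_multc) measurable
    also have "(\<integral>\<^sup>+y. ennreal (?f R y) * indicator A (\<omega>, y) \<partial>lborel) = (\<integral>\<^sup>+y. indicator A (\<omega>, y) \<partial>\<N> R)"
      by (rule nn_integral_centered_normal[OF _ pos(5), symmetric]) measurable
    finally show "(\<integral>\<^sup>+x. \<integral>\<^sup>+z. \<Psi> (\<alpha> * x + z) \<omega> \<partial>\<N> q \<partial>\<N> d) =
       (\<integral>\<^sup>+x. F x \<partial>\<N> d') * (\<integral>\<^sup>+y. indicator A (\<omega>, y) \<partial>\<N> R)" by (simp add: mult.commute)
  qed
  also have "\<dots> = (\<integral>\<^sup>+x. F x \<partial>\<N> d') * (\<integral>\<^sup>+\<omega>. (\<integral>\<^sup>+y. indicator A (\<omega>, y) \<partial>\<N> R) \<partial>?D)"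
  proof (rule nn_integral_cmult)
    show "(\<lambda>\<omega>. \<integral>\<^sup>+y. indicator A (\<omega>, y) \<partial>\<N> R) \<in> borel_measurable ?D"
      by (simp, rule measurable_compose[OF idB(3)], measurable)
  qed
  also have "(\<integral>\<^sup>+\<omega>. (\<integral>\<^sup>+y. indicator A (\<omega>, y) \<partial>\<N> R) \<partial>?D) =
      (\<integral>\<^sup>+\<omega>. ennreal (L \<omega>) * (\<integral>\<^sup>+y. indicator A (\<omega>, y) \<partial>\<N> R) \<partial>M)"
  proof (rule nn_integral_density)
    show "(\<lambda>\<omega>. \<integral>\<^sup>+y. indicator A (\<omega>, y) \<partial>\<N> R) \<in> borel_measurable M"
      by (rule measurable_compose[OF idB(3)], measurable)
  qed (use LM in auto)
  finally show ?thesis .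
qed

text \<open>The correction \<open>c\<close> depends on the old outputs and the new one, so it
  factors as \<open>k \<omega> (b \<omega>)\<close> and the integral formula applies.
  \<open>F = 1\<close> shows that the total mass stays 1; indicators show that \<open>e'\<close> is
  independent of the outputs.\<close>

lemma likelihood_step:
  fixes \<alpha> d q r d' \<sigma> R :: real
  assumes M: "prob_space M"
    and nu: "indep_of M H \<nu> (\<N> q)"
    and n: "indep_of M H' n (\<N> r)"
    and pos: "0 \<le> d" "0 < q" "0 < r" "0 < d'" "0 < R"
    and sub: "subalgebra H B" "subalgebra H' H" and nuH': "\<nu> \<in> borel_measurable H'"
    and L: "L \<in> borel_measurable H" "\<And>\<omega>. 0 < L \<omega>"
    and LP: "prob_space (density M (\<lambda>\<omega>. ennreal (L \<omega>)))"
    and eH: "e \<in> borel_measurable H"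
    and e: "indep_of (density M (\<lambda>\<omega>. ennreal (L \<omega>))) B e (\<N> d)"
    and a: "a \<in> borel_measurable H'"
    and \<sigma>: "\<sigma> = \<alpha>\<^sup>2 * d + q"
    and b: "b = (\<lambda>\<omega>. a \<omega> + n \<omega>)"
    and c: "c \<in> borel_measurable (adjoin B b)"
    and e': "e' = (\<lambda>\<omega>. \<alpha> * e \<omega> + \<nu> \<omega> - c \<omega>)"
    and L': "L' = (\<lambda>\<omega>. L \<omega> * (normal_density 0 (sqrt d') (e' \<omega>) / normal_density 0 (sqrt \<sigma>) (\<alpha> * e \<omega> + \<nu> \<omega>)
       * (normal_density 0 (sqrt R) (b \<omega>) / normal_density 0 (sqrt r) (n \<omega>))))"
  shows "prob_space (density M (\<lambda>\<omega>. ennreal (L' \<omega>)))"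
    and "indep_of (density M (\<lambda>\<omega>. ennreal (L' \<omega>))) (adjoin B b) e' (\<N> d')"
proof -
  interpret prob_space M by fact
  interpret nR: prob_space "\<N> R" using pos by (intro prob_space_centered_normal) simp
  interpret nd': prob_space "\<N> d'" using pos by (intro prob_space_centered_normal) simp
  have MH': "subalgebra M H'" and MH: "subalgebra M H" using n nu by (auto dest: indep_ofD)
  have MB: "subalgebra M B" using subalgebra_trans[OF MH sub(1)] .
  have spB: "space B = space M" using MB by (simp add: subalgebra_def)
  have [measurable]: "\<nu> \<in> borel_measurable M" "n \<in> borel_measurable M" using nu n by (auto dest: indep_ofD)
  have [measurable]: "L \<in> borel_measurable M" "e \<in> borel_measurable M"
    by (rule measurable_from_subalg[OF MH], fact)+
  have [measurable]: "a \<in> borel_measurable M" by (rule measurable_from_subalg[OF MH' a])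
  have [measurable]: "b \<in> borel_measurable M" unfolding b by measurable
  have MBb: "subalgebra M (adjoin B b)" by (rule adjoin_least[OF MB]) simp
  have [measurable]: "c \<in> borel_measurable M" by (rule measurable_from_subalg[OF MBb c])
  have e'm[measurable]: "e' \<in> borel_measurable M" unfolding e' by measurable
  have L'm[measurable]: "L' \<in> borel_measurable M" unfolding L' by measurable
  obtain k where k: "(\<lambda>(\<omega>, x). k \<omega> x) \<in> borel_measurable (B \<Otimes>\<^sub>M borel)"
    and ck: "\<And>\<omega>. \<omega> \<in> space B \<Longrightarrow> c \<omega> = k \<omega> (b \<omega>)" using adjoin_factor[OF c] by blast
  define e2 where "e2 = (\<lambda>\<omega>. \<alpha> * e \<omega> + \<nu> \<omega> - k \<omega> (b \<omega>))"
  define L2 where "L2 = (\<lambda>\<omega>. L \<omega> * (normal_density 0 (sqrt d') (e2 \<omega>) / normal_density 0 (sqrt \<sigma>) (\<alpha> * e \<omega> + \<nu> \<omega>)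
       * (normal_density 0 (sqrt R) (b \<omega>) / normal_density 0 (sqrt r) (n \<omega>))))"
  have eq: "e' \<omega> = e2 \<omega>" "L' \<omega> = L2 \<omega>" if "\<omega> \<in> space M" for \<omega>
    using ck that by (auto simp: e' e2_def L' L2_def spB)
  have key: "(\<integral>\<^sup>+\<omega>. ennreal (L' \<omega>) * (F (e' \<omega>) * indicator A (\<omega>, b \<omega>)) \<partial>M) =
    (\<integral>\<^sup>+x. F x \<partial>\<N> d') *
      (\<integral>\<^sup>+\<omega>. ennreal (L \<omega>) * (\<integral>\<^sup>+y. indicator A (\<omega>, y) \<partial>\<N> R) \<partial>M)"
    if "F \<in> borel_measurable borel" "A \<in> sets (B \<Otimes>\<^sub>M borel)" for F A
  proof -
    have "(\<integral>\<^sup>+\<omega>. ennreal (L' \<omega>) * (F (e' \<omega>) * indicator A (\<omega>, b \<omega>)) \<partial>M) =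
       (\<integral>\<^sup>+\<omega>. ennreal (L2 \<omega>) * (F (e2 \<omega>) * indicator A (\<omega>, b \<omega>)) \<partial>M)"
      by (intro nn_integral_cong) (simp add: eq)
    also have "\<dots> = (\<integral>\<^sup>+x. F x \<partial>\<N> d') *
      (\<integral>\<^sup>+\<omega>. ennreal (L \<omega>) * (\<integral>\<^sup>+y. indicator A (\<omega>, y) \<partial>\<N> R) \<partial>M)"
      by (rule nn_integral_likelihood_step[OF M nu n pos sub nuH' L LP eH e a k \<sigma> b e2_def L2_def that])
    finally show ?thesis .
  qed
  have "(\<integral>\<^sup>+\<omega>. ennreal (L' \<omega>) \<partial>M) = (\<integral>\<^sup>+\<omega>. ennreal (L' \<omega>) * (1 * indicator (space (B \<Otimes>\<^sub>M borel)) (\<omega>, b \<omega>)) \<partial>M)"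
    by (intro nn_integral_cong) (simp add: space_pair_measure spB)
  also have "\<dots> = 1 * (\<integral>\<^sup>+\<omega>. ennreal (L \<omega>) * (\<integral>\<^sup>+y. indicator (space (B \<Otimes>\<^sub>M borel)) (\<omega>, y) \<partial>\<N> R) \<partial>M)"
    by (subst key) (auto simp: nd'.emeasure_space_1[simplified])
  also have "\<dots> = (\<integral>\<^sup>+\<omega>. ennreal (L \<omega>) \<partial>M)"
    using nR.emeasure_space_1 by (auto simp: space_pair_measure spB intro!: nn_integral_cong)
  also have "\<dots> = 1"
    using prob_space.emeasure_space_1[OF LP] by (simp add: emeasure_density cong: nn_integral_cong)
  finally have L'1: "(\<integral>\<^sup>+\<omega>. ennreal (L' \<omega>) \<partial>M) = 1" .
  show P': "prob_space (density M (\<lambda>\<omega>. ennreal (L' \<omega>)))"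
    by (rule prob_spaceI) (simp add: emeasure_density L'1 cong: nn_integral_cong)
  show "indep_of (density M (\<lambda>\<omega>. ennreal (L' \<omega>))) (adjoin B b) e' (\<N> d')"
  proof (rule indep_of_nn_integralI)
    show "subalgebra (density M (\<lambda>\<omega>. ennreal (L' \<omega>))) (adjoin B b)" using MBb by (simp add: subalgebra_def)
    show "prob_space (\<N> d')" by (rule nd'.prob_space_axioms)
    fix A and C :: "real set" assume A: "A \<in> sets (adjoin B b)" and C[measurable]: "C \<in> sets borel"
    obtain A' where A'[measurable]: "A' \<in> sets (B \<Otimes>\<^sub>M borel)" and Aeq: "A = {\<omega>\<in>space B. (\<omega>, b \<omega>) \<in> A'}"
      using A by (elim sets_adjoinE)
    have AM[measurable]: "A \<in> sets M" using A MBb by (auto simp: subalgebra_def)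
    have ind: "indicator A \<omega> = (indicator A' (\<omega>, b \<omega>) :: ennreal)" if "\<omega> \<in> space M" for \<omega>
      using that by (auto simp: Aeq indicator_def spB)
    have "(\<integral>\<^sup>+\<omega>. indicator C (e' \<omega>) * indicator A \<omega> \<partial>density M (\<lambda>\<omega>. ennreal (L' \<omega>))) =
       (\<integral>\<^sup>+\<omega>. ennreal (L' \<omega>) * (indicator C (e' \<omega>) * indicator A' (\<omega>, b \<omega>)) \<partial>M)"
      by (subst nn_integral_density) (auto intro!: nn_integral_cong simp: ind)
    also have "\<dots> = emeasure (\<N> d') C *
        (\<integral>\<^sup>+\<omega>. ennreal (L \<omega>) * (\<integral>\<^sup>+y. indicator A' (\<omega>, y) \<partial>\<N> R) \<partial>M)"
      by (subst key) auto
    \<comment> \<open>Read backwards with \<open>F = 1\<close>, the formula returns the weighted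
      measure of \<open>A\<close>.\<close>
    also have "(\<integral>\<^sup>+\<omega>. ennreal (L \<omega>) * (\<integral>\<^sup>+y. indicator A' (\<omega>, y) \<partial>\<N> R) \<partial>M) =
      (\<integral>\<^sup>+\<omega>. ennreal (L' \<omega>) * (1 * indicator A' (\<omega>, b \<omega>)) \<partial>M)"
      by (subst key) (auto simp: nd'.emeasure_space_1[simplified])
    also have "\<dots> = emeasure (density M (\<lambda>\<omega>. ennreal (L' \<omega>))) A"
      by (subst emeasure_density) (auto intro!: nn_integral_cong simp: ind)
    finally show "(\<integral>\<^sup>+\<omega>. indicator C (e' \<omega>) * indicator A \<omega> \<partial>density M (\<lambda>\<omega>. ennreal (L' \<omega>))) =
      emeasure (\<N> d') C * emeasure (density M (\<lambda>\<omega>. ennreal (L' \<omega>))) A" .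
  qed auto
qed

section \<open>Second moments\<close>

lemma second_moment_finite:
  assumes X[measurable]: "X \<in> borel_measurable M" and s: "second_moment M X = ennreal r" "0 \<le> r"
  shows "integrable M (\<lambda>\<omega>. (X \<omega>)\<^sup>2)" "(\<integral>\<omega>. (X \<omega>)\<^sup>2 \<partial>M) = r"
proof -
  show i: "integrable M (\<lambda>\<omega>. (X \<omega>)\<^sup>2)"
    using s by (intro integrableI_nonneg) (auto simp: second_moment_def)
  show "(\<integral>\<omega>. (X \<omega>)\<^sup>2 \<partial>M) = r"
    using s by (intro nn_integral_eq_integral[OF i, THEN trans[OF sym], THEN ennreal_inj[THEN iffD1, rotated 2]])
      (auto simp: second_moment_def)
qed

text \<open>The cross term has mean zero given \<open>G\<close>. Values in [0, \<infinity>] leave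
  the second moment of \<open>X\<close> unrestricted.\<close>

lemma second_moment_indep_of:
  assumes M: "prob_space M" and Z: "indep_of M G Z (\<N> s)" and s: "0 \<le> s"
    and X: "X \<in> borel_measurable G"
  shows "second_moment M (\<lambda>\<omega>. X \<omega> + c * Z \<omega>) = second_moment M X + ennreal (c\<^sup>2 * s)"
proof -
  interpret prob_space M by fact
  have XM[measurable]: "X \<in> borel_measurable M" by (rule measurable_from_subalg[OF indep_ofD(1)[OF Z] X])
  have "second_moment M (\<lambda>\<omega>. X \<omega> + c * Z \<omega>) = (\<integral>\<^sup>+\<omega>. \<integral>\<^sup>+z. ennreal ((X \<omega> + c * z)\<^sup>2) \<partial>\<N> s \<partial>M)"
    unfolding second_moment_def
    by (rule nn_integral_indep_of_compose[OF M Z X, where h="\<lambda>z x. ennreal ((x + c * z)\<^sup>2)"]) measurable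
  also have "\<dots> = (\<integral>\<^sup>+\<omega>. ennreal ((X \<omega>)\<^sup>2) + ennreal (c\<^sup>2 * s) \<partial>M)"
    using s by (simp add: nn_integral_centered_normal_square)
  also have "\<dots> = second_moment M X + ennreal (c\<^sup>2 * s)"
    unfolding second_moment_def by (subst nn_integral_add) (auto simp: emeasure_space_1)
  finally show ?thesis .
qed

lemma second_moment_cmult:
  "X \<in> borel_measurable M \<Longrightarrow> second_moment M (\<lambda>\<omega>. c * X \<omega>) = ennreal (c\<^sup>2) * second_moment M X"
  unfolding second_moment_def by (simp add: power_mult_distrib ennreal_mult nn_integral_cmult)

lemma second_moment_zero [simp]: "second_moment M (\<lambda>\<omega>. 0) = 0"
  by (simp add: second_moment_def)

section \<open>The converse inequality\<close>

context gaussian_plant begin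

abbreviation (input) "m2 \<equiv> second_moment M"

lemma subalgebra_hist': "subalgebra (hist' t) (hist t)"
  by (simp add: hist'_def subalgebra_adjoin)

lemma subalgebra_hist_Suc': "subalgebra (hist (Suc t)) (hist' t)"
  by (simp add: hist_Suc subalgebra_adjoin)

lemma subalgebra_hist_Suc: "subalgebra (hist (Suc t)) (hist t)"
  by (rule subalgebra_trans[OF subalgebra_hist_Suc' subalgebra_hist'])

lemma subalgebra_hist: "subalgebra M (hist t)"
  by (rule indep_ofD(1)[OF indep_of_inn])

lemma space_hist [simp]: "space (hist t) = space M"
  using subalgebra_hist by (simp add: subalgebra_def)

lemma hist'_measurable: "f \<in> measurable (hist t) N \<Longrightarrow> f \<in> measurable (hist' t) N"
  by (rule measurable_from_subalg[OF subalgebra_hist'])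

lemma hist_Suc_measurable: "f \<in> measurable (hist' t) N \<Longrightarrow> f \<in> measurable (hist (Suc t)) N"
  by (rule measurable_from_subalg[OF subalgebra_hist_Suc'])

lemma hist_mono_measurable: "s \<le> t \<Longrightarrow> f \<in> measurable (hist s) N \<Longrightarrow> f \<in> measurable (hist t) N"
proof (induction t rule: dec_induct)
  case (step t)
  then show ?case by (intro hist_Suc_measurable hist'_measurable) simp
qed

lemma hist_measurable: "f \<in> measurable (hist t) N \<Longrightarrow> f \<in> measurable M N"
  by (rule measurable_from_subalg[OF subalgebra_hist])

lemma inn_hist': "inn t \<in> borel_measurable (hist' t)"
  unfolding hist'_def by (rule measurable_adjoin_new)

lemma n_hist: "n (Suc t) \<in> borel_measurable (hist (Suc t))"
  unfolding hist_Suc by (rule measurable_adjoin_new)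

definition nu :: "nat \<Rightarrow> 'a \<Rightarrow> real" where
  "nu t = (\<lambda>\<omega>. kgain t * inn t \<omega>)"

lemma nu_hist': "nu t \<in> borel_measurable (hist' t)"
  using inn_hist'[of t] unfolding nu_def by measurable

lemma indep_of_nu: "indep_of M (hist t) (nu t) (\<N> (nvar t))"
proof -
  have "0 \<le> pred t + V" using pred_pos[of t] V by simp
  then show ?thesis
    using indep_of_scale[OF prob_space_axioms indep_of_inn, of t "kgain t"]
    by (simp add: distr_centered_normal_scale nvar_kgain nu_def)
qed

text \<open>The observer's estimate of the state, a fully observed linear system driven by
  \<open>nu\<close>. It starts at 0, the mean of \<open>x0\<close>. With zero control it is the
  source that the receiver has to track.\<close>

primrec est :: "(nat \<Rightarrow> 'a \<Rightarrow> real) \<Rightarrow> nat \<Rightarrow> 'a \<Rightarrow> real" where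
  "est u 0 = (\<lambda>\<omega>. 0)"
| "est u (Suc t) = (\<lambda>\<omega>. \<alpha> * est u t \<omega> + u t \<omega> + nu t \<omega>)"

primrec outputs :: "(nat \<Rightarrow> 'a \<Rightarrow> real) \<Rightarrow> nat \<Rightarrow> 'a measure" where
  "outputs b 0 = sigma (space M) {}"
| "outputs b (Suc t) = adjoin (outputs b t) (b (Suc t))"

lemma space_outputs [simp]: "space (outputs b t) = space M"
  by (induction t) auto

lemma est_hist':
  assumes "\<And>s. s \<le> t \<Longrightarrow> u s \<in> borel_measurable (hist s)"
  shows "est u (Suc t) \<in> borel_measurable (hist' t)"
  using assms
proof (induction t)
  case 0
  have [measurable]: "nu 0 \<in> borel_measurable (hist' 0)" "u 0 \<in> borel_measurable (hist' 0)"
    using 0 by (auto intro: nu_hist' hist'_measurable)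
  show ?case by simp
next
  case (Suc t)
  have "est u (Suc t) \<in> borel_measurable (hist' t)" by (rule Suc.IH) (simp add: Suc.prems)
  then have "est u (Suc t) \<in> borel_measurable (hist' (Suc t))"
    by (rule hist'_measurable[OF hist_Suc_measurable])
  moreover have "u (Suc t) \<in> borel_measurable (hist' (Suc t))"
    using Suc.prems by (auto intro: hist'_measurable)
  ultimately show ?case
    using nu_hist'[of "Suc t"] unfolding est.simps(2)[of u "Suc t"] by (intro borel_measurable_add borel_measurable_times) auto
qed

lemma est_hist:
  assumes "\<And>s. s < t \<Longrightarrow> u s \<in> borel_measurable (hist s)"
  shows "est u t \<in> borel_measurable (hist t)"
  using assms by (cases t) (auto intro!: hist_Suc_measurable est_hist' simp del: est.simps(2))

end

section \<open>Estimation over the channel and the expected log-likelihood\<close>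

lemma ln_normal_density_0:
  "0 < s \<Longrightarrow> ln (normal_density 0 (sqrt s) x) = - ln (2 * pi * s) / 2 - x\<^sup>2 / (2 * s)"
  by (simp add: normal_density_0_eq ln_div ln_sqrt)

lemma ln_ratio:
  fixes p q r s t :: real
  assumes "0 < p" "0 < q" "0 < r" "0 < s" "0 < t"
  shows "ln (p * (q / r * (s / t))) = ln p + (ln q - ln r + (ln s - ln t))"
  using assms by (simp add: ln_mult_pos ln_divide_pos)

text \<open>The converse concerns estimation without controls. The input may use all of
  \<open>hist' t\<close>, past channel noise included, so feedback from the receiver is covered; the
  estimate need only be a function of the outputs.\<close>

locale channel_estimation = gaussian_plant +
  fixes a xh :: "nat \<Rightarrow> 'a \<Rightarrow> real"
  assumes a: "\<And>t. a (Suc t) \<in> borel_measurable (hist' t)"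
    and xh: "\<And>t. xh t \<in> borel_measurable (outputs (\<lambda>t \<omega>. a t \<omega> + n t \<omega>) t)"
    and xh_0: "xh 0 = (\<lambda>\<omega>. 0)"
begin

definition b :: "nat \<Rightarrow> 'a \<Rightarrow> real" where
  "b t = (\<lambda>\<omega>. a t \<omega> + n t \<omega>)"

definition err :: "nat \<Rightarrow> 'a \<Rightarrow> real" where
  "err t = (\<lambda>\<omega>. est (\<lambda>_ _. 0) t \<omega> - xh t \<omega>)"

lemma xh_outputs: "xh t \<in> borel_measurable (outputs b t)"
  using xh[of t] by (simp add: b_def[abs_def])

lemma b_hist: "b (Suc t) \<in> borel_measurable (hist (Suc t))"
  unfolding b_def using a[of t] n_hist[of t] hist_Suc_measurable by (intro borel_measurable_add) auto

lemma subalgebra_outputs: "subalgebra (hist t) (outputs b t)"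
proof (induction t)
  case (Suc t)
  then show ?case
    using b_hist[of t] subalgebra_trans[OF subalgebra_hist_Suc] by (auto intro!: adjoin_least)
qed (simp add: subalgebra_refl)

lemma err_hist: "err t \<in> borel_measurable (hist t)"
  unfolding err_def
  by (intro borel_measurable_diff est_hist measurable_from_subalg[OF subalgebra_outputs xh_outputs]) auto

primrec lik :: "(nat \<Rightarrow> real) \<Rightarrow> nat \<Rightarrow> 'a \<Rightarrow> real" where
  "lik d 0 = (\<lambda>\<omega>. 1)"
| "lik d (Suc t) = (\<lambda>\<omega>. lik d t \<omega> *
     (normal_density 0 (sqrt (d (Suc t))) (err (Suc t) \<omega>) /
        normal_density 0 (sqrt (\<alpha>\<^sup>2 * d t + nvar t)) (\<alpha> * err t \<omega> + nu t \<omega>) *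
      (normal_density 0 (sqrt (1 + 1 / SNR)) (b (Suc t) \<omega>) / normal_density 0 (sqrt (1 / SNR)) (n (Suc t) \<omega>))))"

text \<open>\<open>d 0 = 0\<close> matches \<open>err 0 = 0\<close>; the later targets are free
  positive numbers.\<close>

context
  fixes d :: "nat \<Rightarrow> real"
  assumes d_0: "d 0 = 0" and d_Suc: "\<And>t. 0 < d (Suc t)"
begin

lemma d_nonneg: "0 \<le> d t"
  using d_0 d_Suc by (cases t) (auto intro: less_imp_le)

definition sig :: "nat \<Rightarrow> real" where
  "sig t = \<alpha>\<^sup>2 * d t + nvar t"

lemma sig_pos: "0 < sig t"
  using d_nonneg[of t] nvar_pos[of t] by (simp add: sig_def add_nonneg_pos)

lemma lik_pos: "0 < lik d t \<omega>"
proof (induction t)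
  case (Suc t)
  then show ?case
    using d_Suc[of t] sig_pos[of t] SNR
    by (auto intro!: mult_pos_pos divide_pos_pos normal_density_pos simp: sig_def add_pos_pos)
qed simp

lemma err_Suc: "err (Suc t) = (\<lambda>\<omega>. \<alpha> * err t \<omega> + nu t \<omega> - (xh (Suc t) \<omega> - \<alpha> * xh t \<omega>))"
  by (auto simp: err_def algebra_simps)

lemma err_nu_hist': "(\<lambda>\<omega>. \<alpha> * err t \<omega> + nu t \<omega>) \<in> borel_measurable (hist' t)"
  using hist'_measurable[OF err_hist[of t]] nu_hist'[of t] by measurable

lemma lik_hist: "lik d t \<in> borel_measurable (hist t)"
proof (induction t)
  case (Suc t)
  have [measurable]: "lik d t \<in> borel_measurable (hist (Suc t))"
    "(\<lambda>\<omega>. \<alpha> * err t \<omega> + nu t \<omega>) \<in> borel_measurable (hist (Suc t))"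
    "err (Suc t) \<in> borel_measurable (hist (Suc t))" "b (Suc t) \<in> borel_measurable (hist (Suc t))"
    "n (Suc t) \<in> borel_measurable (hist (Suc t))"
    using Suc by (auto intro: hist_Suc_measurable hist'_measurable err_nu_hist' err_hist b_hist n_hist)
  show ?case unfolding lik.simps by measurable
qed simp

text \<open>At time 0 the weight is 1 and the error is the point mass at 0. Each later step is
  \<open>likelihood_step\<close>, with \<open>xh (Suc t) - \<alpha> * xh t\<close> as the correction
  made from the outputs.\<close>

lemma lik_invariant:
  "prob_space (density M (\<lambda>\<omega>. ennreal (lik d t \<omega>))) \<and>
   indep_of (density M (\<lambda>\<omega>. ennreal (lik d t \<omega>))) (outputs b t) (err t) (\<N> (d t))"
proof (induction t)
  case 0
  have eq: "density M (\<lambda>\<omega>. ennreal (lik d 0 \<omega>)) = M" by (simp add: density_1)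
  have "err 0 = (\<lambda>\<omega>. 0)" by (simp add: err_def xh_0)
  moreover have "indep_of M (outputs b 0) (\<lambda>\<omega>. 0) (\<N> 0)"
    unfolding indep_of_def
  proof (intro conjI ballI)
    show "subalgebra M (outputs b 0)" using subalgebra_trans[OF subalgebra_hist subalgebra_outputs] .
    show "prob_space (\<N> 0)" by (rule prob_space_centered_normal) simp
    fix A and B :: "real set" assume "A \<in> sets (outputs b 0)" "B \<in> sets borel"
    then show "emeasure M ((\<lambda>\<omega>. 0) -` B \<inter> A) = emeasure (\<N> 0) B * emeasure M A"
      by (cases "0 \<in> B") (auto simp: centered_normal_def indicator_def)
  qed auto
  ultimately show ?case unfolding eq d_0 by (simp add: prob_space_axioms)
next
  case (Suc t)
  have c: "(\<lambda>\<omega>. xh (Suc t) \<omega> - \<alpha> * xh t \<omega>) \<in> borel_measurable (adjoin (outputs b t) (b (Suc t)))"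
    using xh_outputs[of "Suc t"] measurable_adjoin[OF xh_outputs[of t]]
    by (intro borel_measurable_diff borel_measurable_times) auto
  have r: "0 < 1 / SNR" "0 < 1 + 1 / SNR" using SNR by (auto simp: add_pos_pos)
  note * = likelihood_step[OF prob_space_axioms indep_of_nu indep_of_channel d_nonneg nvar_pos r(1) d_Suc r(2)
      subalgebra_outputs subalgebra_hist' nu_hist' lik_hist lik_pos conjunct1[OF Suc] err_hist
      conjunct2[OF Suc] a refl b_def c err_Suc lik.simps(2)]
  show ?case using * by simp
qed

text \<open>The expected logarithm of \<open>lik\<close> is at most 0. Each logarithm is quadratic
  in variables with known second moments, and the power bound makes the two quadratic channel terms
  together nonnegative in expectation.\<close>

lemma converse:
  assumes D: "\<And>t. t \<le> N \<Longrightarrow> m2 (err t) = ennreal (D t)" "\<And>t. 0 \<le> D t"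
    and power: "\<And>t. t < N \<Longrightarrow> m2 (a (Suc t)) \<le> 1"
  shows "(\<Sum>t<N. ln (sig t / d (Suc t)) / 2 - D (Suc t) / (2 * d (Suc t)) + (\<alpha>\<^sup>2 * D t + nvar t) / (2 * sig t))
     \<le> real N * (ln (1 + SNR) / 2)"
proof -
  define r where "r = 1 / SNR"
  define R where "R = 1 + 1 / SNR"
  have r0: "0 < r" "0 < R" using SNR by (auto simp: r_def R_def add_pos_pos)
  define T where "T t \<omega> = (- ln (2 * pi * d (Suc t)) / 2 - (err (Suc t) \<omega>)\<^sup>2 / (2 * d (Suc t)))
     - (- ln (2 * pi * sig t) / 2 - (\<alpha> * err t \<omega> + nu t \<omega>)\<^sup>2 / (2 * sig t))
     + ((- ln (2 * pi * R) / 2 - (b (Suc t) \<omega>)\<^sup>2 / (2 * R)) - (- ln (2 * pi * r) / 2 - (n (Suc t) \<omega>)\<^sup>2 / (2 * r)))" for t \<omega>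
  have lnlik: "ln (lik d k \<omega>) = (\<Sum>t<k. T t \<omega>)" for k \<omega>
  proof (induction k)
    case (Suc k)
    have p: "0 < normal_density 0 (sqrt (d (Suc k))) x" "0 < normal_density 0 (sqrt (sig k)) x"
       "0 < normal_density 0 (sqrt R) x" "0 < normal_density 0 (sqrt r) x" for x
      using d_Suc[of k] sig_pos[of k] r0 by (auto intro!: normal_density_pos)
    have "lik d (Suc k) \<omega> = lik d k \<omega> *
     (normal_density 0 (sqrt (d (Suc k))) (err (Suc k) \<omega>) /
        normal_density 0 (sqrt (sig k)) (\<alpha> * err k \<omega> + nu k \<omega>) *
      (normal_density 0 (sqrt R) (b (Suc k) \<omega>) / normal_density 0 (sqrt r) (n (Suc k) \<omega>)))"
      by (simp add: sig_def r_def R_def)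
    then show ?case
      using Suc sig_pos[of k] d_Suc[of k] r0
      by (simp only: ln_ratio[OF lik_pos p] ln_normal_density_0 T_def sum.lessThan_Suc)
  qed simp
  have M1: "prob_space (density M (\<lambda>\<omega>. ennreal (lik d N \<omega>)))" using lik_invariant by blast
  have likM[measurable]: "lik d t \<in> borel_measurable M" for t by (rule hist_measurable[OF lik_hist])
  have lik1: "(\<integral>\<^sup>+\<omega>. ennreal (lik d N \<omega>) \<partial>M) = 1"
    using prob_space.emeasure_space_1[OF M1] by (simp add: emeasure_density cong: nn_integral_cong)
  have iL: "integrable M (lik d N)"
    by (rule integrableI_nonneg) (auto simp: lik1 lik_pos less_imp_le)
  have L1: "(\<integral>\<omega>. lik d N \<omega> \<partial>M) = 1"
    using nn_integral_eq_integral[OF iL] lik1 by (simp add: lik_pos less_imp_le)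
  have [measurable]: "err t \<in> borel_measurable M" "nu t \<in> borel_measurable M"
    "b (Suc t) \<in> borel_measurable M" "a (Suc t) \<in> borel_measurable M" for t
    by (auto intro: hist_measurable err_hist b_hist hist_Suc_measurable nu_hist' a)
  have T: "integrable M (T t)" "ln (sig t / d (Suc t)) / 2 - D (Suc t) / (2 * d (Suc t)) + (\<alpha>\<^sup>2 * D t + nvar t) / (2 * sig t)
      - ln (1 + SNR) / 2 \<le> (\<integral>\<omega>. T t \<omega> \<partial>M)" if tN: "t < N" for t
  proof -
    note e = second_moment_finite[OF _ D(1)[of "Suc t"] D(2)]
    have sp: "m2 (\<lambda>\<omega>. \<alpha> * err t \<omega> + nu t \<omega>) = ennreal (\<alpha>\<^sup>2 * D t + nvar t)"
      using second_moment_indep_of[OF prob_space_axioms indep_of_nu less_imp_le[OF nvar_pos], of "\<lambda>\<omega>. \<alpha> * err t \<omega>" t 1]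
        err_hist[of t] that D(1)[of t] D(2) nvar_pos[of t]
      by (simp add: second_moment_cmult ennreal_mult'[symmetric])
    note p = second_moment_finite[OF _ sp]
    obtain A where A: "m2 (a (Suc t)) = ennreal A" "0 \<le> A" "A \<le> 1"
      using power[OF tN] by (cases "m2 (a (Suc t))" rule: ennreal_cases) (auto simp: top_unique)
    have sb: "m2 (b (Suc t)) = ennreal (A + r)"
      using second_moment_indep_of[OF prob_space_axioms indep_of_channel _ a, of t 1] r0 A
      by (simp add: b_def r_def ennreal_plus[symmetric] del: ennreal_plus)
    note bb = second_moment_finite[OF _ sb]
    have sn: "m2 (n (Suc t)) = ennreal r"
      using second_moment_indep_of[OF prob_space_axioms indep_of_channel, of "\<lambda>\<omega>. 0" t 1] r0
      by (simp add: r_def)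
    note nn = second_moment_finite[OF _ sn]
    have I: "integrable M (\<lambda>\<omega>. (err (Suc t) \<omega>)\<^sup>2)" "integrable M (\<lambda>\<omega>. (\<alpha> * err t \<omega> + nu t \<omega>)\<^sup>2)"
      "integrable M (\<lambda>\<omega>. (b (Suc t) \<omega>)\<^sup>2)" "integrable M (\<lambda>\<omega>. (n (Suc t) \<omega>)\<^sup>2)"
      using e(1) p(1) bb(1) nn(1) that D(2) nvar_pos[of t] A r0 by auto
    have V: "(\<integral>\<omega>. (err (Suc t) \<omega>)\<^sup>2 \<partial>M) = D (Suc t)" "(\<integral>\<omega>. (\<alpha> * err t \<omega> + nu t \<omega>)\<^sup>2 \<partial>M) = \<alpha>\<^sup>2 * D t + nvar t"
      "(\<integral>\<omega>. (b (Suc t) \<omega>)\<^sup>2 \<partial>M) = A + r" "(\<integral>\<omega>. (n (Suc t) \<omega>)\<^sup>2 \<partial>M) = r"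
      using e(2) p(2) bb(2) nn(2) that D(2) nvar_pos[of t] A r0 by auto
    show "integrable M (T t)" unfolding T_def using I by simp
    have "(\<integral>\<omega>. T t \<omega> \<partial>M) = (- ln (2 * pi * d (Suc t)) / 2 - D (Suc t) / (2 * d (Suc t)))
     - (- ln (2 * pi * sig t) / 2 - (\<alpha>\<^sup>2 * D t + nvar t) / (2 * sig t))
     + ((- ln (2 * pi * R) / 2 - (A + r) / (2 * R)) - (- ln (2 * pi * r) / 2 - r / (2 * r)))"
      unfolding T_def using I V by (simp add: prob_space)
    also have "\<dots> = ln (sig t / d (Suc t)) / 2 - D (Suc t) / (2 * d (Suc t)) + (\<alpha>\<^sup>2 * D t + nvar t) / (2 * sig t)
      + ln (r / R) / 2 + (1 / 2 - (A + r) / (2 * R))"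
      using r0 d_Suc[of t] sig_pos[of t] by (simp add: ln_mult ln_div field_simps)
    also have "ln (r / R) = - ln (1 + SNR)"
    proof -
      have "r / R = 1 / (1 + SNR)" using SNR by (simp add: r_def R_def field_simps)
      then show ?thesis using SNR by (simp add: ln_div)
    qed
    finally have eq: "(\<integral>\<omega>. T t \<omega> \<partial>M) = ln (sig t / d (Suc t)) / 2 - D (Suc t) / (2 * d (Suc t)) + (\<alpha>\<^sup>2 * D t + nvar t) / (2 * sig t)
      + - ln (1 + SNR) / 2 + (1 / 2 - (A + r) / (2 * R))" .
    have "(A + r) / (2 * R) \<le> R / (2 * R)" using A r0 by (intro divide_right_mono) (auto simp: r_def R_def)
    then have "0 \<le> 1 / 2 - (A + r) / (2 * R)" using r0 by simp
    then show "ln (sig t / d (Suc t)) / 2 - D (Suc t) / (2 * d (Suc t)) + (\<alpha>\<^sup>2 * D t + nvar t) / (2 * sig t)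
      - ln (1 + SNR) / 2 \<le> (\<integral>\<omega>. T t \<omega> \<partial>M)" unfolding eq by linarith
  qed
  have "(\<Sum>t<N. \<integral>\<omega>. T t \<omega> \<partial>M) = (\<integral>\<omega>. ln (lik d N \<omega>) \<partial>M)"
    unfolding lnlik using T(1) by (intro Bochner_Integration.integral_sum[symmetric]) auto
  also have "\<dots> \<le> (\<integral>\<omega>. lik d N \<omega> - 1 \<partial>M)"
  proof (rule integral_mono)
    show "integrable M (\<lambda>\<omega>. ln (lik d N \<omega>))" unfolding lnlik using T(1) by (intro Bochner_Integration.integrable_sum) auto
    show "integrable M (\<lambda>\<omega>. lik d N \<omega> - 1)" using iL by simp
    show "ln (lik d N \<omega>) \<le> lik d N \<omega> - 1" for \<omega> by (rule ln_le_minus_one[OF lik_pos])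
  qed
  also have "\<dots> = 0" using iL by (simp add: L1 prob_space)
  finally have "(\<Sum>t<N. \<integral>\<omega>. T t \<omega> \<partial>M) \<le> 0" .
  moreover have "(\<Sum>t<N. ln (sig t / d (Suc t)) / 2 - D (Suc t) / (2 * d (Suc t)) + (\<alpha>\<^sup>2 * D t + nvar t) / (2 * sig t)
      - ln (1 + SNR) / 2) \<le> (\<Sum>t<N. \<integral>\<omega>. T t \<omega> \<partial>M)"
    using T(2) by (intro sum_mono) auto
  ultimately show ?thesis by (simp add: sum_subtractf)
qed

end

end

section \<open>Averages\<close>

lemma cesaro_zero:
  fixes f :: "nat \<Rightarrow> real"
  assumes f: "f \<longlonglongrightarrow> 0"
  shows "(\<lambda>n. (\<Sum>i<n. f i) / real n) \<longlonglongrightarrow> 0"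
proof (rule LIMSEQ_I)
  fix e :: real assume e: "0 < e"
  obtain N where N: "\<And>i. N \<le> i \<Longrightarrow> \<bar>f i\<bar> < e / 2"
    using LIMSEQ_D[OF f, of "e / 2"] e by auto
  define C where "C = (\<Sum>i<N. \<bar>f i\<bar>)"
  obtain N2 where N2: "2 * C / e < real N2" using reals_Archimedean2 by blast
  show "\<exists>n0. \<forall>n\<ge>n0. norm ((\<Sum>i<n. f i) / real n - 0) < e"
  proof (intro exI allI impI)
    fix n assume n: "Suc (max N N2) \<le> n"
    have split: "{..<n} = {..<N} \<union> {N..<n}" using n by auto
    have "\<bar>\<Sum>i<n. f i\<bar> \<le> (\<Sum>i<n. \<bar>f i\<bar>)" by (rule sum_abs)
    also have "(\<Sum>i<n. \<bar>f i\<bar>) = C + (\<Sum>i\<in>{N..<n}. \<bar>f i\<bar>)"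
      unfolding C_def split by (rule sum.union_disjoint) auto
    also have "(\<Sum>i\<in>{N..<n}. \<bar>f i\<bar>) \<le> (\<Sum>i\<in>{N..<n}. e / 2)"
      by (intro sum_mono less_imp_le[OF N]) simp
    also have "\<dots> \<le> real n * (e / 2)" using e by (simp add: mult_right_mono)
    finally have 1: "\<bar>\<Sum>i<n. f i\<bar> \<le> C + real n * (e / 2)" by simp
    have "2 * C / e < real n" using N2 n by linarith
    then have "C < real n * (e / 2)" using e by (simp add: field_simps)
    with 1 have "\<bar>\<Sum>i<n. f i\<bar> < real n * e" by linarith
    moreover have "0 < real n" using n by simp
    ultimately show "norm ((\<Sum>i<n. f i) / real n - 0) < e" by (simp add: field_simps)
  qed
qed

lemma cesaro:
  fixes f :: "nat \<Rightarrow> real"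
  assumes f: "f \<longlonglongrightarrow> l"
  shows "(\<lambda>n. (\<Sum>i<n. f i) / real n) \<longlonglongrightarrow> l"
proof -
  have "(\<lambda>n. (\<Sum>i<n. f i - l) / real n) \<longlonglongrightarrow> 0"
    using f by (intro cesaro_zero) (simp add: LIM_zero)
  then have "(\<lambda>n. (\<Sum>i<n. f i - l) / real n + l) \<longlonglongrightarrow> l" using tendsto_add[OF _ tendsto_const[of l]] by force
  moreover have "\<forall>\<^sub>F n in sequentially. (\<Sum>i<n. f i - l) / real n + l = (\<Sum>i<n. f i) / real n"
    using eventually_gt_at_top[of 0] by eventually_elim (simp add: sum_subtractf field_simps)
  ultimately show ?thesis by (rule Lim_transform_eventually)
qed

text \<open>Replacing \<open>g\<close> by its limit costs averages of
  \<open>A * \<bar>g i - m\<bar>\<close>, which vanish, and reversing the order leaves the sum of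
  \<open>f\<close> unchanged. Backward Riccati coefficients meet forward Kalman variances in this
  form.\<close>

lemma cesaro_convolution:
  fixes f g :: "nat \<Rightarrow> real"
  assumes f: "f \<longlonglongrightarrow> l" and g: "g \<longlonglongrightarrow> m"
  shows "(\<lambda>n. (\<Sum>i<n. f (n - Suc i) * g i) / real n) \<longlonglongrightarrow> l * m"
proof -
  obtain A where A: "\<And>i. \<bar>f i\<bar> \<le> A" using convergent_imp_Bseq[of f] f
    by (auto simp: convergent_def Bseq_def)
  have 1: "(\<lambda>n. (\<Sum>i<n. A * \<bar>g i - m\<bar>) / real n) \<longlonglongrightarrow> 0"
  proof (rule cesaro_zero)
    have "(\<lambda>i. A * \<bar>g i - m\<bar>) \<longlonglongrightarrow> A * \<bar>m - m\<bar>" by (intro tendsto_intros g)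
    then show "(\<lambda>i. A * \<bar>g i - m\<bar>) \<longlonglongrightarrow> 0" by simp
  qed
  have 2: "(\<lambda>n. (\<Sum>i<n. f (n - Suc i) * (g i - m)) / real n) \<longlonglongrightarrow> 0"
  proof (rule Lim_null_comparison[OF _ 1], rule always_eventually, rule allI)
    fix n
    have "\<bar>\<Sum>i<n. f (n - Suc i) * (g i - m)\<bar> \<le> (\<Sum>i<n. \<bar>f (n - Suc i) * (g i - m)\<bar>)" by (rule sum_abs)
    also have "\<dots> \<le> (\<Sum>i<n. A * \<bar>g i - m\<bar>)"
      unfolding abs_mult using A by (intro sum_mono mult_right_mono) auto
    finally show "norm ((\<Sum>i<n. f (n - Suc i) * (g i - m)) / real n) \<le> (\<Sum>i<n. A * \<bar>g i - m\<bar>) / real n"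
      by (simp add: divide_right_mono)
  qed
  have 3: "(\<lambda>n. m * ((\<Sum>i<n. f i) / real n)) \<longlonglongrightarrow> m * l"
    by (intro tendsto_mult tendsto_const cesaro f)
  have "(\<Sum>i<n. f (n - Suc i) * (g i - m)) / real n + m * ((\<Sum>i<n. f i) / real n) = (\<Sum>i<n. f (n - Suc i) * g i) / real n" for n
  proof -
    have "(\<Sum>i<n. f i) = (\<Sum>i<n. f (n - Suc i))"
      using sum.nat_diff_reindex[of f n] by simp
    then show ?thesis
      by (simp add: right_diff_distrib sum_subtractf sum_distrib_left[symmetric] sum_distrib_right[symmetric] diff_divide_distrib)
  qed
  with tendsto_add[OF 2 3] show ?thesis by (simp add: mult.commute)
qed

section \<open>Convergence of the Riccati recursion\<close>

text \<open>The other root \<open>(B - D) / 2\<close> is nonpositive because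
  \<open>B \<le> D\<close>. One statement serves both \<open>S\<close> and \<open>P\<close>, with
  \<open>W\<close>, \<open>V\<close> in place of \<open>Q\<close>, \<open>R\<close>.\<close>

lemma riccati_root:
  fixes a q r :: real
  assumes a: "1 < a" and q: "0 \<le> q" and r: "0 \<le> r" and pos: "0 < q \<or> 0 < r"
  shows "\<exists>!s. 0 < s \<and> s\<^sup>2 - (q + (a\<^sup>2 - 1) * r) * s - q * r = 0"
proof -
  define B where "B = q + (a\<^sup>2 - 1) * r"
  have a2: "1 < a\<^sup>2" using a by (simp add: one_less_power)
  have B: "0 < B"
  proof (cases "0 < q")
    case True
    then show ?thesis using a2 r by (simp add: B_def add_pos_nonneg)
  next
    case False
    then show ?thesis using pos a2 q by (simp add: B_def)
  qed
  have C: "0 \<le> q * r" using q r by simp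
  define D where "D = sqrt (B\<^sup>2 + 4 * (q * r))"
  have D2: "D\<^sup>2 = B\<^sup>2 + 4 * (q * r)" using C by (simp add: D_def)
  have DB: "B \<le> D" unfolding D_def using C B by (intro real_le_rsqrt) simp
  show ?thesis
  proof (rule ex1I[of _ "(B + D) / 2"])
    have "((B + D) / 2)\<^sup>2 - B * ((B + D) / 2) - q * r = (D\<^sup>2 - B\<^sup>2 - 4 * (q * r)) / 4"
      by (simp add: power2_eq_square field_simps)
    then show "0 < (B + D) / 2 \<and> ((B + D) / 2)\<^sup>2 - (q + (a\<^sup>2 - 1) * r) * ((B + D) / 2) - q * r = 0"
      using B DB D2 by (simp add: B_def[symmetric])
    fix s assume s: "0 < s \<and> s\<^sup>2 - (q + (a\<^sup>2 - 1) * r) * s - q * r = 0"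
    then have s': "s\<^sup>2 - B * s - q * r = 0" by (simp add: B_def)
    have "(2 * s - B)\<^sup>2 = 4 * (s\<^sup>2 - B * s - q * r) + D\<^sup>2"
      unfolding D2 by (simp add: power2_eq_square algebra_simps)
    with s' have "(2 * s - B)\<^sup>2 = D\<^sup>2" by simp
    then have "2 * s - B = D \<or> 2 * s - B = - D" by (simp add: power2_eq_iff)
    then show "s = (B + D) / 2" using s DB by auto
  qed
qed

lemma riccati_fixed_point:
  fixes a q r s :: real
  assumes r: "0 \<le> r" and s: "0 < s" "s\<^sup>2 - (q + (a\<^sup>2 - 1) * r) * s - q * r = 0"
  shows "s = a\<^sup>2 * r * s / (s + r) + q"
proof -
  have "s + r > 0" using r s by simp
  moreover have "s * (s + r) = a\<^sup>2 * r * s + q * (s + r)"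
    using s(2) by (simp add: power2_eq_square algebra_simps)
  ultimately show ?thesis by (simp add: field_simps)
qed

text \<open>Each step multiplies the distance to \<open>s\<close> by two factors:
  \<open>a\<^sup>2 * r / (s + r)\<close>, at most 1 by the fixed-point equation and
  \<open>0 \<le> q\<close>, and \<open>r / (f k + r)\<close>. The iterates stay above
  \<open>min p s\<close>, which keeps the second factor below a constant less than 1, so convergence
  is geometric.\<close>

lemma riccati_tendsto:
  fixes a p q r s :: real
  assumes p: "0 < p" and q: "0 \<le> q" and r: "0 \<le> r" and s: "0 < s"
    and fp: "s = a\<^sup>2 * r * s / (s + r) + q"
  shows "riccati a p q r \<longlonglongrightarrow> s" "\<And>k. 0 < riccati a p q r k"
proof -
  define m where "m = min p s"
  define f where "f = riccati a p q r"
  have m: "0 < m" using p s by (simp add: m_def)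
  have g0: "0 \<le> a\<^sup>2 * r / (s + r)" "a\<^sup>2 * r / (s + r) \<le> 1"
  proof -
    show "0 \<le> a\<^sup>2 * r / (s + r)" using r s by simp
    have "s * (a\<^sup>2 * r / (s + r)) \<le> s * 1" using fp q by (simp add: mult.commute)
    then show "a\<^sup>2 * r / (s + r) \<le> 1" using s by (simp only: mult_le_cancel_left_pos)
  qed
  have step: "f (Suc k) - s = (a\<^sup>2 * r / (s + r)) * (r / (f k + r)) * (f k - s)" if "0 < f k" for k
  proof -
    have "f (Suc k) - s = a\<^sup>2 * r * f k / (f k + r) - a\<^sup>2 * r * s / (s + r)"
      using fp unfolding f_def riccati.simps by linarith
    also have "\<dots> = (a\<^sup>2 * r / (s + r)) * (r / (f k + r)) * (f k - s)"
      using that s r by (simp add: divide_simps) (simp add: algebra_simps)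
    finally show ?thesis .
  qed
  have lb: "m \<le> f k" for k
  proof (induction k)
    case 0
    then show ?case by (simp add: f_def m_def)
  next
    case (Suc k)
    then have fk: "0 < f k" using m by simp
    let ?g = "(a\<^sup>2 * r / (s + r)) * (r / (f k + r))"
    have "0 \<le> r / (f k + r)" "r / (f k + r) \<le> 1" using r fk by auto
    then have g: "0 \<le> ?g" "?g \<le> 1"
      using mult_nonneg_nonneg[OF g0(1)] mult_le_one[OF g0(2)] by blast+
    have "min 0 (f k - s) \<le> ?g * (f k - s)"
    proof (cases "f k \<le> s")
      case True
      then have "1 * (f k - s) \<le> ?g * (f k - s)" using g by (intro mult_right_mono_neg) auto
      then show ?thesis by simp
    next
      case False
      then have "0 \<le> ?g * (f k - s)" by (intro mult_nonneg_nonneg[OF g(1)]) simp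
      then show ?thesis by simp
    qed
    with step[OF fk] Suc show ?case by (simp add: m_def min_def split: if_splits)
  qed
  then show pos: "\<And>k. 0 < riccati a p q r k" using m unfolding f_def by (metis less_le_trans)
  define \<rho> where "\<rho> = r / (m + r)"
  have \<rho>: "0 \<le> \<rho>" "\<rho> < 1" using r m by (auto simp: \<rho>_def)
  have bound: "\<bar>f k - s\<bar> \<le> \<bar>p - s\<bar> * \<rho> ^ k" for k
  proof (induction k)
    case 0
    then show ?case by (simp add: f_def)
  next
    case (Suc k)
    have fk: "0 < f k" using pos by (simp add: f_def)
    have "r / (f k + r) \<le> \<rho>" unfolding \<rho>_def using lb[of k] m r by (intro divide_left_mono) (auto intro!: mult_pos_pos)
    then have "(a\<^sup>2 * r / (s + r)) * (r / (f k + r)) \<le> 1 * \<rho>"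
      using g0 r fk by (intro mult_mono) auto
    then have "\<bar>(a\<^sup>2 * r / (s + r)) * (r / (f k + r))\<bar> \<le> \<rho>"
      using mult_nonneg_nonneg[OF g0(1) divide_nonneg_pos[OF r add_pos_nonneg[OF fk r]]]
      by (simp only: abs_of_nonneg)
    then have "\<bar>f (Suc k) - s\<bar> \<le> \<rho> * \<bar>f k - s\<bar>"
      unfolding step[OF fk] abs_mult by (rule mult_right_mono) simp
    also have "\<dots> \<le> \<rho> * (\<bar>p - s\<bar> * \<rho> ^ k)" using Suc \<rho> by (intro mult_left_mono)
    finally show ?case by (simp add: mult_ac)
  qed
  have "(\<lambda>k. \<bar>p - s\<bar> * \<rho> ^ k) \<longlonglongrightarrow> \<bar>p - s\<bar> * 0"
    using \<rho> by (intro tendsto_mult tendsto_const LIMSEQ_power_zero) auto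
  then have "(\<lambda>k. f k - s) \<longlonglongrightarrow> 0"
    using bound by (intro Lim_null_comparison[of "\<lambda>k. f k - s"]) (auto intro!: always_eventually)
  then show "riccati a p q r \<longlonglongrightarrow> s" by (simp add: LIM_zero_iff f_def)
qed

text \<open>Duality of filtering and control; it hands the Kalman limit to the convergence theorem
  for the Riccati recursion.\<close>

lemma kalman_pred_eq_riccati: "kalman_pred \<alpha> W V P0 t = riccati \<alpha> (\<alpha>\<^sup>2 * P0 + W) W V t"
proof (induction t)
  case 0
  then show ?case by (simp add: kalman_pred_def)
next
  case (Suc t)
  have "kalman_pred \<alpha> W V P0 (Suc t) = \<alpha>\<^sup>2 * (kalman_pred \<alpha> W V P0 t * V / (kalman_pred \<alpha> W V P0 t + V)) + W"
    by (simp add: kalman_pred_def)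
  then show ?case by (simp add: Suc mult_ac)
qed

section \<open>Asymptotic form of the converse inequality\<close>

text \<open>The probabilistic bound as a statement about real sequences, for all targets
  \<open>d\<close> at once; \<open>q\<close> stands for \<open>nvar\<close> and \<open>D\<close> for
  the error moments. What is drawn from it next is real analysis.\<close>

definition converse_inequality :: "real \<Rightarrow> real \<Rightarrow> (nat \<Rightarrow> real) \<Rightarrow> nat \<Rightarrow> (nat \<Rightarrow> real) \<Rightarrow> bool" where
  "converse_inequality \<alpha> snr q N D \<longleftrightarrow>
     (\<forall>d. d 0 = 0 \<and> (\<forall>t. 0 < d (Suc t)) \<longrightarrow>
        (\<Sum>t<N. ln ((\<alpha>\<^sup>2 * d t + q t) / d (Suc t)) / 2 - D (Suc t) / (2 * d (Suc t))
           + (\<alpha>\<^sup>2 * D t + q t) / (2 * (\<alpha>\<^sup>2 * d t + q t))) \<le> real N * (ln (1 + snr) / 2))"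

text \<open>The lower bound \<open>r\<close> is uniform in \<open>D\<close>. In the middle of the
  horizon the target is the fixed point, where the logarithms balance \<open>ln (1 + snr)\<close>;
  \<open>\<theta>\<close> absorbs the gap between \<open>q t\<close> and its limit.\<close>

lemma converse_inequality_asymptotic:
  fixes \<alpha> snr qi \<theta> :: real and q :: "nat \<Rightarrow> real"
  assumes a: "1 < \<alpha>" and snr: "\<alpha>\<^sup>2 < 1 + snr" and q: "\<And>t. 0 < q t" "q \<longlonglongrightarrow> qi" "0 < qi"
    and \<theta>: "0 < \<theta>" "\<theta> < 1"
  obtains r where "r \<longlonglongrightarrow> \<theta> * (qi / (1 + snr - \<alpha>\<^sup>2))"
    "\<And>N D. D 0 = 0 \<Longrightarrow> (\<And>t. 0 \<le> D t) \<Longrightarrow> converse_inequality \<alpha> snr q N D \<Longrightarrow>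
       real N * r N \<le> (\<Sum>t<N. D (Suc t))"
proof -
  define d where "d = qi / (1 + snr - \<alpha>\<^sup>2)"
  have d: "0 < d" using q snr by (simp add: d_def)
  define s where "s = \<alpha>\<^sup>2 * d + qi"
  have s: "0 < s" using d q by (simp add: s_def add_nonneg_pos)
  \<comment> \<open>The prediction variance \<open>s\<close> is \<open>1 + snr\<close> times
    \<open>d\<close>, exactly the reduction that one channel use can achieve.\<close>
  have sd: "s / d = 1 + snr"
  proof -
    have "d * (1 + snr - \<alpha>\<^sup>2) = qi" using snr by (simp add: d_def)
    then have "s = (1 + snr) * d" unfolding s_def by (simp add: algebra_simps)
    then show ?thesis using d by simp
  qed
  \<comment> \<open>In the limit this is the coefficient of one \<open>D t\<close>, once its
    occurrences in two consecutive summands are collected.\<close>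
  define l where "l = 1 / (2 * d) - \<alpha>\<^sup>2 / (2 * s)"
  have l_eq: "l * d = qi / (2 * s)" proof -
    have "l * d = 1 / 2 - \<alpha>\<^sup>2 * d / (2 * s)" using d by (simp add: l_def algebra_simps)
    also have "\<dots> = (s - \<alpha>\<^sup>2 * d) / (2 * s)" using s by (simp add: field_simps)
    finally show ?thesis by (simp add: s_def)
  qed
  have l: "0 < l"
  proof -
    have "0 < l * d" unfolding l_eq using q s by simp
    then show ?thesis using d by (simp add: zero_less_mult_iff)
  qed
  have lt: "l < l / \<theta>" using l \<theta> by (simp add: field_simps)
  have "(\<lambda>t. 1 / (2 * d) - \<alpha>\<^sup>2 / (2 * (\<alpha>\<^sup>2 * d + q t))) \<longlonglongrightarrow> 1 / (2 * d) - \<alpha>\<^sup>2 / (2 * (\<alpha>\<^sup>2 * d + qi))"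
    using s by (intro tendsto_intros q) (simp add: s_def)
  then have "\<forall>\<^sub>F t in sequentially. 1 / (2 * d) - \<alpha>\<^sup>2 / (2 * (\<alpha>\<^sup>2 * d + q t)) < l / \<theta>"
    using lt by (intro order_tendstoD) (auto simp: l_def s_def)
  then obtain K where K: "\<And>t. K \<le> t \<Longrightarrow> 1 / (2 * d) - \<alpha>\<^sup>2 / (2 * (\<alpha>\<^sup>2 * d + q t)) < l / \<theta>"
    by (auto simp: eventually_sequentially)
  \<comment> \<open>The target near the ends, chosen so that \<open>1 / (2 * d0)\<close> alone
    equals \<open>l\<close>: before \<open>K\<close> the subtracted part is only known to be
    nonnegative, and at the horizon it is absent.\<close>
  define d0 where "d0 = 1 / (2 * l)"
  have d0: "0 < d0" "1 / (2 * d0) = l" using l by (auto simp: d0_def)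
  define e where "e t = (if t = 0 then 0 else if t < K then d0 else d)" for t :: nat
  define g where "g t = ln ((\<alpha>\<^sup>2 * e t + q t) / e (Suc t)) / 2 + q t / (2 * (\<alpha>\<^sup>2 * e t + q t))" for t
  \<comment> \<open>The worst loss in the last logarithm from ending at \<open>d0\<close>; it is 0
    if the last target is \<open>d0\<close> anyway.\<close>
  define \<kappa> where "\<kappa> = min 0 (ln (d / d0) / 2)"
  define r where "r N = \<theta> / l * ((\<Sum>t<N. g t) / real N - ln (1 + snr) / 2 + \<kappa> / real N)" for N
  have e_pos: "0 < e (Suc t)" "0 \<le> e t" for t using d d0 by (auto simp: e_def)
  have sp: "0 < \<alpha>\<^sup>2 * x + q t" if "0 \<le> x" for x t using q(1)[of t] that by (simp add: add_nonneg_pos)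
  show ?thesis
  proof (rule that)
    have "(\<lambda>t. ln ((\<alpha>\<^sup>2 * d + q t) / d) / 2 + q t / (2 * (\<alpha>\<^sup>2 * d + q t))) \<longlonglongrightarrow>
       ln ((\<alpha>\<^sup>2 * d + qi) / d) / 2 + qi / (2 * (\<alpha>\<^sup>2 * d + qi))"
      using s d by (intro tendsto_intros q) (auto simp: s_def)
    moreover have "\<forall>\<^sub>F t in sequentially. ln ((\<alpha>\<^sup>2 * d + q t) / d) / 2 + q t / (2 * (\<alpha>\<^sup>2 * d + q t)) = g t"
      using eventually_ge_at_top[of "Suc K"] by eventually_elim (auto simp: g_def e_def)
    ultimately have "g \<longlonglongrightarrow> ln ((\<alpha>\<^sup>2 * d + qi) / d) / 2 + qi / (2 * (\<alpha>\<^sup>2 * d + qi))"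
      by (rule Lim_transform_eventually)
    then have "g \<longlonglongrightarrow> ln (1 + snr) / 2 + l * d" using l_eq sd by (simp add: s_def)
    from cesaro[OF this] have "r \<longlonglongrightarrow> \<theta> / l * (ln (1 + snr) / 2 + l * d - ln (1 + snr) / 2 + 0)"
      unfolding r_def by (intro tendsto_intros lim_const_over_n)
    then show "r \<longlonglongrightarrow> \<theta> * (qi / (1 + snr - \<alpha>\<^sup>2))" using l by (simp add: d_def)
  next
    fix N :: nat and D :: "nat \<Rightarrow> real"
    assume D: "D 0 = 0" "\<And>t. 0 \<le> D t" and ci: "converse_inequality \<alpha> snr q N D"
    show "real N * r N \<le> (\<Sum>t<N. D (Suc t))"
    proof (cases N)
      case 0
      then show ?thesis by simp
    next
      case (Suc n)
      \<comment> \<open>Only the last target is moved to \<open>d0\<close>, so that \<open>e\<close>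
        and \<open>g\<close> do not depend on \<open>N\<close>.\<close>
      define f where "f = e(N := d0)"
      have f_pos: "0 < f (Suc t)" "0 \<le> f t" for t using e_pos d0 by (auto simp: f_def)
      have f0: "f 0 = 0" using Suc by (simp add: f_def e_def)
      have "(\<Sum>t<N. ln ((\<alpha>\<^sup>2 * f t + q t) / f (Suc t)) / 2 - D (Suc t) / (2 * f (Suc t))
           + (\<alpha>\<^sup>2 * D t + q t) / (2 * (\<alpha>\<^sup>2 * f t + q t))) \<le> real N * (ln (1 + snr) / 2)"
        using ci f0 f_pos unfolding converse_inequality_def by blast
      also have "(\<Sum>t<N. ln ((\<alpha>\<^sup>2 * f t + q t) / f (Suc t)) / 2 - D (Suc t) / (2 * f (Suc t))
           + (\<alpha>\<^sup>2 * D t + q t) / (2 * (\<alpha>\<^sup>2 * f t + q t))) =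
         (\<Sum>t<N. ln ((\<alpha>\<^sup>2 * f t + q t) / f (Suc t)) / 2 + q t / (2 * (\<alpha>\<^sup>2 * f t + q t))) -
         ((\<Sum>t<N. D (Suc t) / (2 * f (Suc t))) - (\<Sum>t<N. \<alpha>\<^sup>2 * D t / (2 * (\<alpha>\<^sup>2 * f t + q t))))"
        by (simp add: sum_subtractf[symmetric] sum.distrib[symmetric] add_divide_distrib algebra_simps)
      finally have 1: "(\<Sum>t<N. ln ((\<alpha>\<^sup>2 * f t + q t) / f (Suc t)) / 2 + q t / (2 * (\<alpha>\<^sup>2 * f t + q t)))
           - real N * (ln (1 + snr) / 2) \<le>
         (\<Sum>t<N. D (Suc t) / (2 * f (Suc t))) - (\<Sum>t<N. \<alpha>\<^sup>2 * D t / (2 * (\<alpha>\<^sup>2 * f t + q t)))" by simp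
      have "(\<Sum>t<N. \<alpha>\<^sup>2 * D t / (2 * (\<alpha>\<^sup>2 * f t + q t))) = (\<Sum>t<n. \<alpha>\<^sup>2 * D (Suc t) / (2 * (\<alpha>\<^sup>2 * f (Suc t) + q (Suc t))))"
        unfolding Suc sum.lessThan_Suc_shift by (simp add: D)
      then have "(\<Sum>t<N. D (Suc t) / (2 * f (Suc t))) - (\<Sum>t<N. \<alpha>\<^sup>2 * D t / (2 * (\<alpha>\<^sup>2 * f t + q t))) =
        (\<Sum>t<n. D (Suc t) * (1 / (2 * f (Suc t)) - \<alpha>\<^sup>2 / (2 * (\<alpha>\<^sup>2 * f (Suc t) + q (Suc t))))) + D N / (2 * f N)"
        unfolding Suc by (simp add: right_diff_distrib sum_subtractf mult.commute)
      also have "\<dots> \<le> (\<Sum>t<n. D (Suc t) * (l / \<theta>)) + D N * (l / \<theta>)"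
      proof (intro add_mono sum_mono mult_left_mono D)
        fix t assume t: "t \<in> {..<n}"
        have fe: "f (Suc t) = e (Suc t)" using t Suc by (simp add: f_def)
        show "1 / (2 * f (Suc t)) - \<alpha>\<^sup>2 / (2 * (\<alpha>\<^sup>2 * f (Suc t) + q (Suc t))) \<le> l / \<theta>"
        proof (cases "Suc t < K")
          case True
          have "0 \<le> \<alpha>\<^sup>2 / (2 * (\<alpha>\<^sup>2 * f (Suc t) + q (Suc t)))" using sp[OF f_pos(2)[of "Suc t"], of "Suc t"] by simp
          moreover have "1 / (2 * f (Suc t)) = l" using True d0 by (simp add: fe e_def)
          ultimately show ?thesis using lt by linarith
        next
          case False
          then show ?thesis using K[of "Suc t"] by (simp add: fe e_def)
        qed
      next
        have "D N / (2 * f N) = D N * l" using d0(2) by (simp add: f_def) (metis mult.right_neutral times_divide_eq_right)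
        also have "\<dots> \<le> D N * (l / \<theta>)" using lt D by (intro mult_left_mono) auto
        finally show "D N / (2 * f N) \<le> D N * (l / \<theta>)" .
      qed
      also have "\<dots> = l / \<theta> * (\<Sum>t<N. D (Suc t))"
        unfolding Suc by (simp add: sum_distrib_left algebra_simps)
      finally have 2: "(\<Sum>t<N. ln ((\<alpha>\<^sup>2 * f t + q t) / f (Suc t)) / 2 + q t / (2 * (\<alpha>\<^sup>2 * f t + q t)))
           - real N * (ln (1 + snr) / 2) \<le> l / \<theta> * (\<Sum>t<N. D (Suc t))" using 1 by simp
      have "(\<Sum>t<N. g t) + \<kappa> \<le> (\<Sum>t<N. ln ((\<alpha>\<^sup>2 * f t + q t) / f (Suc t)) / 2 + q t / (2 * (\<alpha>\<^sup>2 * f t + q t)))"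
      proof -
        have "g n + \<kappa> \<le> ln ((\<alpha>\<^sup>2 * f n + q n) / f (Suc n)) / 2 + q n / (2 * (\<alpha>\<^sup>2 * f n + q n))"
        proof -
          have fn: "f n = e n" "f (Suc n) = d0" using Suc by (auto simp: f_def)
          let ?x = "\<alpha>\<^sup>2 * e n + q n"
          have x: "0 < ?x" using sp[OF e_pos(2)] .
          have "ln (?x / d0) = ln (?x / e (Suc n)) + ln (e (Suc n) / d0)"
            using x e_pos(1)[of n] d0 by (simp add: ln_divide_pos)
          moreover have "\<kappa> \<le> ln (e (Suc n) / d0) / 2"
            using d0 by (auto simp: \<kappa>_def e_def)
          ultimately show ?thesis unfolding fn g_def by linarith
        qed
        moreover have "(\<Sum>t<n. g t) = (\<Sum>t<n. ln ((\<alpha>\<^sup>2 * f t + q t) / f (Suc t)) / 2 + q t / (2 * (\<alpha>\<^sup>2 * f t + q t)))"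
          using Suc by (intro sum.cong) (auto simp: g_def f_def)
        ultimately show ?thesis unfolding Suc by simp
      qed
      with 2 have "(\<Sum>t<N. g t) + \<kappa> - real N * (ln (1 + snr) / 2) \<le> l / \<theta> * (\<Sum>t<N. D (Suc t))" by linarith
      then have "\<theta> / l * ((\<Sum>t<N. g t) + \<kappa> - real N * (ln (1 + snr) / 2)) \<le> \<theta> / l * (l / \<theta> * (\<Sum>t<N. D (Suc t)))"
        using l \<theta> by (intro mult_left_mono) auto
      moreover have "real N * r N = \<theta> / l * ((\<Sum>t<N. g t) + \<kappa> - real N * (ln (1 + snr) / 2))"
      proof -
        have "0 < real N" using Suc by simp
        then have "real N * ((\<Sum>t<N. g t) / real N - ln (1 + snr) / 2 + \<kappa> / real N) =
            (\<Sum>t<N. g t) + \<kappa> - real N * (ln (1 + snr) / 2)"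
          by (simp add: field_simps)
        then show ?thesis unfolding r_def by (metis mult.left_commute)
      qed
      ultimately show ?thesis using l \<theta> by simp
    qed
  qed
qed

text \<open>With a constant target \<open>d \<ge> B\<close> the terms in \<open>D\<close> telescope
  up to a nonnegative remainder, and if \<open>1 + snr \<le> \<alpha>\<^sup>2\<close> every step
  exceeds the permitted rate by \<open>\<delta> > 0\<close>. The summand \<open>q0 / d\<close>
  settles the case of equality.\<close>

lemma converse_inequality_bounded:
  fixes \<alpha> snr B q0 :: real
  assumes a: "1 < \<alpha>" and q: "\<And>t. q0 \<le> q t" "0 < q0" and snr: "0 < snr"
    and D: "D 0 = 0" "\<And>t. 0 \<le> D t" "\<And>t. D t \<le> B"
    and ci: "\<And>N. converse_inequality \<alpha> snr q N D"
  shows "\<alpha>\<^sup>2 < 1 + snr"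
proof (rule ccontr)
  assume "\<not> \<alpha>\<^sup>2 < 1 + snr"
  then have le: "1 + snr \<le> \<alpha>\<^sup>2" by simp
  define d where "d = max B 1"
  have d: "0 < d" "B \<le> d" by (auto simp: d_def)
  define \<delta> where "\<delta> = (ln (\<alpha>\<^sup>2 + q0 / d) - ln (1 + snr)) / 2"
  have \<delta>: "0 < \<delta>"
  proof -
    have "0 < q0 / d" using q d by simp
    with le have "1 + snr < \<alpha>\<^sup>2 + q0 / d" by linarith
    then show ?thesis using snr by (simp add: \<delta>_def)
  qed
  define e where "e t = (if t = 0 then 0 else d)" for t :: nat
  \<comment> \<open>Half the relative slack of \<open>D t\<close> below \<open>d\<close>; the terms
    in \<open>D\<close> of one summand are bounded below by a difference of consecutive
    values.\<close>
  define z where "z t = (if t = 0 then 0 else (d - D t) / (2 * d))" for t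
  have z: "0 \<le> z t" for t using D(3)[of t] d by (auto simp: z_def)
  define h where "h t = ln ((\<alpha>\<^sup>2 * e t + q t) / e (Suc t)) / 2 - D (Suc t) / (2 * e (Suc t))
           + (\<alpha>\<^sup>2 * D t + q t) / (2 * (\<alpha>\<^sup>2 * e t + q t))" for t
  have step: "ln (1 + snr) / 2 + \<delta> + z (Suc t) - z t \<le> h t" if "0 < t" for t
  proof -
    have qt: "0 < q t" using q(1)[of t] q(2) by linarith
    have s: "0 < \<alpha>\<^sup>2 * d + q t" using d qt by (simp add: add_nonneg_pos)
    have "ln (\<alpha>\<^sup>2 + q0 / d) \<le> ln ((\<alpha>\<^sup>2 * d + q t) / d)"
    proof -
      have "\<alpha>\<^sup>2 + q0 / d \<le> (\<alpha>\<^sup>2 * d + q t) / d" using q(1)[of t] d by (simp add: field_simps)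
      moreover have "0 < \<alpha>\<^sup>2 + q0 / d" using q d by (simp add: add_nonneg_pos)
      ultimately show ?thesis by simp
    qed
    moreover have "1 / 2 - z t \<le> (\<alpha>\<^sup>2 * D t + q t) / (2 * (\<alpha>\<^sup>2 * d + q t))"
    proof -
      have "(\<alpha>\<^sup>2 * D t + q t) / (2 * (\<alpha>\<^sup>2 * d + q t)) = 1 / 2 - \<alpha>\<^sup>2 * (d - D t) / (2 * (\<alpha>\<^sup>2 * d + q t))"
        using s by (simp add: field_simps)
      moreover have "\<alpha>\<^sup>2 * (d - D t) / (2 * (\<alpha>\<^sup>2 * d + q t)) \<le> \<alpha>\<^sup>2 * (d - D t) / (2 * (\<alpha>\<^sup>2 * d))"
        using D(3)[of t] d qt s a by (intro divide_left_mono mult_nonneg_nonneg mult_pos_pos) auto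
      moreover have "\<alpha>\<^sup>2 * (d - D t) / (2 * (\<alpha>\<^sup>2 * d)) = z t" using that a by (simp add: z_def)
      ultimately show ?thesis by linarith
    qed
    moreover have "D (Suc t) / (2 * d) = 1 / 2 - z (Suc t)" using d by (simp add: z_def field_simps)
    moreover have "h t = ln ((\<alpha>\<^sup>2 * d + q t) / d) / 2 - D (Suc t) / (2 * d)
        + (\<alpha>\<^sup>2 * D t + q t) / (2 * (\<alpha>\<^sup>2 * d + q t))"
      using that by (simp add: h_def e_def)
    moreover have "C / 2 + (A - C) / 2 + y' - y \<le> x"
      if "A \<le> B'" "1 / 2 - y \<le> X" "E = 1 / 2 - y'" "x = B' / 2 - E + X" for A B' C X E x y y' :: real
      using that by (simp add: field_simps)
    ultimately show ?thesis unfolding \<delta>_def by blast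
  qed
  have sumh: "real N * (ln (1 + snr) / 2 + \<delta>) + z (Suc N) - z 1 + h 0 \<le> (\<Sum>t<Suc N. h t)" for N
  proof (induction N)
    case (Suc N)
    then show ?case using step[of "Suc N"] by (simp add: algebra_simps add_divide_distrib)
  qed simp
  have "(\<Sum>t<N. h t) \<le> real N * (ln (1 + snr) / 2)" for N
  proof -
    have "e 0 = 0 \<and> (\<forall>t. 0 < e (Suc t))" using d by (simp add: e_def)
    then show ?thesis using ci[of N] unfolding converse_inequality_def h_def by blast
  qed
  then have "real N * (ln (1 + snr) / 2 + \<delta>) + z (Suc N) - z 1 + h 0 \<le> real (Suc N) * (ln (1 + snr) / 2)" for N
    using sumh[of N] order_trans by blast
  then have "real N * \<delta> \<le> z 1 - h 0 + ln (1 + snr) / 2" for N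
  proof -
    have "real N * (c + \<delta>) + y - y1 + h0 \<le> real (Suc N) * c \<Longrightarrow> 0 \<le> y \<Longrightarrow> real N * \<delta> \<le> y1 - h0 + c" for c y y1 h0
      by (simp add: algebra_simps)
    then show ?thesis
      using z[of "Suc N"] \<open>\<And>N. real N * (ln (1 + snr) / 2 + \<delta>) + z (Suc N) - z 1 + h 0 \<le> real (Suc N) * (ln (1 + snr) / 2)\<close>
      by blast
  qed
  moreover obtain N where "(z 1 - h 0 + ln (1 + snr) / 2) / \<delta> < real N" using reals_Archimedean2 by blast
  then have "z 1 - h 0 + ln (1 + snr) / 2 < real N * \<delta>" using \<delta> by (simp add: field_simps)
  ultimately show False by (meson not_less)
qed

section \<open>The quadratic cost of a controlled plant\<close>

lemma avg_cost_eq: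
  assumes [measurable]: "\<And>t. x t \<in> borel_measurable M" "\<And>t. u t \<in> borel_measurable M"
    and pos: "0 \<le> F" "0 \<le> Q" "0 \<le> R"
  shows "avg_cost M F Q R T x u = (ennreal F * second_moment M (x (Suc T)) +
    (\<Sum>t=1..T. ennreal Q * second_moment M (x t) + ennreal R * second_moment M (u t))) / ennreal (real T)"
proof -
  have "(\<integral>\<^sup>+\<omega>. ennreal (F * (x (Suc T) \<omega>)\<^sup>2 + (\<Sum>t=1..T. Q * (x t \<omega>)\<^sup>2 + R * (u t \<omega>)\<^sup>2)) \<partial>M) =
    (\<integral>\<^sup>+\<omega>. ennreal F * ennreal ((x (Suc T) \<omega>)\<^sup>2) +
      (\<Sum>t=1..T. ennreal Q * ennreal ((x t \<omega>)\<^sup>2) + ennreal R * ennreal ((u t \<omega>)\<^sup>2)) \<partial>M)"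
    using pos by (intro nn_integral_cong)
      (simp add: ennreal_plus sum_nonneg ennreal_mult sum_ennreal[symmetric] del: sum_ennreal)
  also have "\<dots> = ennreal F * second_moment M (x (Suc T)) +
    (\<Sum>t=1..T. ennreal Q * second_moment M (x t) + ennreal R * second_moment M (u t))"
    unfolding second_moment_def by (simp add: nn_integral_add nn_integral_sum nn_integral_cmult)
  finally show ?thesis by (simp add: avg_cost_def)
qed

context gaussian_plant begin

section \<open>Separation of estimation from control, and completing the square\<close>

primrec plant_state :: "(nat \<Rightarrow> 'a \<Rightarrow> real) \<Rightarrow> nat \<Rightarrow> 'a \<Rightarrow> real" where
  "plant_state u 0 = x0"
| "plant_state u (Suc t) = (\<lambda>\<omega>. \<alpha> * plant_state u t \<omega> + w t \<omega> + u t \<omega>)"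

lemma plant_state_eq: "plant_state u t = (\<lambda>\<omega>. est u t \<omega> + eps t \<omega>)"
proof (induction t)
  case (Suc t)
  then show ?case by (simp add: eps_Suc nu_def algebra_simps)
qed simp

text \<open>The accumulated effect of the controls. A receiver can compute it from the outputs, so
  subtracting it leaves an uncontrolled estimation problem: control has no dual effect.\<close>

primrec drift :: "(nat \<Rightarrow> 'a \<Rightarrow> real) \<Rightarrow> nat \<Rightarrow> 'a \<Rightarrow> real" where
  "drift u 0 = (\<lambda>\<omega>. 0)"
| "drift u (Suc t) = (\<lambda>\<omega>. \<alpha> * drift u t \<omega> + u t \<omega>)"

lemma est_drift: "est u t \<omega> = est (\<lambda>_ _. 0) t \<omega> + drift u t \<omega>"
  by (induction t) (auto simp: algebra_simps)

text \<open>A bound uniform in \<open>t\<close>, the \<open>q0\<close> of the stability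
  converse.\<close>

lemma nvar_ge: "W * (W / (W + V)) \<le> nvar t"
proof -
  have "W / (W + V) \<le> pred t / (pred t + V)"
    using pred_ge[of t] pred_pos[of t] W V by (simp add: field_simps mult_left_mono)
  then have "W * (W / (W + V)) \<le> pred t * (pred t / (pred t + V))"
    using pred_ge[of t] W V by (intro mult_mono) auto
  then show ?thesis by (simp add: nvar_def power2_eq_square)
qed

context
  fixes u :: "nat \<Rightarrow> 'a \<Rightarrow> real"
  assumes u: "\<And>t. u t \<in> borel_measurable (hist t)"
begin

lemma est_hist_u: "est u t \<in> borel_measurable (hist t)"
  by (rule est_hist[OF u])

lemma u_measurable: "u t \<in> borel_measurable M"
  and est_measurable: "est u t \<in> borel_measurable M"
  by (auto intro: hist_measurable u est_hist_u)

lemma plant_state_measurable: "plant_state u t \<in> borel_measurable M"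
  unfolding plant_state_eq using est_measurable[of t] eps_measurable[of t] by measurable

lemma second_moment_plant_state:
  "m2 (plant_state u t) = m2 (est u t) + ennreal (filt t)"
  using second_moment_indep_of[OF prob_space_axioms indep_of_eps filt_nonneg est_hist_u, of t 1]
  by (simp add: plant_state_eq)

lemma second_moment_est_Suc:
  "m2 (est u (Suc t)) = m2 (\<lambda>\<omega>. \<alpha> * est u t \<omega> + u t \<omega>) + ennreal (nvar t)"
  using second_moment_indep_of[OF prob_space_axioms indep_of_nu less_imp_le[OF nvar_pos],
      of "\<lambda>\<omega>. \<alpha> * est u t \<omega> + u t \<omega>" t 1] u[of t] est_hist_u[of t]
  by simp

text \<open>The square is completed pointwise: \<open>L\<close> produces the mixed term and the
  Riccati equation for \<open>S\<close> matches the square of the estimate; \<open>nu t\<close> then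
  adds its variance. All terms are nonnegative, so the identity survives infinite moments.\<close>

lemma lqg_stage:
  assumes S: "S = \<alpha>\<^sup>2 * R * S' / (S' + R) + Q" and pos: "0 < S' + R" "0 \<le> S'" "0 \<le> Q" "0 \<le> R"
    and L: "L = \<alpha> * S' / (S' + R)"
  shows "ennreal S' * m2 (est u (Suc t)) +
      (ennreal Q * m2 (est u t) + ennreal R * m2 (u t)) =
    ennreal (S' * nvar t) + ennreal S * m2 (est u t) +
      ennreal (S' + R) * m2 (\<lambda>\<omega>. u t \<omega> + L * est u t \<omega>)"
proof -
  note [measurable] = u_measurable est_measurable
  have S0: "0 \<le> S" using S pos by simp
  have alg: "S' * (\<alpha> * z + y)\<^sup>2 + (Q * z\<^sup>2 + R * y\<^sup>2) = S * z\<^sup>2 + (S' + R) * (y + L * z)\<^sup>2" for z y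
  proof -
    have LL: "(S' + R) * L = \<alpha> * S'" using L pos by simp
    have L2: "(S' + R) * L\<^sup>2 = \<alpha>\<^sup>2 * S' - \<alpha>\<^sup>2 * R * S' / (S' + R)"
    proof -
      have "(S' + R) * L\<^sup>2 = (\<alpha> * S')\<^sup>2 / (S' + R)"
        using pos by (simp add: L power_divide power2_eq_square)
      also have "\<dots> = \<alpha>\<^sup>2 * S' - \<alpha>\<^sup>2 * R * S' / (S' + R)"
        using pos by (simp add: field_simps power2_eq_square)
      finally show ?thesis .
    qed
    have "S * z\<^sup>2 + (S' + R) * (y + L * z)\<^sup>2 = S * z\<^sup>2 + (S' + R) * y\<^sup>2 + 2 * ((S' + R) * L) * (y * z) + ((S' + R) * L\<^sup>2) * z\<^sup>2"
      by (simp add: power2_eq_square algebra_simps)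
    also have "\<dots> = S' * (\<alpha> * z + y)\<^sup>2 + (Q * z\<^sup>2 + R * y\<^sup>2)"
      unfolding LL L2 S by (simp add: power2_eq_square algebra_simps)
    finally show ?thesis by simp
  qed
  have "ennreal S' * m2 (\<lambda>\<omega>. \<alpha> * est u t \<omega> + u t \<omega>) +
      (ennreal Q * m2 (est u t) + ennreal R * m2 (u t)) =
    (\<integral>\<^sup>+\<omega>. ennreal (S' * (\<alpha> * est u t \<omega> + u t \<omega>)\<^sup>2 + (Q * (est u t \<omega>)\<^sup>2 + R * (u t \<omega>)\<^sup>2)) \<partial>M)"
    unfolding second_moment_def using pos
    by (simp add: nn_integral_cmult[symmetric] nn_integral_add[symmetric] ennreal_mult)
  also have "\<dots> = ennreal S * m2 (est u t) + ennreal (S' + R) * m2 (\<lambda>\<omega>. u t \<omega> + L * est u t \<omega>)"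
    unfolding alg second_moment_def using pos S0
    by (simp add: nn_integral_cmult[symmetric] nn_integral_add[symmetric] ennreal_mult del: ennreal_plus)
       (simp add: ennreal_mult)
  finally show ?thesis
    unfolding second_moment_est_Suc using nvar_pos[of t] pos
    by (simp add: distrib_left ennreal_mult add.assoc add.left_commute less_imp_le)
qed

text \<open>\<open>S\<close> may be any solution of the recursion: the lower bound takes the one
  ending in \<open>F\<close>, the upper bound the stationary one.\<close>

lemma lqg_sum:
  assumes "\<And>t. 1 \<le> t \<Longrightarrow> t \<le> T \<Longrightarrow> S t = \<alpha>\<^sup>2 * R * S (Suc t) / (S (Suc t) + R) + Q \<and>
      0 < S (Suc t) + R \<and> 0 \<le> S (Suc t) \<and> L t = \<alpha> * S (Suc t) / (S (Suc t) + R)"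
    and "0 \<le> Q" "0 \<le> R"
  shows "ennreal (S (Suc T)) * m2 (est u (Suc T)) +
      (\<Sum>t=1..T. ennreal Q * m2 (est u t) + ennreal R * m2 (u t)) =
    ennreal (S 1) * m2 (est u 1) + (\<Sum>t=1..T. ennreal (S (Suc t) * nvar t) +
      ennreal (S (Suc t) + R) * m2 (\<lambda>\<omega>. u t \<omega> + L t * est u t \<omega>))"
  using assms(1)
proof (induction T)
  case (Suc T)
  let ?c = "\<lambda>t. ennreal Q * m2 (est u t) + ennreal R * m2 (u t)"
  let ?e = "\<lambda>t. ennreal (S (Suc t) * nvar t) + ennreal (S (Suc t) + R) * m2 (\<lambda>\<omega>. u t \<omega> + L t * est u t \<omega>)"
  have "ennreal (S (Suc (Suc T))) * m2 (est u (Suc (Suc T))) + (\<Sum>t=1..Suc T. ?c t)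
     = (ennreal (S (Suc (Suc T))) * m2 (est u (Suc (Suc T))) + ?c (Suc T)) + (\<Sum>t=1..T. ?c t)"
    by (simp add: add_ac)
  also have "ennreal (S (Suc (Suc T))) * m2 (est u (Suc (Suc T))) + ?c (Suc T)
     = ennreal (S (Suc (Suc T)) * nvar (Suc T)) + ennreal (S (Suc T)) * m2 (est u (Suc T)) +
      ennreal (S (Suc (Suc T)) + R) * m2 (\<lambda>\<omega>. u (Suc T) \<omega> + L (Suc T) * est u (Suc T) \<omega>)"
    using Suc.prems[of "Suc T"] assms(2,3) by (intro lqg_stage) auto
  also have "\<dots> + (\<Sum>t=1..T. ?c t) = (ennreal (S (Suc T)) * m2 (est u (Suc T)) + (\<Sum>t=1..T. ?c t)) + ?e (Suc T)"
    by (simp only: add_ac)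
  also have "ennreal (S (Suc T)) * m2 (est u (Suc T)) + (\<Sum>t=1..T. ?c t) =
      ennreal (S 1) * m2 (est u 1) + (\<Sum>t=1..T. ?e t)"
    by (rule Suc.IH, rule Suc.prems) simp_all
  also have "\<dots> + ?e (Suc T) = ennreal (S 1) * m2 (est u 1) + (\<Sum>t=1..Suc T. ?e t)"
    by (simp only: sum.cl_ivl_Suc add_ac) simp
  finally show ?case .
qed simp

lemma avg_cost_plant:
  assumes pos: "0 \<le> F" "0 \<le> Q" "0 \<le> R"
  shows "avg_cost M F Q R T (plant_state u) u =
    (ennreal (F * filt (Suc T) + (\<Sum>t=1..T. Q * filt t)) +
     (ennreal F * m2 (est u (Suc T)) +
      (\<Sum>t=1..T. ennreal Q * m2 (est u t) + ennreal R * m2 (u t)))) / ennreal (real T)"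
proof -
  have "ennreal F * m2 (plant_state u (Suc T)) +
    (\<Sum>t=1..T. ennreal Q * m2 (plant_state u t) + ennreal R * m2 (u t)) =
    (ennreal (F * filt (Suc T)) + (\<Sum>t=1..T. ennreal (Q * filt t))) +
     (ennreal F * m2 (est u (Suc T)) +
      (\<Sum>t=1..T. ennreal Q * m2 (est u t) + ennreal R * m2 (u t)))"
    unfolding second_moment_plant_state using pos filt_nonneg
    by (simp add: distrib_left ennreal_mult sum.distrib add_ac)
  also have "ennreal (F * filt (Suc T)) + (\<Sum>t=1..T. ennreal (Q * filt t)) = ennreal (F * filt (Suc T) + (\<Sum>t=1..T. Q * filt t))"
    using pos filt_nonneg by (simp add: sum_nonneg)
  finally show ?thesis by (subst avg_cost_eq) (auto simp: pos plant_state_measurable u_measurable)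
qed

end

section \<open>Remote control as estimation over the channel\<close>

lemma outputs_mono_measurable: "s \<le> t \<Longrightarrow> f \<in> measurable (outputs b s) N \<Longrightarrow> f \<in> measurable (outputs b t) N"
proof (induction t rule: dec_induct)
  case (step t)
  then show ?case by (auto intro: measurable_adjoin)
qed

lemma drift_outputs:
  "(\<And>s. s < t \<Longrightarrow> u s \<in> borel_measurable (outputs b s)) \<Longrightarrow> drift u t \<in> borel_measurable (outputs b t)"
proof (induction t)
  case (Suc t)
  have m: "drift u t \<in> borel_measurable (outputs b (Suc t))" "u t \<in> borel_measurable (outputs b (Suc t))"
    by (rule outputs_mono_measurable[OF le_SucI[OF order_refl]], rule Suc.IH, rule Suc.prems, simp)
       (rule outputs_mono_measurable[OF le_SucI[OF order_refl] Suc.prems], simp)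
  show ?case unfolding drift.simps
    by (intro borel_measurable_add borel_measurable_times borel_measurable_const m)
next
  case 0
  show ?case unfolding drift.simps by (rule borel_measurable_const)
qed

text \<open>All that the lower bounds retain of a closed loop: the information patterns of
  transmitter and receiver.\<close>

definition remote :: "(nat \<Rightarrow> 'a \<Rightarrow> real) \<Rightarrow> (nat \<Rightarrow> 'a \<Rightarrow> real) \<Rightarrow> bool" where
  "remote a u \<longleftrightarrow> (\<forall>t. a (Suc t) \<in> borel_measurable (hist' t)) \<and>
     (\<forall>t. u t \<in> borel_measurable (outputs (\<lambda>t \<omega>. a t \<omega> + n t \<omega>) t)) \<and> u 0 = (\<lambda>\<omega>. 0)"

lemma remoteD:
  assumes "remote a u"
  shows "a (Suc t) \<in> borel_measurable (hist' t)"
    and "u t \<in> borel_measurable (outputs (\<lambda>t \<omega>. a t \<omega> + n t \<omega>) t)"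
    and "u 0 = (\<lambda>\<omega>. 0)"
  using assms unfolding remote_def by blast+

lemma remote_estimation:
  assumes "remote a u" "xh 0 = (\<lambda>\<omega>. 0)"
    "\<And>t. xh t \<in> borel_measurable (outputs (\<lambda>t \<omega>. a t \<omega> + n t \<omega>) t)"
  shows "channel_estimation M \<alpha> W V P0 SNR x0 w v n a xh"
  by (intro channel_estimation.intro gaussian_plant_axioms channel_estimation_axioms.intro
      remoteD(1)[OF assms(1)] assms(2,3))

lemma remote_hist:
  assumes r: "remote a u"
  shows "u t \<in> borel_measurable (hist t)"
proof -
  interpret channel_estimation M \<alpha> W V P0 SNR x0 w v n a "\<lambda>t \<omega>. 0"
    by (rule remote_estimation[OF r]) auto
  have b: "b = (\<lambda>t \<omega>. a t \<omega> + n t \<omega>)" by (simp add: b_def[abs_def])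
  show ?thesis
    by (rule measurable_from_subalg[OF subalgebra_outputs]) (unfold b, rule remoteD(2)[OF r])
qed

text \<open>\<open>est u t + l t * u t\<close> is the uncontrolled estimate minus
  \<open>- (drift u t + l t * u t)\<close>, a function of the outputs, hence an estimation error.
  The free factor \<open>l\<close> fits the completed squares and, with \<open>l = 0\<close>, the
  estimate itself.\<close>

lemma remote_converse:
  assumes r: "remote a u"
    and D: "\<And>t. t \<le> N \<Longrightarrow> m2 (\<lambda>\<omega>. est u t \<omega> + l t * u t \<omega>) = ennreal (D t)" "\<And>t. 0 \<le> D t"
    and power: "\<And>t. t < N \<Longrightarrow> m2 (a (Suc t)) \<le> 1"
  shows "converse_inequality \<alpha> SNR nvar N D"
proof -
  define xh where "xh t = (\<lambda>\<omega>. - (drift u t \<omega> + l t * u t \<omega>))" for t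
  let ?b = "\<lambda>t \<omega>. a t \<omega> + n t \<omega>"
  have uo: "u t \<in> borel_measurable (outputs ?b t)" for t by (rule remoteD(2)[OF r])
  have "xh t \<in> borel_measurable (outputs ?b t)" for t
  proof -
    show ?thesis
      unfolding xh_def
      by (intro borel_measurable_uminus borel_measurable_add borel_measurable_times borel_measurable_const
          drift_outputs uo)
  qed
  moreover have "xh 0 = (\<lambda>\<omega>. 0)" by (simp add: xh_def remoteD(3)[OF r])
  ultimately interpret channel_estimation M \<alpha> W V P0 SNR x0 w v n a xh by (intro remote_estimation[OF r])
  have "err t = (\<lambda>\<omega>. est u t \<omega> + l t * u t \<omega>)" for t
    by (auto simp: err_def xh_def est_drift[of u t])
  then have "m2 (err t) = ennreal (D t)" if "t \<le> N" for t using D that by simp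
  then show ?thesis
    unfolding converse_inequality_def using converse[of _ N D] D(2) power by (simp add: sig_def)
qed

lemma remote_stable_imp:
  assumes r: "remote a u" and power: "\<And>t. 1 \<le> t \<Longrightarrow> m2 (a t) \<le> 1"
    and B: "\<And>t. m2 (plant_state u t) \<le> ennreal B"
  shows "\<alpha>\<^sup>2 < 1 + SNR"
proof (rule converse_inequality_bounded[OF alpha])
  define D where "D t = enn2real (m2 (est u t))" for t
  \<comment> \<open>\<open>ennreal B\<close> is 0 for negative \<open>B\<close>, hence the
    \<open>max\<close>.\<close>
  have le: "m2 (est u t) \<le> ennreal (max B 0)" for t
    using B[of t] second_moment_plant_state[OF remote_hist[OF r], of t]
    by (metis add_increasing2 ennreal_leI le_zero_eq max.cobounded1 order.trans order_refl zero_le add.commute le_add_same_cancel1)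
  have m: "m2 (est u t) = ennreal (D t)" for t
    unfolding D_def using le[of t] by (intro ennreal_enn2real[symmetric]) (auto simp: less_top[symmetric] top_unique)
  show "W * (W / (W + V)) \<le> nvar t" for t by (rule nvar_ge)
  show "0 < W * (W / (W + V))" using W V by simp
  show "0 < SNR" by (rule SNR)
  show "D 0 = 0" by (simp add: D_def)
  show "0 \<le> D t" for t by (simp add: D_def)
  show "D t \<le> max B 0" for t using le[of t] unfolding m by (subst (asm) ennreal_le_iff) auto
  show "converse_inequality \<alpha> SNR nvar N D" for N
    by (rule remote_converse[OF r, where l="\<lambda>_. 0"]) (use m power in \<open>auto simp: D_def\<close>)
qed

end

section \<open>Lower bounds on the average cost\<close>

text \<open>\<open>0 < F\<close> and \<open>QR\<close> are what the hypothesis on the gains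
  supplies. Positivity of \<open>F\<close> keeps the Riccati iterates away from 0, which is also a
  fixed point when \<open>Q = 0\<close> and \<open>0 < R\<close>.\<close>

locale lqg_plant = gaussian_plant +
  fixes F Q R S P :: real
  assumes F: "0 < F" and Q: "0 \<le> Q" and R: "0 \<le> R" and QR: "0 < Q \<or> 0 < R"
    and S: "0 < S" "S\<^sup>2 - (Q + (\<alpha>\<^sup>2 - 1) * R) * S - Q * R = 0"
    and P: "0 < P" "P\<^sup>2 - ((\<alpha>\<^sup>2 - 1) * V + W) * P - V * W = 0"
begin

definition Pf :: real where "Pf = P * V / (P + V)"

lemma S_fixed: "S = \<alpha>\<^sup>2 * R * S / (S + R) + Q"
  by (rule riccati_fixed_point[OF R S])

lemma riccati_lim: "riccati \<alpha> F Q R \<longlonglongrightarrow> S" and riccati_pos: "0 < riccati \<alpha> F Q R k"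
  using riccati_tendsto[OF F Q R S(1) S_fixed] by auto

lemma pred_lim: "pred \<longlonglongrightarrow> P"
proof -
  have eq: "P = \<alpha>\<^sup>2 * V * P / (P + V) + W"
    by (rule riccati_fixed_point[OF V P(1)]) (use P(2) in \<open>simp add: algebra_simps\<close>)
  have "riccati \<alpha> (\<alpha>\<^sup>2 * P0 + W) W V \<longlonglongrightarrow> P"
    using P0 W by (intro riccati_tendsto(1)[OF _ _ V P(1) eq]) (auto simp: add_nonneg_pos)
  then show ?thesis by (simp add: kalman_pred_eq_riccati[abs_def])
qed

lemma PV: "0 < P + V" using P V by simp

lemma filt_lim: "filt \<longlonglongrightarrow> Pf"
proof -
  have "(\<lambda>t. pred t * V / (pred t + V)) \<longlonglongrightarrow> Pf"
    unfolding Pf_def using PV by (intro tendsto_intros pred_lim) simp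
  then have "(\<lambda>t. filt (Suc t)) \<longlonglongrightarrow> Pf" by (simp add: filt_Suc)
  then show ?thesis by (rule LIMSEQ_imp_Suc)
qed

lemma nvar_lim: "nvar \<longlonglongrightarrow> P - Pf"
proof -
  have "(\<lambda>t. pred t - filt (Suc t)) \<longlonglongrightarrow> P - Pf"
    by (intro tendsto_diff pred_lim LIMSEQ_Suc filt_lim)
  then show ?thesis by (simp add: nvar_eq[abs_def])
qed

lemma Pf_less: "0 \<le> Pf" "0 < P - Pf"
proof -
  show "0 \<le> Pf" using P V by (simp add: Pf_def)
  have "P - Pf = P\<^sup>2 / (P + V)" using PV by (simp add: Pf_def field_simps power2_eq_square)
  then show "0 < P - Pf" using P PV by simp
qed

abbreviation "ric \<equiv> riccati \<alpha> F Q R"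

text \<open>The coefficient \<open>ric k + R\<close> of the completed square times the squared gain,
  once the square is normalised to \<open>est + u / L\<close>.\<close>

definition wgt :: "nat \<Rightarrow> real" where
  "wgt k = \<alpha>\<^sup>2 * (ric k)\<^sup>2 / (ric k + R)"

text \<open>The part of the cost that no control can influence, without the terminal filtering
  error.\<close>

definition base :: "nat \<Rightarrow> real" where
  "base T = (\<Sum>i<T. Q * filt (Suc i)) + (\<Sum>i<T. ric (T - Suc i) * nvar (Suc i))"

lemma wgt_pos: "0 < wgt k"
  using riccati_pos[of k] R alpha by (simp add: wgt_def add_pos_nonneg)

lemma wgt_lim: "wgt \<longlonglongrightarrow> Q + (\<alpha>\<^sup>2 - 1) * S"
proof -
  have SR: "0 < S + R" using S R by simp
  have "\<alpha>\<^sup>2 * S\<^sup>2 / (S + R) = Q + (\<alpha>\<^sup>2 - 1) * S"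
  proof -
    have "\<alpha>\<^sup>2 * S\<^sup>2 / (S + R) = \<alpha>\<^sup>2 * S - \<alpha>\<^sup>2 * R * S / (S + R)"
      using SR by (simp add: field_simps power2_eq_square)
    also have "\<dots> = \<alpha>\<^sup>2 * S - (S - Q)" using S_fixed by linarith
    finally show ?thesis by (simp add: algebra_simps)
  qed
  moreover have "wgt \<longlonglongrightarrow> \<alpha>\<^sup>2 * S\<^sup>2 / (S + R)"
    unfolding wgt_def using SR by (intro tendsto_intros riccati_lim) simp
  ultimately show ?thesis by simp
qed

lemma base_lim: "(\<lambda>T. base T / real T) \<longlonglongrightarrow> Q * Pf + S * (P - Pf)"
proof -
  have "(\<lambda>T. (\<Sum>i<T. Q * filt (Suc i)) / real T) \<longlonglongrightarrow> Q * Pf"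
    by (intro cesaro tendsto_mult tendsto_const LIMSEQ_Suc filt_lim)
  moreover have "(\<lambda>T. (\<Sum>i<T. ric (T - Suc i) * nvar (Suc i)) / real T) \<longlonglongrightarrow> S * (P - Pf)"
    by (intro cesaro_convolution riccati_lim LIMSEQ_Suc nvar_lim)
  ultimately show ?thesis
    unfolding base_def add_divide_distrib by (rule tendsto_add)
qed

lemma base_nonneg: "0 \<le> base T"
  unfolding base_def using Q filt_nonneg riccati_pos nvar_pos
  by (intro add_nonneg_nonneg sum_nonneg mult_nonneg_nonneg) (auto intro: less_imp_le)

definition igain :: "nat \<Rightarrow> real" where
  "igain k = (ric k + R) / (\<alpha> * ric k)"

text \<open>Complete the square along the finite-horizon Riccati sequence, then drop the initial
  term and the terminal filtering error, both nonnegative.\<close>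

lemma avg_cost_lower:
  assumes u: "\<And>t. u t \<in> borel_measurable (hist t)"
  shows "(ennreal (base T) + (\<Sum>i<T. ennreal (wgt (T - Suc i)) *
       m2 (\<lambda>\<omega>. est u (Suc i) \<omega> + igain (T - Suc i) * u (Suc i) \<omega>)))
       / ennreal (real T) \<le> avg_cost M F Q R T (plant_state u) u"
proof -
  have [measurable]: "u t \<in> borel_measurable M" "est u t \<in> borel_measurable M" for t
    by (rule u_measurable[OF u], rule est_measurable[OF u])
  let ?S = "\<lambda>t. ric (T + 1 - t)" and ?L = "\<lambda>t. \<alpha> * ric (T - t) / (ric (T - t) + R)"
  have lq: "ennreal (?S (Suc T)) * m2 (est u (Suc T)) +
      (\<Sum>t=1..T. ennreal Q * m2 (est u t) + ennreal R * m2 (u t)) =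
    ennreal (?S 1) * m2 (est u 1) + (\<Sum>t=1..T. ennreal (?S (Suc t) * nvar t) +
      ennreal (?S (Suc t) + R) * m2 (\<lambda>\<omega>. u t \<omega> + ?L t * est u t \<omega>))"
  proof (rule lqg_sum[OF u _ Q R])
    fix t assume "1 \<le> t" "t \<le> T"
    then have "T + 1 - t = Suc (T - t)" by simp
    then show "?S t = \<alpha>\<^sup>2 * R * ?S (Suc t) / (?S (Suc t) + R) + Q \<and> 0 < ?S (Suc t) + R \<and>
       0 \<le> ?S (Suc t) \<and> ?L t = \<alpha> * ?S (Suc t) / (?S (Suc t) + R)"
      using riccati_pos[of "T - t"] R by simp
  qed
  have stage: "ennreal (?S (Suc t) + R) * m2 (\<lambda>\<omega>. u t \<omega> + ?L t * est u t \<omega>) =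
     ennreal (wgt (T - t)) * m2 (\<lambda>\<omega>. est u t \<omega> + igain (T - t) * u t \<omega>)" for t
  proof -
    have r: "0 < ric (T - t)" "0 < ric (T - t) + R" using riccati_pos[of "T - t"] R by auto
    have "(\<lambda>\<omega>. u t \<omega> + ?L t * est u t \<omega>) =
        (\<lambda>\<omega>. ?L t * (est u t \<omega> + igain (T - t) * u t \<omega>))"
    proof -
      have "?L t * igain (T - t) = 1" using r alpha by (simp add: igain_def)
      moreover have "y + c * e = c * (e + k * y)" if "c * k = 1" for c k e y :: real
        using that by (simp add: distrib_left flip: mult.assoc)
      ultimately show ?thesis by blast
    qed
    then have "m2 (\<lambda>\<omega>. u t \<omega> + ?L t * est u t \<omega>) = m2
        (\<lambda>\<omega>. ?L t * (est u t \<omega> + igain (T - t) * u t \<omega>))"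
      by (rule arg_cong)
    also have "\<dots> = ennreal ((?L t)\<^sup>2) * m2 (\<lambda>\<omega>. est u t \<omega> + igain (T - t) * u t \<omega>)"
      by (rule second_moment_cmult) measurable
    finally have "m2 (\<lambda>\<omega>. u t \<omega> + ?L t * est u t \<omega>) =
       ennreal ((?L t)\<^sup>2) * m2 (\<lambda>\<omega>. est u t \<omega> + igain (T - t) * u t \<omega>)" .
    moreover have "(ric (T - t) + R) * (?L t)\<^sup>2 = wgt (T - t)"
      using r by (simp add: wgt_def power_divide power_mult_distrib power2_eq_square)
    ultimately show ?thesis using r by (simp add: mult.assoc[symmetric] ennreal_mult[symmetric])
  qed
  have "ennreal (base T) + (\<Sum>i<T. ennreal (wgt (T - Suc i)) *
       m2 (\<lambda>\<omega>. est u (Suc i) \<omega> + igain (T - Suc i) * u (Suc i) \<omega>)) =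
     ennreal (\<Sum>t=1..T. Q * filt t) + (\<Sum>t=1..T. ennreal (?S (Suc t) * nvar t) +
      ennreal (?S (Suc t) + R) * m2 (\<lambda>\<omega>. u t \<omega> + ?L t * est u t \<omega>))"
  proof -
    have b: "base T = (\<Sum>t=1..T. Q * filt t) + (\<Sum>t=1..T. ?S (Suc t) * nvar t)"
      unfolding base_def by (simp add: sum.atLeast1_atMost_eq)
    have "ennreal (base T) = ennreal (\<Sum>t=1..T. Q * filt t) + (\<Sum>t=1..T. ennreal (?S (Suc t) * nvar t))"
    proof -
      have n: "0 \<le> Q * filt t" "0 \<le> ?S (Suc t) * nvar t" for t
        using Q filt_nonneg[of t] riccati_pos[of "T - t"] nvar_pos[of t]
        by (auto intro!: mult_nonneg_nonneg simp: less_imp_le)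
      show ?thesis unfolding b using n by (simp add: sum_nonneg)
    qed
    then show ?thesis
      unfolding stage by (simp add: sum.distrib sum.atLeast1_atMost_eq add.assoc)
  qed
  also have "\<dots> \<le> ennreal (F * filt (Suc T) + (\<Sum>t=1..T. Q * filt t)) +
     (ennreal F * m2 (est u (Suc T)) +
      (\<Sum>t=1..T. ennreal Q * m2 (est u t) + ennreal R * m2 (u t)))"
  proof (rule add_mono)
    show "ennreal (\<Sum>t=1..T. Q * filt t) \<le> ennreal (F * filt (Suc T) + (\<Sum>t=1..T. Q * filt t))"
      using F filt_nonneg[of "Suc T"] by (intro ennreal_leI) simp
    show "(\<Sum>t=1..T. ennreal (?S (Suc t) * nvar t) +
      ennreal (?S (Suc t) + R) * m2 (\<lambda>\<omega>. u t \<omega> + ?L t * est u t \<omega>)) \<le>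
      ennreal F * m2 (est u (Suc T)) +
      (\<Sum>t=1..T. ennreal Q * m2 (est u t) + ennreal R * m2 (u t))"
      using lq by (simp add: le_add_same_cancel2 flip: lq)
  qed
  finally show ?thesis
    unfolding avg_cost_plant[OF u less_imp_le[OF F] Q R] by (rule divide_right_mono_ennreal)
qed

lemma limsup_avg_cost_lower:
  assumes u: "\<And>T t. u T t \<in> borel_measurable (hist t)"
  shows "ennreal (Q * Pf + S * (P - Pf)) \<le> limsup (\<lambda>T. avg_cost M F Q R T (plant_state (u T)) (u T))"
proof -
  have "(\<lambda>T. ennreal (base T / real T)) \<longlonglongrightarrow> ennreal (Q * Pf + S * (P - Pf))"
    by (intro tendsto_ennrealI base_lim)
  then have "ennreal (Q * Pf + S * (P - Pf)) = limsup (\<lambda>T. ennreal (base T / real T))"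
    by (intro lim_imp_Limsup[symmetric]) auto
  also have "\<dots> \<le> limsup (\<lambda>T. avg_cost M F Q R T (plant_state (u T)) (u T))"
  proof (rule Limsup_mono, rule eventually_mono[OF eventually_gt_at_top[of 0]])
    fix T :: nat assume T: "0 < T"
    have "ennreal (base T / real T) = ennreal (base T) / ennreal (real T)"
      using T base_nonneg by (simp add: divide_ennreal)
    also have "\<dots> \<le> avg_cost M F Q R T (plant_state (u T)) (u T)"
      by (rule order_trans[OF divide_right_mono_ennreal avg_cost_lower[OF u]]) (simp add: le_add_same_cancel1)
    finally show "ennreal (base T / real T) \<le> avg_cost M F Q R T (plant_state (u T)) (u T)" .
  qed
  finally show ?thesis .
qed

text \<open>Weights with at least \<open>K\<close> steps to go exceed \<open>\<theta>\<close> times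
  their limit, so the last \<open>K\<close> stages are discarded and the estimation bound is applied
  up to time \<open>T - K\<close>. One factor \<open>\<theta>\<close> is lost in the weights and one
  in the estimation bound; both tend to 1.\<close>

lemma limsup_avg_cost_remote_lower:
  assumes r: "\<And>T. remote (a T) (u T)"
    and power: "\<And>T t. 1 \<le> t \<Longrightarrow> t \<le> T \<Longrightarrow> m2 (a T t) \<le> 1"
    and snr: "\<alpha>\<^sup>2 < 1 + SNR"
  shows "ennreal (Q * Pf + S * (P - Pf) + (Q + (\<alpha>\<^sup>2 - 1) * S) * ((P - Pf) / (1 + SNR - \<alpha>\<^sup>2)))
    \<le> limsup (\<lambda>T. avg_cost M F Q R T (plant_state (u T)) (u T))" (is "ennreal (?J + ?c * ?d) \<le> ?lim")
proof -
  have c: "0 < ?c"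
  proof -
    have "1 < \<alpha>\<^sup>2" using alpha by (simp add: one_less_power)
    then show ?thesis using Q S by (simp add: add_nonneg_pos)
  qed
  have bound: "ennreal (?J + \<theta> * ?c * (\<theta> * ?d)) \<le> ?lim" if \<theta>: "0 < \<theta>" "\<theta> < 1" for \<theta>
  proof -
    obtain r where r_lim: "r \<longlonglongrightarrow> \<theta> * ?d"
      and r_le: "\<And>N D. D 0 = 0 \<Longrightarrow> (\<And>t. 0 \<le> D t) \<Longrightarrow> converse_inequality \<alpha> SNR nvar N D \<Longrightarrow>
         real N * r N \<le> (\<Sum>t<N. D (Suc t))"
      using converse_inequality_asymptotic[OF alpha snr nvar_pos nvar_lim Pf_less(2) \<theta>] by blast
    have "\<forall>\<^sub>F k in sequentially. \<theta> * ?c < wgt k"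
      using \<theta> c by (intro order_tendstoD[OF wgt_lim]) simp
    then obtain K where K: "\<And>k. K \<le> k \<Longrightarrow> \<theta> * ?c < wgt k" by (auto simp: eventually_sequentially)
    define low where "low T = base T / real T + \<theta> * ?c * (real (T - K) / real T * r (T - K))" for T
    have lim: "low \<longlonglongrightarrow> ?J + \<theta> * ?c * (1 * (\<theta> * ?d))"
      unfolding low_def
    proof (intro tendsto_add tendsto_mult tendsto_const base_lim)
      show "(\<lambda>T. r (T - K)) \<longlonglongrightarrow> \<theta> * ?d"
        using r_lim by (rule filterlim_compose) (rule filterlim_minus_const_nat_at_top)
      have "(\<lambda>T. 1 - real K / real T) \<longlonglongrightarrow> 1 - 0"
        by (intro tendsto_diff tendsto_const lim_const_over_n)
      moreover have "\<forall>\<^sub>F T in sequentially. 1 - real K / real T = real (T - K) / real T"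
        using eventually_gt_at_top[of K] by eventually_elim (simp add: of_nat_diff field_simps)
      ultimately show "(\<lambda>T. real (T - K) / real T) \<longlonglongrightarrow> 1"
        using Lim_transform_eventually by fastforce
    qed
    have "ennreal (low T) \<le> avg_cost M F Q R T (plant_state (u T)) (u T)" if T: "0 < T" for T
    proof -
      define l where "l t = igain (T - t)" for t
      define m where "m t = m2 (\<lambda>\<omega>. est (u T) t \<omega> + l t * u T t \<omega>)" for t
      have low: "(ennreal (base T) + (\<Sum>i<T. ennreal (wgt (T - Suc i)) * m (Suc i))) / ennreal (real T)
          \<le> avg_cost M F Q R T (plant_state (u T)) (u T)"
        using avg_cost_lower[OF remote_hist[OF r[of T]], of T] by (simp add: m_def l_def)
      show ?thesis
      \<comment> \<open>One infinite error moment makes the cost infinite, as all weights are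
        positive; otherwise the moments are real and the converse applies.\<close>
      proof (cases "\<exists>i<T. m (Suc i) = \<infinity>")
        case True
        then obtain i where i: "i < T" "m (Suc i) = \<infinity>" by blast
        have "\<infinity> = ennreal (wgt (T - Suc i)) * m (Suc i)"
          using i wgt_pos[of "T - Suc i"] by (simp add: ennreal_mult_top)
        also have "\<dots> \<le> (\<Sum>i<T. ennreal (wgt (T - Suc i)) * m (Suc i))"
          using i by (intro member_le_sum[of i]) auto
        finally have "(\<Sum>i<T. ennreal (wgt (T - Suc i)) * m (Suc i)) = \<infinity>" by (simp add: top_unique)
        with low show ?thesis by (simp add: ennreal_top_divide top_unique)
      next
        case False
        define D where "D t = enn2real (m t)" for t
        have m0: "m 0 = 0" by (simp add: m_def remoteD(3)[OF r])
        have mD: "m t = ennreal (D t)" if "t \<le> T" for t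
          unfolding D_def using False m0 that
          by (cases t) (auto simp: less_top intro!: ennreal_enn2real[symmetric])
        have D0: "D 0 = 0" "\<And>t. 0 \<le> D t" using m0 by (auto simp: D_def)
        have "converse_inequality \<alpha> SNR nvar (T - K) D"
          by (rule remote_converse[OF r[of T], where l=l])
             (use mD power D0 in \<open>auto simp: m_def[symmetric]\<close>)
        then have 1: "real (T - K) * r (T - K) \<le> (\<Sum>t<T - K. D (Suc t))" using r_le D0 by blast
        have "\<theta> * ?c * (real (T - K) * r (T - K)) \<le> \<theta> * ?c * (\<Sum>t<T - K. D (Suc t))"
          using 1 \<theta> c by (intro mult_left_mono) auto
        also have "\<dots> \<le> (\<Sum>t<T - K. wgt (T - Suc t) * D (Suc t))"
          unfolding sum_distrib_left
          by (intro sum_mono mult_right_mono D0 less_imp_le[OF K]) auto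
        also have "\<dots> \<le> (\<Sum>t<T. wgt (T - Suc t) * D (Suc t))"
          using wgt_pos D0 by (intro sum_mono2) (auto intro!: mult_nonneg_nonneg simp: less_imp_le)
        finally have 2: "\<theta> * ?c * (real (T - K) * r (T - K)) \<le> (\<Sum>t<T. wgt (T - Suc t) * D (Suc t))" .
        have "low T = (base T + \<theta> * ?c * (real (T - K) * r (T - K))) / real T"
          using T by (simp add: low_def add_divide_distrib)
        also have "\<dots> \<le> (base T + (\<Sum>t<T. wgt (T - Suc t) * D (Suc t))) / real T"
          using 2 by (intro divide_right_mono) auto
        finally have "ennreal (low T) \<le> ennreal ((base T + (\<Sum>t<T. wgt (T - Suc t) * D (Suc t))) / real T)"
          by (rule ennreal_leI)
        also have "\<dots> = (ennreal (base T) + (\<Sum>i<T. ennreal (wgt (T - Suc i)) * m (Suc i))) / ennreal (real T)"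
        proof -
          have "(\<Sum>i<T. ennreal (wgt (T - Suc i)) * m (Suc i)) = (\<Sum>i<T. ennreal (wgt (T - Suc i) * D (Suc i)))"
            using mD wgt_pos D0 by (intro sum.cong) (auto simp: ennreal_mult less_imp_le)
          also have "\<dots> = ennreal (\<Sum>t<T. wgt (T - Suc t) * D (Suc t))"
            using wgt_pos D0 by (intro sum_ennreal) (auto intro!: mult_nonneg_nonneg simp: less_imp_le)
          finally show ?thesis
            using T base_nonneg wgt_pos D0
            by (simp add: divide_ennreal[symmetric] ennreal_plus sum_nonneg less_imp_le)
        qed
        also note low
        finally show ?thesis .
      qed
    qed
    then have ev: "\<forall>\<^sub>F T in sequentially. ennreal (low T) \<le> avg_cost M F Q R T (plant_state (u T)) (u T)"
      by (rule eventually_mono[OF eventually_gt_at_top])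
    have "ennreal (?J + \<theta> * ?c * (1 * (\<theta> * ?d))) = limsup (\<lambda>T. ennreal (low T))"
      by (intro lim_imp_Limsup[symmetric] tendsto_ennrealI lim) auto
    also have "\<dots> \<le> ?lim" by (rule Limsup_mono[OF ev])
    finally show ?thesis by simp
  qed
  define th where "th k = 1 - 1 / (real k + 2)" for k :: nat
  have th: "0 < th k" "th k < 1" for k by (auto simp: th_def field_simps)
  have "th \<longlonglongrightarrow> 1 - 0" unfolding th_def
    using LIMSEQ_ignore_initial_segment[OF lim_const_over_n[of "1::real"], of 2]
    by (intro tendsto_diff tendsto_const) (simp add: add.commute)
  then have "th \<longlonglongrightarrow> 1" by simp
  then have "(\<lambda>k. ennreal (?J + th k * ?c * (th k * ?d))) \<longlonglongrightarrow> ennreal (?J + 1 * ?c * (1 * ?d))"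
    by (intro tendsto_ennrealI tendsto_intros)
  then have "ennreal (?J + 1 * ?c * (1 * ?d)) \<le> ?lim"
    using bound th by (intro LIMSEQ_le_const2) auto
  then show ?thesis by simp
qed

end

section \<open>Certainty-equivalent control\<close>

lemma square_add_le:
  fixes x y \<eta> :: real
  assumes "0 < \<eta>"
  shows "(x + y)\<^sup>2 \<le> (1 + \<eta>) * x\<^sup>2 + (1 + 1 / \<eta>) * y\<^sup>2"
proof -
  have "0 \<le> (\<eta> * x - y)\<^sup>2 / \<eta>" using assms by simp
  also have "(\<eta> * x - y)\<^sup>2 / \<eta> = (1 + \<eta>) * x\<^sup>2 + (1 + 1 / \<eta>) * y\<^sup>2 - (x + y)\<^sup>2"
    using assms by (simp add: power2_eq_square field_simps)
  finally show ?thesis by simp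
qed

lemma second_moment_add_le:
  assumes [measurable]: "X \<in> borel_measurable M" "Y \<in> borel_measurable M" and \<eta>: "0 < \<eta>"
  shows "second_moment M (\<lambda>\<omega>. X \<omega> + Y \<omega>) \<le>
    ennreal (1 + \<eta>) * second_moment M X + ennreal (1 + 1 / \<eta>) * second_moment M Y"
proof -
  have "second_moment M (\<lambda>\<omega>. X \<omega> + Y \<omega>) \<le>
      (\<integral>\<^sup>+\<omega>. ennreal ((1 + \<eta>) * (X \<omega>)\<^sup>2 + (1 + 1 / \<eta>) * (Y \<omega>)\<^sup>2) \<partial>M)"
    unfolding second_moment_def using square_add_le[OF \<eta>] by (intro nn_integral_mono ennreal_leI) simp
  also have "\<dots> = (\<integral>\<^sup>+\<omega>. ennreal (1 + \<eta>) * ennreal ((X \<omega>)\<^sup>2) + ennreal (1 + 1 / \<eta>) * ennreal ((Y \<omega>)\<^sup>2) \<partial>M)"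
    using \<eta> by (intro nn_integral_cong) (simp add: ennreal_mult[symmetric] ennreal_plus[symmetric] del: ennreal_plus)
  finally show ?thesis
    unfolding second_moment_def by (simp add: nn_integral_add nn_integral_cmult)
qed

context lqg_plant begin

definition Lg :: real where
  "Lg = \<alpha> * S / (S + R)"

definition cst :: real where
  "cst = Q + (\<alpha>\<^sup>2 - 1) * S"

lemma SR: "0 < S + R" using S R by simp

lemma Lg_pos: "0 < Lg"
  using S alpha SR by (simp add: Lg_def)

lemma cst_pos: "0 < cst"
proof -
  have "1 < \<alpha>\<^sup>2" using alpha by (simp add: one_less_power)
  then show ?thesis using Q S by (simp add: cst_def add_nonneg_pos)
qed

lemma cst_eq: "(S + R) * Lg\<^sup>2 = cst"
proof -
  have "(S + R) * Lg\<^sup>2 = \<alpha>\<^sup>2 * S\<^sup>2 / (S + R)"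
    using SR by (simp add: Lg_def power_divide power_mult_distrib power2_eq_square)
  also have "\<dots> = \<alpha>\<^sup>2 * S - \<alpha>\<^sup>2 * R * S / (S + R)"
    using SR by (simp add: field_simps power2_eq_square)
  also have "\<dots> = \<alpha>\<^sup>2 * S - (S - Q)" using S_fixed by linarith
  finally show ?thesis by (simp add: cst_def algebra_simps)
qed

text \<open>The square of \<open>\<alpha> - Lg = \<alpha> * R / (S + R)\<close> is
  \<open>\<alpha>\<^sup>2 * R / (S + R)\<close>, at most 1 by the fixed-point equation, times
  \<open>R / (S + R)\<close>, less than 1.\<close>

lemma closed_loop_gain: "(\<alpha> - Lg)\<^sup>2 < 1"
proof -
  have e: "\<alpha> - Lg = \<alpha> * R / (S + R)" using SR by (simp add: Lg_def field_simps)
  have "S * (\<alpha>\<^sup>2 * R / (S + R)) \<le> S * 1" using S_fixed Q by (simp add: mult.commute)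
  then have 1: "\<alpha>\<^sup>2 * R / (S + R) \<le> 1" using S by (simp only: mult_le_cancel_left_pos)
  have "R / (S + R) < 1" using S SR by simp
  moreover have "0 \<le> R / (S + R)" using R SR by simp
  ultimately have "(\<alpha>\<^sup>2 * R / (S + R)) * (R / (S + R)) < 1"
    using 1 by (meson R SR divide_nonneg_pos le_less_trans mult_left_le_one_le mult_nonneg_nonneg zero_le_power2)
  then show ?thesis unfolding e by (simp add: power_divide power_mult_distrib power2_eq_square mult_ac)
qed

text \<open>Certainty-equivalent control from an estimate with error \<open>e\<close>. It serves
  both loops: \<open>e = 0\<close> at the observer, and the receiver's error over the
  channel.\<close>

context
  fixes u e :: "nat \<Rightarrow> 'a \<Rightarrow> real" and E :: "nat \<Rightarrow> real" and Emax :: real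
  assumes u_hist: "\<And>t. u t \<in> borel_measurable (hist t)"
    and u_eq: "\<And>t \<omega>. u t \<omega> = - Lg * (est u t \<omega> - e t \<omega>)"
    and e_hist: "\<And>t. e t \<in> borel_measurable (hist t)"
    and e_moment: "\<And>t. m2 (e t) = ennreal (E t)"
    and E: "\<And>t. 0 \<le> E t" "\<And>t. E t \<le> Emax"
begin

lemma est_bounded: "\<exists>B\<ge>0. \<forall>t. m2 (est u t) \<le> ennreal B"
proof -
  define \<rho> where "\<rho> = (\<alpha> - Lg)\<^sup>2"
  have \<rho>: "0 \<le> \<rho>" "\<rho> < 1" using closed_loop_gain by (auto simp: \<rho>_def)
  \<comment> \<open>\<open>e\<close> may be correlated with the estimate, so Young's inequality is
    used, with \<open>\<eta>\<close> small enough to keep \<open>(1 + \<eta>) * \<rho>\<close> below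
    1.\<close>
  define \<eta> where "\<eta> = (1 - \<rho>) / 2"
  have \<eta>: "0 < \<eta>" using \<rho> by (simp add: \<eta>_def)
  define \<kappa> where "\<kappa> = (1 + \<eta>) * \<rho>"
  have \<kappa>: "0 \<le> \<kappa>" "\<kappa> < 1"
  proof -
    show "0 \<le> \<kappa>" using \<eta> \<rho> by (simp add: \<kappa>_def)
    have "1 - \<kappa> = (1 - \<rho>) * (1 - \<rho> / 2)" by (simp add: \<kappa>_def \<eta>_def field_simps)
    also have "\<dots> > 0" using \<rho> by (intro mult_pos_pos) auto
    finally show "\<kappa> < 1" by simp
  qed
  obtain Nm where Nm: "\<And>t. \<bar>nvar t\<bar> \<le> Nm"
    using convergent_imp_Bseq[of nvar] nvar_lim by (auto simp: convergent_def Bseq_def)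
  have Nm0: "0 \<le> Nm" using Nm[of 0] by linarith
  have Em0: "0 \<le> Emax" using E(1)[of 0] E(2)[of 0] by linarith
  define C where "C = (1 + 1 / \<eta>) * (Lg\<^sup>2 * Emax) + Nm"
  have C: "0 \<le> C" using \<eta> Em0 Nm0 by (simp add: C_def)
  define B where "B = C / (1 - \<kappa>)"
  have B: "0 \<le> B" "\<kappa> * B + C = B"
  proof -
    show "0 \<le> B" using C \<kappa> by (simp add: B_def)
    show "\<kappa> * B + C = B" using \<kappa> by (simp add: B_def field_simps)
  qed
  have "m2 (est u t) \<le> ennreal B" for t
  proof (induction t)
    case (Suc t)
    have m: "est u t \<in> borel_measurable M" "e t \<in> borel_measurable M"
      by (rule est_measurable[OF u_hist], rule hist_measurable[OF e_hist])
    have "(\<lambda>\<omega>. \<alpha> * est u t \<omega> + u t \<omega>) = (\<lambda>\<omega>. (\<alpha> - Lg) * est u t \<omega> + Lg * e t \<omega>)"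
    proof
      fix \<omega>
      show "\<alpha> * est u t \<omega> + u t \<omega> = (\<alpha> - Lg) * est u t \<omega> + Lg * e t \<omega>"
        unfolding u_eq[of t \<omega>] by (simp add: algebra_simps)
    qed
    then have "m2 (\<lambda>\<omega>. \<alpha> * est u t \<omega> + u t \<omega>) =
        m2 (\<lambda>\<omega>. (\<alpha> - Lg) * est u t \<omega> + Lg * e t \<omega>)" by (rule arg_cong)
    also have "\<dots> \<le> ennreal (1 + \<eta>) * m2 (\<lambda>\<omega>. (\<alpha> - Lg) * est u t \<omega>) +
        ennreal (1 + 1 / \<eta>) * m2 (\<lambda>\<omega>. Lg * e t \<omega>)"
      by (intro second_moment_add_le borel_measurable_times borel_measurable_const m \<eta>)
    also have "\<dots> = ennreal \<kappa> * m2 (est u t) + ennreal ((1 + 1 / \<eta>) * (Lg\<^sup>2 * E t))"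
    proof -
      have "ennreal \<kappa> = ennreal (1 + \<eta>) * ennreal \<rho>" unfolding \<kappa>_def using \<eta> \<rho> by (intro ennreal_mult) auto
      moreover have "ennreal ((1 + 1 / \<eta>) * (Lg\<^sup>2 * E t)) = ennreal (1 + 1 / \<eta>) * (ennreal (Lg\<^sup>2) * ennreal (E t))"
        using \<eta> E(1)[of t] by (simp add: ennreal_mult del: ennreal_plus)
      ultimately show ?thesis
        unfolding second_moment_cmult[OF m(1)] second_moment_cmult[OF m(2)] e_moment
        by (simp only: \<rho>_def mult.assoc)
    qed
    also have "\<dots> \<le> ennreal \<kappa> * ennreal B + ennreal ((1 + 1 / \<eta>) * (Lg\<^sup>2 * Emax))"
      using Suc \<eta> E(2)[of t] by (intro add_mono mult_left_mono ennreal_leI) auto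
    finally have "m2 (est u (Suc t)) \<le> ennreal \<kappa> * ennreal B + ennreal ((1 + 1 / \<eta>) * (Lg\<^sup>2 * Emax)) + ennreal Nm"
      unfolding second_moment_est_Suc[OF u_hist]
      using Nm[of t] by (intro add_mono ennreal_leI) auto
    also have "\<dots> = ennreal (\<kappa> * B + C)"
      using \<kappa> B(1) \<eta> Em0 Nm0 by (simp add: C_def ennreal_mult[symmetric] ennreal_plus[symmetric] add.assoc del: ennreal_plus)
    finally show ?case by (simp add: B)
  qed (simp add: B)
  then show ?thesis using B by blast
qed

lemma plant_state_bounded: "\<exists>B\<ge>0. \<forall>t. m2 (plant_state u t) \<le> ennreal B"
proof -
  obtain B where B: "0 \<le> B" "\<And>t. m2 (est u t) \<le> ennreal B" using est_bounded by blast
  obtain Pm where Pm: "\<And>t. \<bar>filt t\<bar> \<le> Pm"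
    using convergent_imp_Bseq[of filt] filt_lim by (auto simp: convergent_def Bseq_def)
  have Pm0: "0 \<le> Pm" using Pm[of 0] by linarith
  have "m2 (plant_state u t) \<le> ennreal (B + Pm)" for t
  proof -
    have "m2 (plant_state u t) \<le> ennreal B + ennreal Pm"
      unfolding second_moment_plant_state[OF u_hist] using B Pm[of t] by (intro add_mono ennreal_leI) auto
    then show ?thesis using B Pm0 by simp
  qed
  then show ?thesis using B Pm0 by (intro exI[of _ "B + Pm"]) auto
qed

text \<open>With the stationary \<open>S\<close> and \<open>Lg\<close> the cost is explicit up to
  boundary terms, which are bounded because the state is, and so vanish in the average. For
  \<open>E\<close> an averaged bound suffices, without a limit.\<close>

lemma limsup_avg_cost_upper:
  assumes \<delta>: "\<And>T. (\<Sum>i<T. E (Suc i)) \<le> \<delta> * (\<Sum>i<T. nvar i)"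
  shows "limsup (\<lambda>T. avg_cost M F Q R T (plant_state u) u) \<le> ennreal (Q * Pf + S * (P - Pf) + cst * (\<delta> * (P - Pf)))"
proof -
  obtain B where B: "0 \<le> B" "\<And>t. m2 (plant_state u t) \<le> ennreal B" using plant_state_bounded by blast
  have Bz: "m2 (est u t) \<le> ennreal B" for t
    using B(2)[of t] unfolding second_moment_plant_state[OF u_hist] by (rule order_trans[rotated]) simp
  define up where "up T = (F * B + S * B) / real T + ((\<Sum>i<T. Q * filt (Suc i)) / real T + (\<Sum>i<T. S * nvar (Suc i)) / real T
     + cst * (\<delta> * ((\<Sum>i<T. nvar i) / real T)))" for T
  have "up \<longlonglongrightarrow> 0 + (Q * Pf + S * (P - Pf) + cst * (\<delta> * (P - Pf)))"
    unfolding up_def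
    by (intro tendsto_add tendsto_mult tendsto_const cesaro lim_const_over_n LIMSEQ_Suc filt_lim nvar_lim)
  then have lim: "up \<longlonglongrightarrow> Q * Pf + S * (P - Pf) + cst * (\<delta> * (P - Pf))" by simp
  have le: "avg_cost M F Q R T (plant_state u) u \<le> ennreal (up T)" if T: "0 < T" for T
  proof -
    have err: "m2 (\<lambda>\<omega>. u t \<omega> + Lg * est u t \<omega>) = ennreal (Lg\<^sup>2 * E t)" for t
    proof -
      have "(\<lambda>\<omega>. u t \<omega> + Lg * est u t \<omega>) = (\<lambda>\<omega>. Lg * e t \<omega>)"
      proof
        fix \<omega> show "u t \<omega> + Lg * est u t \<omega> = Lg * e t \<omega>"
          unfolding u_eq[of t \<omega>] by (simp add: algebra_simps)
      qed
      then have "m2 (\<lambda>\<omega>. u t \<omega> + Lg * est u t \<omega>) = m2 (\<lambda>\<omega>. Lg * e t \<omega>)" by (rule arg_cong)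
      also have "\<dots> = ennreal (Lg\<^sup>2) * ennreal (E t)"
        by (simp add: second_moment_cmult[OF hist_measurable[OF e_hist]] e_moment)
      finally show ?thesis using E(1)[of t] by (simp add: ennreal_mult)
    qed
    let ?stage = "\<Sum>t=1..T. ennreal Q * m2 (est u t) + ennreal R * m2 (u t)"
    \<comment> \<open>Adding a terminal term with weight \<open>S\<close> instead of
      \<open>F\<close> makes the constant Riccati solution applicable.\<close>
    have "?stage \<le> ennreal S * m2 (est u (Suc T)) + ?stage"
      by (rule add_increasing[OF zero_le order_refl])
    also have "\<dots> = ennreal S * m2 (est u 1) + (\<Sum>t=1..T. ennreal (S * nvar t) +
        ennreal (S + R) * m2 (\<lambda>\<omega>. u t \<omega> + Lg * est u t \<omega>))"
      by (rule lqg_sum[OF u_hist _ Q R, where S="\<lambda>_. S" and L="\<lambda>_. Lg"])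
         (intro conjI S_fixed SR less_imp_le[OF S(1)] Lg_def)
    also have "\<dots> = ennreal S * m2 (est u 1) + (\<Sum>t=1..T. ennreal (S * nvar t) +
        ennreal (S + R) * ennreal (Lg\<^sup>2 * E t))"
      unfolding err ..
    also have "\<dots> \<le> ennreal S * ennreal B + (\<Sum>t=1..T. ennreal (S * nvar t + cst * E t))"
    proof (intro add_mono mult_left_mono Bz order_refl zero_le sum_mono)
      fix t
      have "ennreal (S + R) * ennreal (Lg\<^sup>2 * E t) = ennreal (cst * E t)"
        using SR E(1)[of t] by (simp add: ennreal_mult[symmetric] cst_eq[symmetric] mult.assoc)
      then show "ennreal (S * nvar t) + ennreal (S + R) * ennreal (Lg\<^sup>2 * E t) \<le> ennreal (S * nvar t + cst * E t)"
        using S nvar_pos[of t] cst_pos E(1)[of t] by (simp add: less_imp_le)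
    qed
    also have "\<dots> = ennreal (S * B + (\<Sum>t=1..T. S * nvar t + cst * E t))"
    proof -
      have n: "0 \<le> S * nvar t + cst * E t" for t
        using S nvar_pos[of t] cst_pos E(1)[of t] by (simp add: less_imp_le)
      then show ?thesis using S B n by (simp add: ennreal_mult sum_nonneg)
    qed
    finally have st: "?stage \<le> ennreal (S * B + (\<Sum>t=1..T. S * nvar t + cst * E t))" .
    have "ennreal (F * filt (Suc T) + (\<Sum>t=1..T. Q * filt t)) + (ennreal F * m2 (est u (Suc T)) + ?stage)
       = ennreal F * m2 (plant_state u (Suc T)) + ennreal (\<Sum>t=1..T. Q * filt t) + ?stage"
    proof -
      have "0 \<le> (\<Sum>t=1..T. Q * filt t)" using Q filt_nonneg by (simp add: sum_nonneg)
      then have "ennreal (F * filt (Suc T) + (\<Sum>t=1..T. Q * filt t)) =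
          ennreal F * ennreal (filt (Suc T)) + ennreal (\<Sum>t=1..T. Q * filt t)"
        using F filt_nonneg[of "Suc T"] by (simp only: ennreal_plus ennreal_mult less_imp_le mult_nonneg_nonneg)
      then show ?thesis
        unfolding second_moment_plant_state[OF u_hist] by (simp only: distrib_left add_ac)
    qed
    also have "\<dots> \<le> ennreal F * ennreal B + ennreal (\<Sum>t=1..T. Q * filt t) + ennreal (S * B + (\<Sum>t=1..T. S * nvar t + cst * E t))"
      by (intro add_mono mult_left_mono B(2) order_refl zero_le st)
    also have "\<dots> = ennreal (F * B + (\<Sum>t=1..T. Q * filt t) + (S * B + (\<Sum>t=1..T. S * nvar t + cst * E t)))"
    proof -
      have n: "0 \<le> S * nvar t + cst * E t" for t
        using S nvar_pos[of t] cst_pos E(1)[of t] by (simp add: less_imp_le)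
      then show ?thesis using F S B Q filt_nonneg by (simp add: ennreal_mult sum_nonneg)
    qed
    also have "\<dots> \<le> ennreal (real T * up T)"
    proof (rule ennreal_leI)
      have "F * B + (\<Sum>t=1..T. Q * filt t) + (S * B + (\<Sum>t=1..T. S * nvar t + cst * E t)) =
         (F * B + S * B) + ((\<Sum>i<T. Q * filt (Suc i)) + (\<Sum>i<T. S * nvar (Suc i)) + cst * (\<Sum>i<T. E (Suc i)))"
        by (simp add: sum.atLeast1_atMost_eq sum.distrib sum_distrib_left)
      also have "\<dots> \<le> (F * B + S * B) + ((\<Sum>i<T. Q * filt (Suc i)) + (\<Sum>i<T. S * nvar (Suc i)) + cst * (\<delta> * (\<Sum>i<T. nvar i)))"
        using \<delta>[of T] cst_pos by (intro add_left_mono mult_left_mono) auto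
      also have "\<dots> = real T * up T" using T by (simp add: up_def field_simps)
      finally show "F * B + (\<Sum>t=1..T. Q * filt t) + (S * B + (\<Sum>t=1..T. S * nvar t + cst * E t)) \<le> real T * up T" .
    qed
    finally have tot: "ennreal (F * filt (Suc T) + (\<Sum>t=1..T. Q * filt t)) + (ennreal F * m2 (est u (Suc T)) + ?stage)
       \<le> ennreal (real T * up T)" .
    have "avg_cost M F Q R T (plant_state u) u \<le> ennreal (real T * up T) / ennreal (real T)"
      unfolding avg_cost_plant[OF u_hist less_imp_le[OF F] Q R] by (rule divide_right_mono_ennreal[OF tot])
    also have "\<dots> = ennreal (up T)"
    proof (cases "0 \<le> up T")
      case True
      then show ?thesis using T by (simp add: divide_ennreal)
    next
      case False
      then show ?thesis using T by (simp add: ennreal_neg mult_nonneg_nonpos)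
    qed
    finally show ?thesis .
  qed
  have "limsup (\<lambda>T. avg_cost M F Q R T (plant_state u) u) \<le> limsup (\<lambda>T. ennreal (up T))"
    using le by (intro Limsup_mono eventually_mono[OF eventually_gt_at_top[of 0]])
  also have "\<dots> = ennreal (Q * Pf + S * (P - Pf) + cst * (\<delta> * (P - Pf)))"
    by (intro lim_imp_Limsup tendsto_ennrealI lim) simp
  finally show ?thesis .
qed

end

end

section \<open>Linear feedback over the channel\<close>

context gaussian_plant begin

text \<open>The receiver's error variance in the linear scheme: one channel use divides the
  prediction variance by \<open>1 + SNR\<close>.\<close>

primrec dvar :: "nat \<Rightarrow> real" where
  "dvar 0 = 0"
| "dvar (Suc t) = (\<alpha>\<^sup>2 * dvar t + nvar t) / (1 + SNR)"

definition pvar :: "nat \<Rightarrow> real" where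
  "pvar t = \<alpha>\<^sup>2 * dvar t + nvar t"

lemma dvar_nonneg: "0 \<le> dvar t"
proof (induction t)
  case (Suc t)
  then show ?case using nvar_pos[of t] SNR by (simp add: less_imp_le)
qed simp

lemma pvar_pos: "0 < pvar t"
  using dvar_nonneg[of t] nvar_pos[of t] by (simp add: pvar_def add_nonneg_pos)

text \<open>The linear least-squares gain for a signal of variance \<open>pvar t\<close>, sent with
  unit power and observed in noise of variance \<open>1 / SNR\<close>.\<close>

definition rgain :: "nat \<Rightarrow> real" where
  "rgain t = sqrt (pvar t) * (SNR / (1 + SNR))"

text \<open>A fraction \<open>1 / (1 + SNR)\<close> of the prediction error survives, plus scaled
  channel noise independent of it; the two variances add up to
  \<open>pvar t / (1 + SNR)\<close>.\<close>

lemma feedback_moments: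
  assumes e0: "e 0 = (\<lambda>\<omega>. 0)"
    and e: "\<And>t. e (Suc t) = (\<lambda>\<omega>. (\<alpha> * e t \<omega> + nu t \<omega>) / (1 + SNR) - rgain t * n (Suc t) \<omega>)"
  shows "e t \<in> borel_measurable (hist t)" "m2 (e t) = ennreal (dvar t)"
    "m2 (\<lambda>\<omega>. (\<alpha> * e t \<omega> + nu t \<omega>) / sqrt (pvar t)) = 1"
proof -
  have *: "m2 (\<lambda>\<omega>. \<alpha> * e t \<omega> + nu t \<omega>) = ennreal (pvar t)"
    if "e t \<in> borel_measurable (hist t)" "m2 (e t) = ennreal (dvar t)" for t
  proof -
    have "m2 (\<lambda>\<omega>. \<alpha> * e t \<omega> + nu t \<omega>) = ennreal (\<alpha>\<^sup>2) * ennreal (dvar t) + ennreal (nvar t)"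
      using second_moment_indep_of[OF prob_space_axioms indep_of_nu less_imp_le[OF nvar_pos],
          of "\<lambda>\<omega>. \<alpha> * e t \<omega>" t 1] that
      by (simp add: second_moment_cmult[OF hist_measurable[OF that(1)]])
    then show ?thesis
      using dvar_nonneg[of t] nvar_pos[of t] by (simp add: pvar_def ennreal_mult less_imp_le)
  qed
  have p_hist: "(\<lambda>\<omega>. \<alpha> * e t \<omega> + nu t \<omega>) \<in> borel_measurable (hist' t)"
    if "e t \<in> borel_measurable (hist t)" for t
    using hist'_measurable[OF that] nu_hist'[of t] by measurable
  have main: "e t \<in> borel_measurable (hist t) \<and> m2 (e t) = ennreal (dvar t)" for t
  proof (induction t)
    case 0
    then show ?case by (simp add: e0)
  next
    case (Suc t)
    then have IH: "e t \<in> borel_measurable (hist t)" "m2 (e t) = ennreal (dvar t)" by auto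
    note p = p_hist[OF IH(1)]
    have q: "(\<lambda>\<omega>. (\<alpha> * e t \<omega> + nu t \<omega>) / (1 + SNR)) \<in> borel_measurable (hist' t)" using p by measurable
    have "e (Suc t) \<in> borel_measurable (hist (Suc t))"
      unfolding e using hist_Suc_measurable[OF q] n_hist[of t] by measurable
    moreover have "m2 (e (Suc t)) =
        m2 (\<lambda>\<omega>. (\<alpha> * e t \<omega> + nu t \<omega>) / (1 + SNR)) + ennreal ((rgain t)\<^sup>2 * (1 / SNR))"
      using second_moment_indep_of[OF prob_space_axioms indep_of_channel _ q, of "- rgain t"] SNR
      by (simp add: e)
    moreover have "m2 (\<lambda>\<omega>. (\<alpha> * e t \<omega> + nu t \<omega>) / (1 + SNR)) = ennreal ((1 / (1 + SNR))\<^sup>2) * ennreal (pvar t)"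
      using second_moment_cmult[OF hist_measurable[OF hist_Suc_measurable[OF p]], of "1 / (1 + SNR)"] *[OF IH]
      by simp
    moreover have "(1 / (1 + SNR))\<^sup>2 * pvar t + (rgain t)\<^sup>2 * (1 / SNR) = dvar (Suc t)"
    proof -
      have "(rgain t)\<^sup>2 * (1 / SNR) = pvar t * (SNR / (1 + SNR)\<^sup>2)"
        using pvar_pos[of t] SNR by (simp add: rgain_def power_mult_distrib power_divide power2_eq_square)
      then have "(1 / (1 + SNR))\<^sup>2 * pvar t + (rgain t)\<^sup>2 * (1 / SNR) = pvar t * ((1 + SNR) / (1 + SNR)\<^sup>2)"
        using SNR by (simp add: power_divide add_divide_distrib distrib_left)
      also have "\<dots> = pvar t / (1 + SNR)" using SNR by (simp add: power2_eq_square)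
      finally show ?thesis by (simp add: pvar_def)
    qed
    ultimately show ?case
      using pvar_pos[of t] SNR by (simp add: ennreal_mult[symmetric] ennreal_plus[symmetric] less_imp_le del: ennreal_plus dvar.simps)
  qed
  then show "e t \<in> borel_measurable (hist t)" "m2 (e t) = ennreal (dvar t)" by auto
  show "m2 (\<lambda>\<omega>. (\<alpha> * e t \<omega> + nu t \<omega>) / sqrt (pvar t)) = 1"
    using second_moment_cmult[OF hist_measurable[OF hist_Suc_measurable[OF p_hist[OF conjunct1[OF main]]]],
        of "1 / sqrt (pvar t)" t] *[of t] main[of t] pvar_pos[of t]
    by (simp add: power_divide ennreal_mult[symmetric] less_imp_le)
qed

text \<open>Summing the recursion and shifting the index, where \<open>dvar 0 = 0\<close> is lost
  and \<open>dvar T\<close> gained, gives the fixed-point constant without the limit of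
  \<open>dvar\<close>.\<close>

lemma dvar_sum:
  assumes "\<alpha>\<^sup>2 < 1 + SNR"
  shows "(\<Sum>i<T. dvar (Suc i)) \<le> 1 / (1 + SNR - \<alpha>\<^sup>2) * (\<Sum>i<T. nvar i)"
proof -
  have "(1 + SNR) * (\<Sum>i<T. dvar (Suc i)) = \<alpha>\<^sup>2 * (\<Sum>i<T. dvar i) + (\<Sum>i<T. nvar i)"
    using SNR by (simp add: sum_distrib_left sum.distrib[symmetric] del: sum.distrib)
  moreover have "(\<Sum>i<T. dvar i) \<le> (\<Sum>i<T. dvar (Suc i))"
  proof -
    have "(\<Sum>i<T. dvar (Suc i)) = (\<Sum>i<T. dvar i) + dvar T"
      using sum.lessThan_Suc_shift[of dvar T] by simp
    then show ?thesis using dvar_nonneg[of T] by simp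
  qed
  ultimately have "(1 + SNR) * (\<Sum>i<T. dvar (Suc i)) \<le> \<alpha>\<^sup>2 * (\<Sum>i<T. dvar (Suc i)) + (\<Sum>i<T. nvar i)"
    by (simp add: mult_left_mono)
  then have "(1 + SNR - \<alpha>\<^sup>2) * (\<Sum>i<T. dvar (Suc i)) \<le> (\<Sum>i<T. nvar i)" by (simp add: algebra_simps)
  then show ?thesis using assms by (simp add: field_simps)
qed

text \<open>The bound is the fixed point of the recursion driven by the constant \<open>Nm\<close>,
  hence preserved by every step.\<close>

lemma dvar_bounded:
  assumes "\<alpha>\<^sup>2 < 1 + SNR" and Nm: "\<And>t. nvar t \<le> Nm"
  shows "dvar t \<le> Nm / (1 + SNR - \<alpha>\<^sup>2)"
proof (induction t)
  case 0
  have "0 \<le> Nm" using Nm[of 0] nvar_pos[of 0] by linarith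
  then show ?case using assms by simp
next
  case (Suc t)
  define B where "B = Nm / (1 + SNR - \<alpha>\<^sup>2)"
  have "(1 + SNR - \<alpha>\<^sup>2) * B = Nm" using assms by (simp add: B_def)
  then have B: "\<alpha>\<^sup>2 * B + Nm = B * (1 + SNR)" by (simp add: algebra_simps)
  have "\<alpha>\<^sup>2 * dvar t + nvar t \<le> \<alpha>\<^sup>2 * B + Nm"
    using Suc Nm[of t] by (intro add_mono mult_left_mono) (auto simp: B_def)
  then have "\<alpha>\<^sup>2 * dvar t + nvar t \<le> B * (1 + SNR)" using B by simp
  then show ?case using SNR by (simp add: B_def[symmetric] pos_divide_le_eq)
qed

end

section \<open>The closed loop\<close>

context gaussian_plant begin

definition loop_control :: "transmitter \<Rightarrow> receiver \<Rightarrow> nat \<Rightarrow> 'a \<Rightarrow> real" where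
  "loop_control f g t = process (control \<alpha> f g) x0 w v n t"

definition loop_input :: "transmitter \<Rightarrow> receiver \<Rightarrow> nat \<Rightarrow> 'a \<Rightarrow> real" where
  "loop_input f g t = process (ch_in \<alpha> f g) x0 w v n t"

definition obs_loop_control :: "receiver \<Rightarrow> nat \<Rightarrow> 'a \<Rightarrow> real" where
  "obs_loop_control g t \<omega> = obs_control \<alpha> g (x0 \<omega>) (\<lambda>s. w s \<omega>) (\<lambda>s. v s \<omega>) t"

definition meas :: "(nat \<Rightarrow> 'a \<Rightarrow> real) \<Rightarrow> nat \<Rightarrow> 'a \<Rightarrow> real" where
  "meas u t \<omega> = plant_state u t \<omega> + v t \<omega>"

lemma loop_state: "process (state \<alpha> f g) x0 w v n = plant_state (loop_control f g)"
proof
  fix t show "process (state \<alpha> f g) x0 w v n t = plant_state (loop_control f g) t"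
  proof (induction t)
    case (Suc t)
    then show ?case by (auto simp: process_def loop_control_def fun_eq_iff)
  qed (auto simp: process_def)
qed

lemma loop_control_0: "loop_control f g 0 = (\<lambda>\<omega>. 0)"
  by (auto simp: loop_control_def process_def control.simps)

lemma loop_control_eq:
  "0 < t \<Longrightarrow> loop_control f g t \<omega> = g t (\<lambda>s\<in>{1..t}. loop_input f g s \<omega> + n s \<omega>)"
  by (simp add: loop_control_def loop_input_def process_def control.simps ch_out.simps[abs_def])

lemma loop_input_eq:
  "loop_input f g t \<omega> = f t (\<lambda>s\<in>{1..t}. meas (loop_control f g) s \<omega>) (\<lambda>s\<in>{1..<t}. loop_control f g s \<omega>)"
proof -
  have "state \<alpha> f g (x0 \<omega>) (\<lambda>s. w s \<omega>) (\<lambda>s. v s \<omega>) (\<lambda>s. n s \<omega>) s = plant_state (loop_control f g) s \<omega>" for s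
    using loop_state[of f g] by (simp add: process_def fun_eq_iff)
  then show ?thesis
    by (simp add: loop_control_def loop_input_def process_def ch_in.simps measured.simps[abs_def] meas_def)
qed

lemma obs_loop_state:
  "(\<lambda>t \<omega>. obs_state \<alpha> g (x0 \<omega>) (\<lambda>s. w s \<omega>) (\<lambda>s. v s \<omega>) t) = plant_state (obs_loop_control g)"
proof
  fix t show "(\<lambda>\<omega>. obs_state \<alpha> g (x0 \<omega>) (\<lambda>s. w s \<omega>) (\<lambda>s. v s \<omega>) t) = plant_state (obs_loop_control g) t"
  proof (induction t)
    case (Suc t)
    then show ?case by (auto simp: obs_loop_control_def fun_eq_iff)
  qed auto
qed

lemma obs_loop_control_eq:
  "obs_loop_control g t \<omega> = (if t = 0 then 0 else g t (\<lambda>s\<in>{1..t}. meas (obs_loop_control g) s \<omega>))"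
proof -
  have "obs_state \<alpha> g (x0 \<omega>) (\<lambda>s. w s \<omega>) (\<lambda>s. v s \<omega>) s = plant_state (obs_loop_control g) s \<omega>" for s
    using obs_loop_state[of g] by (simp add: fun_eq_iff)
  then show ?thesis
    by (simp add: obs_loop_control_def[of g t] obs_control.simps meas_def)
qed

lemma meas_Suc: "meas u (Suc t) \<omega> = \<alpha> * est u t \<omega> + u t \<omega> + inn t \<omega>"
  by (simp add: meas_def plant_state_eq[of u t] inn_def algebra_simps)

lemma meas_hist':
  assumes "\<And>s. s \<le> t \<Longrightarrow> u s \<in> borel_measurable (hist s)"
  shows "meas u (Suc t) \<in> borel_measurable (hist' t)"
proof -
  have "est u t \<in> borel_measurable (hist' t)" "u t \<in> borel_measurable (hist' t)"
    by (rule hist'_measurable, rule est_hist, rule assms, simp) (rule hist'_measurable, rule assms, simp)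
  then show ?thesis
    unfolding meas_Suc[abs_def]
    by (intro borel_measurable_add borel_measurable_times borel_measurable_const inn_hist')
qed

lemma hist'_mono_measurable:
  assumes "s \<le> t" "f \<in> measurable (hist' s) N"
  shows "f \<in> measurable (hist' t) N"
proof (cases "s = t")
  case False
  then have "Suc s \<le> t" using assms(1) by simp
  then show ?thesis by (rule hist'_measurable[OF hist_mono_measurable[OF _ hist_Suc_measurable[OF assms(2)]]])
qed (use assms in simp)

lemma loop_input_hist':
  assumes f: "measurable_transmitter f"
    and u: "\<And>s. s \<le> t \<Longrightarrow> loop_control f g s \<in> borel_measurable (hist s)"
  shows "loop_input f g (Suc t) \<in> borel_measurable (hist' t)"
proof -
  have "(\<lambda>(y, u). f (Suc t) y u) \<in> borel_measurable (PiM {1..Suc t} (\<lambda>_. borel) \<Otimes>\<^sub>M PiM {1..<Suc t} (\<lambda>_. borel))"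
    using f by (auto simp: measurable_transmitter_def)
  moreover have "(\<lambda>\<omega>. (\<lambda>s\<in>{1..Suc t}. meas (loop_control f g) s \<omega>, \<lambda>s\<in>{1..<Suc t}. loop_control f g s \<omega>)) \<in>
      measurable (hist' t) (PiM {1..Suc t} (\<lambda>_. borel) \<Otimes>\<^sub>M PiM {1..<Suc t} (\<lambda>_. borel))"
  proof (intro measurable_Pair measurable_restrict)
    fix s assume "s \<in> {1..Suc t}"
    then obtain s' where s': "s = Suc s'" "s' \<le> t" by (cases s) auto
    show "meas (loop_control f g) s \<in> borel_measurable (hist' t)"
      unfolding s'(1) by (rule hist'_mono_measurable[OF s'(2) meas_hist']) (use u s' in auto)
  next
    fix s assume "s \<in> {1..<Suc t}"
    then have s: "s \<le> t" by simp
    show "loop_control f g s \<in> borel_measurable (hist' t)"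
      by (rule hist'_measurable[OF hist_mono_measurable[OF s u[OF s]]])
  qed
  ultimately show ?thesis
    using measurable_compose by (fastforce simp: loop_input_eq[abs_def])
qed

lemma loop_control_hist:
  assumes g: "measurable_receiver g"
    and a: "\<And>s. s < t \<Longrightarrow> loop_input f g (Suc s) \<in> borel_measurable (hist' s)"
  shows "loop_control f g t \<in> borel_measurable (hist t)"
proof (cases "t = 0")
  case True
  then show ?thesis by (simp add: loop_control_0)
next
  case False
  then have gt: "g t \<in> borel_measurable (PiM {1..t} (\<lambda>_. borel))" using g by (auto simp: measurable_receiver_def)
  have m: "(\<lambda>\<omega>. \<lambda>s\<in>{1..t}. loop_input f g s \<omega> + n s \<omega>) \<in> measurable (hist t) (PiM {1..t} (\<lambda>_. borel))"
  proof (intro measurable_restrict borel_measurable_add)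
    fix s assume "s \<in> {1..t}"
    then obtain s' where s': "s = Suc s'" "Suc s' \<le> t" by (cases s) auto
    show "loop_input f g s \<in> borel_measurable (hist t)"
      unfolding s'(1) by (rule hist_mono_measurable[OF s'(2) hist_Suc_measurable[OF a]]) (use s' in simp)
    show "n s \<in> borel_measurable (hist t)"
      unfolding s'(1) by (rule hist_mono_measurable[OF s'(2) n_hist])
  qed
  have "loop_control f g t = (\<lambda>\<omega>. g t (\<lambda>s\<in>{1..t}. loop_input f g s \<omega> + n s \<omega>))"
    using False by (intro ext loop_control_eq) simp
  with measurable_compose[OF m gt] show ?thesis by simp
qed

text \<open>Strong induction alternates between the two signals: the control at \<open>t\<close>
  needs the inputs up to \<open>t\<close>, the next input needs the controls up to
  \<open>t\<close>.\<close>

lemma loop_remote: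
  assumes f: "measurable_transmitter f" and g: "measurable_receiver g"
  shows "remote (loop_input f g) (loop_control f g)"
proof -
  have main: "loop_control f g t \<in> borel_measurable (hist t) \<and> loop_input f g (Suc t) \<in> borel_measurable (hist' t)" for t
  proof (induction t rule: less_induct)
    case (less t)
    have "loop_control f g t \<in> borel_measurable (hist t)"
      by (rule loop_control_hist[OF g conjunct2[OF less]])
    moreover from this less have "loop_input f g (Suc t) \<in> borel_measurable (hist' t)"
      by (intro loop_input_hist'[OF f]) (metis le_neq_implies_less)
    ultimately show ?case ..
  qed
  let ?b = "\<lambda>t \<omega>. loop_input f g t \<omega> + n t \<omega>"
  have u: "loop_control f g t \<in> borel_measurable (outputs ?b t)" for t
  proof (cases "t = 0")
    case True
    then show ?thesis by (simp add: loop_control_0)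
  next
    case False
    then have gt: "g t \<in> borel_measurable (PiM {1..t} (\<lambda>_. borel))" using g by (auto simp: measurable_receiver_def)
    have m: "(\<lambda>\<omega>. \<lambda>s\<in>{1..t}. ?b s \<omega>) \<in> measurable (outputs ?b t) (PiM {1..t} (\<lambda>_. borel))"
    proof (intro measurable_restrict)
      fix s assume "s \<in> {1..t}"
      then obtain s' where s': "s = Suc s'" "Suc s' \<le> t" by (cases s) auto
      show "?b s \<in> borel_measurable (outputs ?b t)"
        unfolding s'(1) by (rule outputs_mono_measurable[OF s'(2)]) (unfold outputs.simps, rule measurable_adjoin_new)
    qed
    have "loop_control f g t = (\<lambda>\<omega>. g t (\<lambda>s\<in>{1..t}. ?b s \<omega>))"
      using False by (intro ext loop_control_eq) simp
    with measurable_compose[OF m gt] show ?thesis by simp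
  qed
  show ?thesis unfolding remote_def using main u loop_control_0 by blast
qed

lemma obs_loop_control_hist:
  assumes g: "measurable_receiver g"
  shows "obs_loop_control g t \<in> borel_measurable (hist t)"
proof (induction t rule: less_induct)
  case (less t)
  show ?case
  proof (cases "t = 0")
    case True
    then have "obs_loop_control g t = (\<lambda>\<omega>. 0)" by (simp add: obs_loop_control_eq fun_eq_iff)
    then show ?thesis by simp
  next
    case False
    then have gt: "g t \<in> borel_measurable (PiM {1..t} (\<lambda>_. borel))" using g by (auto simp: measurable_receiver_def)
    have m: "(\<lambda>\<omega>. \<lambda>s\<in>{1..t}. meas (obs_loop_control g) s \<omega>) \<in> measurable (hist t) (PiM {1..t} (\<lambda>_. borel))"
    proof (intro measurable_restrict)
      fix s assume "s \<in> {1..t}"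
      then obtain s' where s': "s = Suc s'" "Suc s' \<le> t" by (cases s) auto
      show "meas (obs_loop_control g) s \<in> borel_measurable (hist t)"
        unfolding s'(1) by (rule hist_mono_measurable[OF s'(2) hist_Suc_measurable[OF meas_hist']])
          (rule less, use s' in simp)
    qed
    have "obs_loop_control g t = (\<lambda>\<omega>. g t (\<lambda>s\<in>{1..t}. meas (obs_loop_control g) s \<omega>))"
      using False by (intro ext trans[OF obs_loop_control_eq]) simp
    with measurable_compose[OF m gt] show ?thesis by simp
  qed
qed

section \<open>Linear policies\<close>

text \<open>The common shape of the observer's and the receiver's linear filters. It reads
  \<open>y\<close> only from time 1 on, where the records begin.\<close>

primrec filter_out :: "(nat \<Rightarrow> real) \<Rightarrow> (nat \<Rightarrow> real) \<Rightarrow> (nat \<Rightarrow> real) \<Rightarrow> nat \<Rightarrow> real" where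
  "filter_out c k y 0 = 0"
| "filter_out c k y (Suc t) = c t * filter_out c k y t + k t * y (Suc t)"

lemma filter_out_cong:
  "(\<And>s. 1 \<le> s \<Longrightarrow> s \<le> t \<Longrightarrow> y s = y' s) \<Longrightarrow> filter_out c k y t = filter_out c k y' t"
proof (induction t)
  case (Suc t)
  have "filter_out c k y t = filter_out c k y' t" "y (Suc t) = y' (Suc t)"
    by (rule Suc.IH, rule Suc.prems, simp_all) (rule Suc.prems, simp_all)
  then show ?case by simp
qed simp

lemma measurable_filter_out: "measurable_receiver (\<lambda>t y. - L * filter_out c k y t)"
proof -
  have "(\<lambda>y. filter_out c k y s) \<in> borel_measurable (PiM {1..t} (\<lambda>_. borel))" if "s \<le> t" for s t
    using that
  proof (induction s)
    case (Suc s)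
    have "(\<lambda>y. filter_out c k y s) \<in> borel_measurable (PiM {1..t} (\<lambda>_. borel))" using Suc by simp
    moreover have "(\<lambda>y. y (Suc s)) \<in> borel_measurable (PiM {1..t} (\<lambda>_. borel :: real measure))"
      using Suc.prems by (intro measurable_component_singleton) simp
    ultimately show ?case unfolding filter_out.simps
      by (intro borel_measurable_add borel_measurable_times borel_measurable_const)
  qed simp
  then show ?thesis unfolding measurable_receiver_def
    by (intro allI impI borel_measurable_times borel_measurable_const) simp
qed

text \<open>Under \<open>u = - L * est\<close> the prediction is \<open>\<alpha> - L\<close> times
  the estimate, so the Kalman update becomes a filter of the measurements alone.\<close>

abbreviation obs_filter :: "real \<Rightarrow> (nat \<Rightarrow> real) \<Rightarrow> nat \<Rightarrow> real" where
  "obs_filter L \<equiv> filter_out (\<lambda>t. (1 - kgain t) * (\<alpha> - L)) kgain"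

definition obs_policy :: "real \<Rightarrow> receiver" where
  "obs_policy L = (\<lambda>t y. - L * obs_filter L y t)"

lemma measurable_obs_policy: "measurable_receiver (obs_policy L)"
  unfolding obs_policy_def by (rule measurable_filter_out)

text \<open>The measurements depend on the very controls computed from them; induction on time shows
  that the filter reproduces \<open>est\<close>.\<close>

lemma obs_policy_control:
  "obs_loop_control (obs_policy L) t \<omega> = - L * est (obs_loop_control (obs_policy L)) t \<omega>"
proof -
  let ?u = "obs_loop_control (obs_policy L)"
  have u: "?u t \<omega> = - L * obs_filter L (\<lambda>s. meas ?u s \<omega>) t" for t
  proof (cases "t = 0")
    case False
    have "obs_filter L (\<lambda>s\<in>{1..t}. meas ?u s \<omega>) t = obs_filter L (\<lambda>s. meas ?u s \<omega>) t"
      by (rule filter_out_cong) simp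
    with False show ?thesis by (subst obs_loop_control_eq) (simp add: obs_policy_def)
  qed (simp add: obs_loop_control_eq)
  have "obs_filter L (\<lambda>s. meas ?u s \<omega>) t = est ?u t \<omega>" for t
  proof (induction t)
    case (Suc t)
    have ut: "?u t \<omega> = - L * est ?u t \<omega>" using u[of t] Suc by simp
    have "obs_filter L (\<lambda>s. meas ?u s \<omega>) (Suc t) = (\<alpha> - L) * est ?u t \<omega> + kgain t * (meas ?u (Suc t) \<omega> - (\<alpha> - L) * est ?u t \<omega>)"
      unfolding filter_out.simps Suc by (simp add: algebra_simps)
    also have "\<dots> = est ?u (Suc t) \<omega>"
      unfolding meas_Suc est.simps ut nu_def by (simp add: algebra_simps)
    finally show ?case .
  qed simp
  then show ?thesis using u by simp
qed

text \<open>The Kalman filter with past controls read from the record. The record starts at time 1,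
  so the control at time 0 is supplied as 0.\<close>

primrec loop_filter :: "(nat \<Rightarrow> real) \<Rightarrow> (nat \<Rightarrow> real) \<Rightarrow> nat \<Rightarrow> real" where
  "loop_filter y u 0 = 0"
| "loop_filter y u (Suc t) = \<alpha> * loop_filter y u t + (if t = 0 then 0 else u t) +
     kgain t * (y (Suc t) - (\<alpha> * loop_filter y u t + (if t = 0 then 0 else u t)))"

text \<open>The receiver's estimate \<open>r\<close> is predicted as
  \<open>\<alpha> * r + u = (\<alpha> - L) * r\<close> and corrected by \<open>rgain\<close> times
  the channel output.\<close>

abbreviation recv_filter :: "real \<Rightarrow> (nat \<Rightarrow> real) \<Rightarrow> nat \<Rightarrow> real" where
  "recv_filter L \<equiv> filter_out (\<lambda>t. \<alpha> - L) rgain"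

text \<open>The observer recovers the previous receiver estimate from the control as \<open>- u / L\<close>.\<close>

definition loop_transmitter :: "real \<Rightarrow> transmitter" where
  "loop_transmitter L t y u =
     (loop_filter y u t - (\<alpha> - L) * (if t \<le> 1 then 0 else - u (t - 1) / L)) / sqrt (pvar (t - 1))"

definition loop_receiver :: "real \<Rightarrow> receiver" where
  "loop_receiver L = (\<lambda>t b. - L * recv_filter L b t)"

lemma loop_filter_cong:
  "(\<And>s. 1 \<le> s \<Longrightarrow> s \<le> t \<Longrightarrow> y s = y' s) \<Longrightarrow> (\<And>s. 1 \<le> s \<Longrightarrow> s < t \<Longrightarrow> u s = u' s) \<Longrightarrow>
    loop_filter y u t = loop_filter y' u' t"
proof (induction t)
  case (Suc t)
  have "loop_filter y u t = loop_filter y' u' t"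
    by (rule Suc.IH; rule Suc.prems) simp_all
  moreover have "y (Suc t) = y' (Suc t)" by (rule Suc.prems) simp_all
  moreover have "t \<noteq> 0 \<Longrightarrow> u t = u' t" by (rule Suc.prems) simp_all
  ultimately show ?case by simp
qed simp

lemma measurable_loop_receiver: "measurable_receiver (loop_receiver L)"
  unfolding loop_receiver_def by (rule measurable_filter_out)

lemma measurable_loop_transmitter: "measurable_transmitter (loop_transmitter L)"
  unfolding measurable_transmitter_def
proof (intro allI impI)
  fix t :: nat assume t: "1 \<le> t"
  let ?N = "PiM {1..t} (\<lambda>_. borel :: real measure) \<Otimes>\<^sub>M PiM {1..<t} (\<lambda>_. borel :: real measure)"
  have y: "(\<lambda>x. fst x s) \<in> borel_measurable ?N" if "1 \<le> s" "s \<le> t" for s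
    using that by (intro measurable_compose[OF measurable_fst measurable_component_singleton]) simp
  have u: "(\<lambda>x. snd x s) \<in> borel_measurable ?N" if "1 \<le> s" "s < t" for s
    using that by (intro measurable_compose[OF measurable_snd measurable_component_singleton]) simp
  have z: "(\<lambda>x. loop_filter (fst x) (snd x) s) \<in> borel_measurable ?N" if "s \<le> t" for s
    using that
  proof (induction s)
    case (Suc s)
    have 1: "(\<lambda>x. loop_filter (fst x) (snd x) s) \<in> borel_measurable ?N" using Suc by simp
    have 2: "(\<lambda>x. if s = 0 then 0 else snd x s) \<in> borel_measurable ?N"
      using u[of s] Suc.prems by (cases "s = 0") auto
    have 3: "(\<lambda>x. fst x (Suc s)) \<in> borel_measurable ?N" using y Suc.prems by simp
    show ?case unfolding loop_filter.simps
      by (intro borel_measurable_add borel_measurable_diff borel_measurable_times borel_measurable_const 1 2 3)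
  qed simp
  have r: "(\<lambda>x. if t \<le> 1 then 0 else - snd x (t - 1) / L) \<in> borel_measurable ?N"
    using u[of "t - 1"] t by (cases "t \<le> 1") auto
  show "(\<lambda>(y, u). loop_transmitter L t y u) \<in> borel_measurable ?N"
    unfolding loop_transmitter_def case_prod_beta
    by (intro borel_measurable_diff borel_measurable_times borel_measurable_divide borel_measurable_const z r) simp
qed

context
  fixes L :: real and u a r :: "nat \<Rightarrow> 'a \<Rightarrow> real"
  assumes L: "L \<noteq> 0"
  defines "u \<equiv> loop_control (loop_transmitter L) (loop_receiver L)"
    and "a \<equiv> loop_input (loop_transmitter L) (loop_receiver L)"
    and "r \<equiv> \<lambda>t \<omega>. recv_filter L (\<lambda>s. a s \<omega> + n s \<omega>) t"
begin

lemma linear_control: "u t \<omega> = - L * r t \<omega>"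
proof (cases "t = 0")
  case True
  then show ?thesis by (simp add: u_def r_def loop_control_0)
next
  case False
  have "recv_filter L (\<lambda>s\<in>{1..t}. a s \<omega> + n s \<omega>) t = recv_filter L (\<lambda>s. a s \<omega> + n s \<omega>) t"
    by (rule filter_out_cong) simp
  then show ?thesis
    using False unfolding u_def by (subst loop_control_eq) (auto simp: loop_receiver_def a_def r_def)
qed

lemma linear_filter: "loop_filter (\<lambda>s. meas u s \<omega>) (\<lambda>s. u s \<omega>) t = est u t \<omega>"
proof (induction t)
  case (Suc t)
  have u0: "(if t = 0 then 0 else u t \<omega>) = u t \<omega>" by (simp add: u_def loop_control_0)
  show ?case unfolding loop_filter.simps u0 Suc meas_Suc est.simps nu_def by (simp add: algebra_simps)
qed simp

text \<open>Both sides predict with \<open>\<alpha> - L\<close>, so the transmitted signal is the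
  receiver's prediction error, scaled to unit variance.\<close>

lemma linear_error_Suc:
  "a (Suc t) \<omega> = (\<alpha> * (est u t \<omega> - r t \<omega>) + nu t \<omega>) / sqrt (pvar t)"
proof -
  have f: "loop_filter (\<lambda>s\<in>{1..Suc t}. meas u s \<omega>) (\<lambda>s\<in>{1..<Suc t}. u s \<omega>) (Suc t) = est u (Suc t) \<omega>"
    unfolding linear_filter[symmetric] by (rule loop_filter_cong) simp_all
  have p: "(if Suc t \<le> 1 then 0 else - (\<lambda>s\<in>{1..<Suc t}. u s \<omega>) (Suc t - 1) / L) = r t \<omega>"
    using L linear_control[of t \<omega>] by (auto simp: r_def)
  have "a (Suc t) \<omega> = loop_transmitter L (Suc t) (\<lambda>s\<in>{1..Suc t}. meas u s \<omega>) (\<lambda>s\<in>{1..<Suc t}. u s \<omega>)"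
    unfolding a_def u_def by (rule loop_input_eq)
  also have "\<dots> = (est u (Suc t) \<omega> - (\<alpha> - L) * r t \<omega>) / sqrt (pvar t)"
    unfolding loop_transmitter_def f p by simp
  also have "est u (Suc t) \<omega> - (\<alpha> - L) * r t \<omega> = \<alpha> * (est u t \<omega> - r t \<omega>) + nu t \<omega>"
    unfolding est.simps linear_control[of t \<omega>] by (simp add: algebra_simps)
  finally show ?thesis .
qed

lemma linear_error:
  shows "(\<lambda>\<omega>. est u 0 \<omega> - r 0 \<omega>) = (\<lambda>\<omega>. 0)"
    and "(\<lambda>\<omega>. est u (Suc t) \<omega> - r (Suc t) \<omega>) =
      (\<lambda>\<omega>. (\<alpha> * (est u t \<omega> - r t \<omega>) + nu t \<omega>) / (1 + SNR) - rgain t * n (Suc t) \<omega>)"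
proof -
  show "(\<lambda>\<omega>. est u 0 \<omega> - r 0 \<omega>) = (\<lambda>\<omega>. 0)" by (simp add: r_def)
  show "(\<lambda>\<omega>. est u (Suc t) \<omega> - r (Suc t) \<omega>) =
      (\<lambda>\<omega>. (\<alpha> * (est u t \<omega> - r t \<omega>) + nu t \<omega>) / (1 + SNR) - rgain t * n (Suc t) \<omega>)"
  proof
    fix \<omega>
    define p where "p = \<alpha> * (est u t \<omega> - r t \<omega>) + nu t \<omega>"
    have rS: "r (Suc t) \<omega> = (\<alpha> - L) * r t \<omega> + rgain t * (a (Suc t) \<omega> + n (Suc t) \<omega>)"
      by (simp add: r_def)
    have "rgain t * a (Suc t) \<omega> = p * (SNR / (1 + SNR))"
      using pvar_pos[of t] unfolding linear_error_Suc p_def[symmetric] rgain_def by simp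
    moreover have "est u (Suc t) \<omega> = (\<alpha> - L) * r t \<omega> + p"
      unfolding est.simps linear_control[of t \<omega>] p_def by (simp add: algebra_simps)
    ultimately have "est u (Suc t) \<omega> - r (Suc t) \<omega> = p - p * (SNR / (1 + SNR)) - rgain t * n (Suc t) \<omega>"
      unfolding rS distrib_left by simp
    also have "p - p * (SNR / (1 + SNR)) = p / (1 + SNR)" using SNR by (simp add: field_simps)
    finally show "est u (Suc t) \<omega> - r (Suc t) \<omega> =
      (\<alpha> * (est u t \<omega> - r t \<omega>) + nu t \<omega>) / (1 + SNR) - rgain t * n (Suc t) \<omega>" unfolding p_def .
  qed
qed

lemmas linear_moments =
  feedback_moments[of "\<lambda>t \<omega>. est u t \<omega> - r t \<omega>", OF linear_error]

lemma linear_power: "m2 (a (Suc t)) = 1"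
  unfolding linear_error_Suc[abs_def] by (rule linear_moments)

lemma linear_admissible:
  assumes "I \<subseteq> {1..}"
  shows "admissible M \<alpha> x0 w v n I (loop_transmitter L) (loop_receiver L)"
  unfolding admissible_def
proof (intro conjI ballI measurable_loop_transmitter measurable_loop_receiver)
  fix t assume "t \<in> I"
  then obtain s where "t = Suc s" using assms by (cases t) auto
  then show "m2 (process (ch_in \<alpha> (loop_transmitter L) (loop_receiver L)) x0 w v n t) \<le> 1"
    using linear_power[of s] by (simp add: a_def loop_input_def)
qed

end

end

section \<open>Optimal costs\<close>

context gaussian_plant begin

lemma stabilizable_imp:
  assumes "stabilizable M \<alpha> x0 w v n"
  shows "\<alpha>\<^sup>2 < 1 + SNR"
proof -
  obtain f g B where ad: "admissible M \<alpha> x0 w v n {1..} f g"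
    and B: "\<And>t. m2 (process (state \<alpha> f g) x0 w v n t) \<le> ennreal B"
    using assms unfolding stabilizable_def by blast
  have fg: "measurable_transmitter f" "measurable_receiver g"
    and pw: "\<And>t. 1 \<le> t \<Longrightarrow> m2 (loop_input f g t) \<le> 1"
    using ad by (auto simp: admissible_def loop_input_def)
  show ?thesis
    by (rule remote_stable_imp[OF loop_remote[OF fg] pw]) (use B in \<open>auto simp: loop_state\<close>)
qed

end

context lqg_plant begin

lemma nvar_bounded: "\<exists>Nm. \<forall>t. nvar t \<le> Nm"
proof -
  obtain Nm where "\<And>t. \<bar>nvar t\<bar> \<le> Nm"
    using convergent_imp_Bseq[of nvar] nvar_lim by (auto simp: convergent_def Bseq_def)
  then show ?thesis by (intro exI[of _ Nm]) (meson abs_le_D1)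
qed

text \<open>The observer's controls are adapted to \<open>hist\<close>, so the general lower bound
  applies. It is met with error 0, because the observer knows \<open>est\<close>.\<close>

lemma obs_optimal_cost_eq:
  "obs_optimal_cost M \<alpha> F Q R x0 w v = ennreal (Q * Pf + S * (P - Pf))"
proof (rule antisym)
  let ?g = "obs_policy Lg"
  let ?u = "obs_loop_control ?g"
  have "obs_optimal_cost M \<alpha> F Q R x0 w v \<le> limsup (\<lambda>T. avg_cost M F Q R T (plant_state ?u) ?u)"
    unfolding obs_optimal_cost_def
  proof (rule Inf_lower, rule CollectI, intro exI conjI allI)
    show "limsup (\<lambda>T. avg_cost M F Q R T (plant_state ?u) ?u) =
      limsup (\<lambda>T. avg_cost M F Q R T
            (\<lambda>t \<omega>. obs_state \<alpha> ((\<lambda>_. ?g) T) (x0 \<omega>) (\<lambda>s. w s \<omega>) (\<lambda>s. v s \<omega>) t)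
            (\<lambda>t \<omega>. obs_control \<alpha> ((\<lambda>_. ?g) T) (x0 \<omega>) (\<lambda>s. w s \<omega>) (\<lambda>s. v s \<omega>) t))"
      by (simp add: obs_loop_state obs_loop_control_def[abs_def])
  qed (rule measurable_obs_policy)
  also have "\<dots> \<le> ennreal (Q * Pf + S * (P - Pf) + cst * (0 * (P - Pf)))"
    by (rule limsup_avg_cost_upper[where e="\<lambda>_ _. 0" and E="\<lambda>_. 0" and Emax=0])
       (auto intro: obs_loop_control_hist measurable_obs_policy simp: obs_policy_control)
  finally show "obs_optimal_cost M \<alpha> F Q R x0 w v \<le> ennreal (Q * Pf + S * (P - Pf))" by simp
next
  show "ennreal (Q * Pf + S * (P - Pf)) \<le> obs_optimal_cost M \<alpha> F Q R x0 w v"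
    unfolding obs_optimal_cost_def
  proof (rule Inf_greatest, safe)
    fix g :: "nat \<Rightarrow> receiver" assume g: "\<forall>T. measurable_receiver (g T)"
    show "ennreal (Q * Pf + S * (P - Pf)) \<le> limsup (\<lambda>T. avg_cost M F Q R T
            (\<lambda>t \<omega>. obs_state \<alpha> (g T) (x0 \<omega>) (\<lambda>s. w s \<omega>) (\<lambda>s. v s \<omega>) t)
            (\<lambda>t \<omega>. obs_control \<alpha> (g T) (x0 \<omega>) (\<lambda>s. w s \<omega>) (\<lambda>s. v s \<omega>) t))"
      using limsup_avg_cost_lower[of "\<lambda>T. obs_loop_control (g T)", OF obs_loop_control_hist] g
      by (simp add: obs_loop_state obs_loop_control_def[abs_def])
  qed
qed

context
  assumes snr: "\<alpha>\<^sup>2 < 1 + SNR"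
begin

lemma linear_loop:
  fixes f :: transmitter and g :: receiver
  defines "f \<equiv> loop_transmitter Lg" and "g \<equiv> loop_receiver Lg"
  shows "\<exists>B\<ge>0. \<forall>t. m2 (plant_state (loop_control f g) t) \<le> ennreal B"
    and "limsup (\<lambda>T. avg_cost M F Q R T (plant_state (loop_control f g)) (loop_control f g)) \<le>
      ennreal (Q * Pf + S * (P - Pf) + cst * (1 / (1 + SNR - \<alpha>\<^sup>2) * (P - Pf)))"
proof -
  let ?u = "loop_control f g"
  let ?e = "\<lambda>t \<omega>. est ?u t \<omega> - recv_filter Lg (\<lambda>s. loop_input f g s \<omega> + n s \<omega>) t"
  have L: "Lg \<noteq> 0" using Lg_pos by simp
  obtain Nm where Nm: "\<And>t. nvar t \<le> Nm" using nvar_bounded by blast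
  have u: "?u t \<in> borel_measurable (hist t)" for t
    unfolding f_def g_def
    by (rule remote_hist[OF loop_remote[OF measurable_loop_transmitter measurable_loop_receiver]])
  have ue: "?u t \<omega> = - Lg * (est ?u t \<omega> - ?e t \<omega>)" for t \<omega>
    using linear_control[OF L, of t \<omega>] by (simp add: f_def g_def)
  have e: "?e t \<in> borel_measurable (hist t)" "m2 (?e t) = ennreal (dvar t)" for t
    unfolding f_def g_def by (rule linear_moments[OF L])+
  show "\<exists>B\<ge>0. \<forall>t. m2 (plant_state ?u t) \<le> ennreal B"
    by (rule plant_state_bounded[OF u ue e dvar_nonneg dvar_bounded[OF snr Nm]])
  show "limsup (\<lambda>T. avg_cost M F Q R T (plant_state ?u) ?u) \<le>
      ennreal (Q * Pf + S * (P - Pf) + cst * (1 / (1 + SNR - \<alpha>\<^sup>2) * (P - Pf)))"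
    by (rule limsup_avg_cost_upper[OF u ue e dvar_nonneg dvar_bounded[OF snr Nm] dvar_sum[OF snr]])
qed

lemma stabilizable_if: "stabilizable M \<alpha> x0 w v n"
proof -
  have L: "Lg \<noteq> 0" using Lg_pos by simp
  show ?thesis
    unfolding stabilizable_def
    using linear_admissible[OF L, of "{1..}"] linear_loop(1) by (auto simp: loop_state)
qed

text \<open>One pair of policies, the same for every horizon, attains the infimum over families
  depending on \<open>T\<close>.\<close>

lemma optimal_cost_eq:
  "optimal_cost M \<alpha> F Q R x0 w v n =
    ennreal (Q * Pf + S * (P - Pf) + cst * (1 / (1 + SNR - \<alpha>\<^sup>2) * (P - Pf)))"
proof (rule antisym)
  let ?f = "loop_transmitter Lg" and ?g = "loop_receiver Lg"
  let ?u = "loop_control ?f ?g"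
  have L: "Lg \<noteq> 0" using Lg_pos by simp
  have "optimal_cost M \<alpha> F Q R x0 w v n \<le> limsup (\<lambda>T. avg_cost M F Q R T (plant_state ?u) ?u)"
    unfolding optimal_cost_def
  proof (rule Inf_lower, rule CollectI, intro exI conjI allI)
    show "limsup (\<lambda>T. avg_cost M F Q R T (plant_state ?u) ?u) =
      limsup (\<lambda>T. avg_cost M F Q R T
            (process (state \<alpha> ((\<lambda>_. ?f) T) ((\<lambda>_. ?g) T)) x0 w v n)
            (process (control \<alpha> ((\<lambda>_. ?f) T) ((\<lambda>_. ?g) T)) x0 w v n))"
      by (simp add: loop_state loop_control_def[abs_def])
  qed (rule linear_admissible[OF L], simp)
  also have "\<dots> \<le> ennreal (Q * Pf + S * (P - Pf) + cst * (1 / (1 + SNR - \<alpha>\<^sup>2) * (P - Pf)))"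
    by (rule linear_loop(2))
  finally show "optimal_cost M \<alpha> F Q R x0 w v n \<le>
    ennreal (Q * Pf + S * (P - Pf) + cst * (1 / (1 + SNR - \<alpha>\<^sup>2) * (P - Pf)))" .
next
  show "ennreal (Q * Pf + S * (P - Pf) + cst * (1 / (1 + SNR - \<alpha>\<^sup>2) * (P - Pf))) \<le>
    optimal_cost M \<alpha> F Q R x0 w v n"
    unfolding optimal_cost_def
  proof (rule Inf_greatest, safe)
    fix f :: "nat \<Rightarrow> transmitter" and g :: "nat \<Rightarrow> receiver"
    assume ad: "\<forall>T. admissible M \<alpha> x0 w v n {1..T} (f T) (g T)"
    have fg: "measurable_transmitter (f T)" "measurable_receiver (g T)" for T
      using ad by (auto simp: admissible_def)
    have pw: "m2 (loop_input (f T) (g T) t) \<le> 1" if "1 \<le> t" "t \<le> T" for T t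
      using ad that by (auto simp: admissible_def loop_input_def)
    show "ennreal (Q * Pf + S * (P - Pf) + cst * (1 / (1 + SNR - \<alpha>\<^sup>2) * (P - Pf))) \<le>
      limsup (\<lambda>T. avg_cost M F Q R T (process (state \<alpha> (f T) (g T)) x0 w v n)
        (process (control \<alpha> (f T) (g T)) x0 w v n))"
      using limsup_avg_cost_remote_lower[of "\<lambda>T. loop_input (f T) (g T)" "\<lambda>T. loop_control (f T) (g T)",
          OF loop_remote[OF fg] pw snr]
      by (simp add: loop_state loop_control_def[abs_def] cst_def)
  qed
qed

end

end

theorem corollary1:
  fixes M :: "'a measure"
    and \<alpha> W V P0 SNR F Q R :: real
    and x0 :: "'a \<Rightarrow> real" and w v n :: "nat \<Rightarrow> 'a \<Rightarrow> real"
  assumes "prob_space M"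
    and "\<alpha> > 1" and "W > 0" and "V \<ge> 0" and "P0 \<ge> 0" and "SNR > 0"
    and "F \<ge> 0" and "Q \<ge> 0" and "R \<ge> 0"
    and "prob_space.indep_vars M (\<lambda>_. borel) (noise_family x0 w v n) UNIV"
    and "distr M borel x0 = centered_normal P0"
    and "\<And>t. distr M borel (w t) = centered_normal W"
    and "\<And>t. distr M borel (v t) = centered_normal V"
    and "\<And>t. distr M borel (n t) = centered_normal (1 / SNR)"
    and "\<And>T t. 1 \<le> t \<Longrightarrow> t \<le> T \<Longrightarrow>
           lqg_S \<alpha> F Q R T (t + 1) + R \<noteq> 0 \<and> lqg_gain \<alpha> F Q R T t \<noteq> 0"
  shows "(stabilizable M \<alpha> x0 w v n \<longleftrightarrow> \<alpha>\<^sup>2 < 1 + SNR) \<and>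
    (\<alpha>\<^sup>2 < 1 + SNR \<longrightarrow>
      (\<exists>!S. S > 0 \<and> S\<^sup>2 - (Q + (\<alpha>\<^sup>2 - 1) * R) * S - Q * R = 0) \<and>
      (\<exists>!P. P > 0 \<and> P\<^sup>2 - ((\<alpha>\<^sup>2 - 1) * V + W) * P - V * W = 0) \<and>
      (\<forall>S P P'. S > 0 \<and> S\<^sup>2 - (Q + (\<alpha>\<^sup>2 - 1) * R) * S - Q * R = 0 \<and>
         P > 0 \<and> P\<^sup>2 - ((\<alpha>\<^sup>2 - 1) * V + W) * P - V * W = 0 \<and>
         P' = P * V / (P + V) \<longrightarrow>
           kalman_pred \<alpha> W V P0 \<longlonglongrightarrow> P \<and>
           kalman_filt \<alpha> W V P0 \<longlonglongrightarrow> P' \<and>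
           obs_optimal_cost M \<alpha> F Q R x0 w v = ennreal (Q * P' + S * (P - P')) \<and>
           optimal_cost M \<alpha> F Q R x0 w v n =
             obs_optimal_cost M \<alpha> F Q R x0 w v +
             ennreal ((Q + (\<alpha>\<^sup>2 - 1) * S) / (1 + SNR - \<alpha>\<^sup>2) * (P - P'))))"
proof -
  have plant: "gaussian_plant M \<alpha> W V P0 SNR x0 w v n"
    by (intro gaussian_plant.intro gaussian_plant_axioms.intro assms(1-6,10-14))
  \<comment> \<open>For \<open>T = t = 1\<close> the gain is \<open>\<alpha> * F / (F + R)\<close>,
    so \<open>F\<close> cannot vanish.\<close>
  have F: "0 < F"
    using assms(15)[of 1 1] assms(7) by (auto simp: lqg_gain_def lqg_S_def less_le)
  \<comment> \<open>For \<open>t = 1\<close> and \<open>T = 2\<close>, \<open>Q = R = 0\<close>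
    would make the denominator of the gain vanish.\<close>
  have QR: "0 < Q \<or> 0 < R"
    using assms(15)[of 1 2] assms(8,9) by (auto simp: lqg_S_def less_le)
  have S1: "\<exists>!S. S > 0 \<and> S\<^sup>2 - (Q + (\<alpha>\<^sup>2 - 1) * R) * S - Q * R = 0"
    by (rule riccati_root[OF assms(2,8,9) QR])
  have P1: "\<exists>!P. P > 0 \<and> P\<^sup>2 - ((\<alpha>\<^sup>2 - 1) * V + W) * P - V * W = 0"
    using riccati_root[OF assms(2) less_imp_le[OF assms(3)] assms(4) disjI1[OF assms(3)]]
    by (simp add: add.commute mult.commute)
  have lqg: "lqg_plant M \<alpha> W V P0 SNR x0 w v n F Q R S P"
    if "S > 0" "S\<^sup>2 - (Q + (\<alpha>\<^sup>2 - 1) * R) * S - Q * R = 0"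
      "P > 0" "P\<^sup>2 - ((\<alpha>\<^sup>2 - 1) * V + W) * P - V * W = 0" for S P
    by (intro lqg_plant.intro plant lqg_plant_axioms.intro F assms(8,9) QR that)
  have "stabilizable M \<alpha> x0 w v n \<longleftrightarrow> \<alpha>\<^sup>2 < 1 + SNR"
  proof
    assume "stabilizable M \<alpha> x0 w v n"
    then show "\<alpha>\<^sup>2 < 1 + SNR" by (rule gaussian_plant.stabilizable_imp[OF plant])
  next
    assume snr: "\<alpha>\<^sup>2 < 1 + SNR"
    \<comment> \<open>The stabilizing gain is the stationary LQG gain built from
      \<open>S\<close>.\<close>
    obtain S P where "S > 0" "S\<^sup>2 - (Q + (\<alpha>\<^sup>2 - 1) * R) * S - Q * R = 0"
      "P > 0" "P\<^sup>2 - ((\<alpha>\<^sup>2 - 1) * V + W) * P - V * W = 0"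
      using S1 P1 by blast
    then show "stabilizable M \<alpha> x0 w v n" by (rule lqg_plant.stabilizable_if[OF lqg snr])
  qed
  moreover have "kalman_pred \<alpha> W V P0 \<longlonglongrightarrow> P \<and>
           kalman_filt \<alpha> W V P0 \<longlonglongrightarrow> P' \<and>
           obs_optimal_cost M \<alpha> F Q R x0 w v = ennreal (Q * P' + S * (P - P')) \<and>
           optimal_cost M \<alpha> F Q R x0 w v n =
             obs_optimal_cost M \<alpha> F Q R x0 w v +
             ennreal ((Q + (\<alpha>\<^sup>2 - 1) * S) / (1 + SNR - \<alpha>\<^sup>2) * (P - P'))"
    if snr: "\<alpha>\<^sup>2 < 1 + SNR" and S: "S > 0" "S\<^sup>2 - (Q + (\<alpha>\<^sup>2 - 1) * R) * S - Q * R = 0"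
      and P: "P > 0" "P\<^sup>2 - ((\<alpha>\<^sup>2 - 1) * V + W) * P - V * W = 0"
      and P': "P' = P * V / (P + V)" for S P P'
  proof -
    interpret lqg_plant M \<alpha> W V P0 SNR x0 w v n F Q R S P by (rule lqg[OF S P])
    have Pf: "Pf = P'" by (simp add: Pf_def P')
    have n1: "0 \<le> Q * P' + S * (P - P')"
      using Pf_less assms(8) S by (simp add: Pf)
    have n2: "0 \<le> (Q + (\<alpha>\<^sup>2 - 1) * S) / (1 + SNR - \<alpha>\<^sup>2) * (P - P')"
      using Pf_less(2) cst_pos snr by (simp add: Pf cst_def)
    have "optimal_cost M \<alpha> F Q R x0 w v n =
        ennreal (Q * P' + S * (P - P') + (Q + (\<alpha>\<^sup>2 - 1) * S) / (1 + SNR - \<alpha>\<^sup>2) * (P - P'))"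
      unfolding optimal_cost_eq[OF snr] by (simp add: Pf cst_def)
    also have "\<dots> = ennreal (Q * P' + S * (P - P')) + ennreal ((Q + (\<alpha>\<^sup>2 - 1) * S) / (1 + SNR - \<alpha>\<^sup>2) * (P - P'))"
      by (rule ennreal_plus[OF n1 n2])
    finally show ?thesis
      using pred_lim filt_lim obs_optimal_cost_eq by (simp add: Pf)
  qed
  ultimately show ?thesis using S1 P1 by blast
qed

end
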